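(* Let $f_1,f_2$ be nonzero tempered distributions on $\mathbb{R}^d$ with discrete supports $\Lambda_1,\Lambda_2$, respectively, such that $\Lambda_1-\Lambda_2=\{\lambda-\lambda':\lambda\in\Lambda_1,\ \lambda'\in\Lambda_2\}$ is a discrete set and $$\inf_{\lambda\in\Lambda_j}\kappa_{f_j}(\lambda)>0,\qquad j=1,2.$$ Suppose that $\hat f_1,\hat f_2$ are both measures with countable supports (i.e. $\hat f_j=\sum_{\gamma\in\Gamma_j}q^{(j)}_\gamma\delta_\gamma$ with $\Gamma_j\subset\mathbb{R}^d$ countable and $q^{(j)}_\gamma\in\mathbb{C}$) such that, for some $T<\infty$, $$\rho_{\hat f_1}(r)+\rho_{\hat f_2}(r)=O(r^T),\qquad r\to\infty.$$ Then there is one and the same full-rank lattice $L\subset\mathbb{R}^d$ such that both $\Lambda_1$ and $\Lambda_2$ are pure crystals with respect to $L$.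
   Context: $S(\mathbb{R}^d)$ is the Schwartz space, $S^*(\mathbb{R}^d)$ the space of tempered distributions. Fourier transform: $\hat\varphi(y)=\int_{\mathbb{R}^d}\varphi(x)e^{-2\pi i\langle x,y\rangle}dx$ and $\hat f(\varphi)=f(\hat\varphi)$ for $\varphi\in S(\mathbb{R}^d)$. A set $A\subset\mathbb{R}^d$ is discrete if it has no finite limit points. For a multi-index $k\in(\mathbb{N}\cup\{0\})^d$, $\|k\|=k_1+\dots+k_d$; $\delta_\lambda$ is the unit mass at $\lambda$. Every tempered distribution $f$ with discrete support $\Lambda$ has the form $f=\sum_{\lambda\in\Lambda}\sum_{\|k\|\le m}p_{\lambda,k}D^k\delta_\lambda$ with $p_{\lambda,k}\in\mathbb{C}$ and some finite $m$ ($m=\operatorname{ord} f$ is the smallest such number). For such $f$ put $\kappa_f(\lambda)=\sup_{\|k\|\le m}|p_{\lambda,k}|$. For a measure $\hat f=\sum_{\gamma\in\Gamma}q_\gamma\delta_\gamma$ with countable $\Gamma$ ($\Gamma$ is then called its support, even if it is not closed), $\rho_{\hat f}(r)=\sum_{\gamma\in\Gamma,\,|\gamma|<r}|q_\gamma|$. A full-rank lattice is a set $L=T\mathbb{Z}^d$ with $T$ a nondegenerate linear operator on $\mathbb{R}^d$. A set $A\subset\mathbb{R}^d$ is a pure crystal with respect to $L$ if it is a finite union of cosets (translates) of $L$. *)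

theory Defs
  imports "HOL-Analysis.Analysis" "HOL-Library.Landau_Symbols"
begin

section \<open>Smooth functions and Schwartz functions on the Euclidean space indexed by a finite type\<close>

definition partial_deriv :: "'n \<Rightarrow> (real ^ 'n \<Rightarrow> complex) \<Rightarrow> real ^ 'n \<Rightarrow> complex"
  where "partial_deriv i \<phi> = (\<lambda>x. frechet_derivative \<phi> (at x) (axis i 1))"

text \<open>All iterated partial derivatives exist and are totally differentiable (hence continuous),
  so this is the class of infinitely differentiable functions.\<close>

definition smooth :: "(real ^ 'n \<Rightarrow> complex) \<Rightarrow> bool"
  where "smooth \<phi> \<longleftrightarrow> (\<forall>is. foldr partial_deriv is \<phi> differentiable_on UNIV)"

type_synonym 'n multi_index = "'n \<Rightarrow> nat"

definition mi_size :: "('n::finite) multi_index \<Rightarrow> nat"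
  where "mi_size k = (\<Sum>i\<in>UNIV. k i)"

text \<open>An arbitrary enumeration of the coordinates, used only to fix the order of differentiation
  in \<open>mi_deriv\<close>; on smooth functions the partial derivatives commute.\<close>

definition index_list :: "('n::finite) list"
  where "index_list = (SOME is. distinct is \<and> set is = UNIV)"

definition mi_deriv :: "('n::finite) multi_index \<Rightarrow> (real ^ 'n \<Rightarrow> complex) \<Rightarrow> real ^ 'n \<Rightarrow> complex"
  where "mi_deriv k \<phi> = foldr (\<lambda>i. partial_deriv i ^^ k i) index_list \<phi>"

definition schwartz :: "(real ^ 'n::finite \<Rightarrow> complex) set"
  where "schwartz = {\<phi>. smooth \<phi> \<and>
    (\<forall>n k. bdd_above (range (\<lambda>x. (1 + norm x) ^ n * norm (mi_deriv k \<phi> x))))}"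

definition schwartz_norm :: "nat \<Rightarrow> nat \<Rightarrow> (real ^ 'n::finite \<Rightarrow> complex) \<Rightarrow> real"
  where "schwartz_norm n m \<phi> =
    (SUP (x, k) \<in> UNIV \<times> {k. mi_size k \<le> m}. (1 + norm x) ^ n * norm (mi_deriv k \<phi> x))"

definition fun_support :: "(real ^ 'n::finite \<Rightarrow> complex) \<Rightarrow> (real ^ 'n) set"
  where "fun_support \<phi> = closure {x. \<phi> x \<noteq> 0}"

definition test_fun :: "(real ^ 'n::finite \<Rightarrow> complex) set"
  where "test_fun = {\<phi>. smooth \<phi> \<and> compact (fun_support \<phi>)}"


section \<open>Tempered distributions\<close>

text \<open>A functional is represented by a map on all functions; only its values on \<open>schwartz\<close>
  are meaningful.\<close>

type_synonym 'n functional = "(real ^ 'n \<Rightarrow> complex) \<Rightarrow> complex"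

text \<open>Continuity for the topology of the (directed) family of norms \<open>schwartz_norm n m\<close> is
  expressed as domination by one of these norms.\<close>

definition tempered :: "('n::finite) functional \<Rightarrow> bool"
  where "tempered f \<longleftrightarrow>
    (\<forall>\<phi>\<in>schwartz. \<forall>\<psi>\<in>schwartz. f (\<lambda>x. \<phi> x + \<psi> x) = f \<phi> + f \<psi>) \<and>
    (\<forall>c. \<forall>\<phi>\<in>schwartz. f (\<lambda>x. c * \<phi> x) = c * f \<phi>) \<and>
    (\<exists>C n m. \<forall>\<phi>\<in>schwartz. norm (f \<phi>) \<le> C * schwartz_norm n m \<phi>)"

definition nonzero_dist :: "('n::finite) functional \<Rightarrow> bool"
  where "nonzero_dist f \<longleftrightarrow> (\<exists>\<phi>\<in>schwartz. f \<phi> \<noteq> 0)"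

definition dist_support :: "('n::finite) functional \<Rightarrow> (real ^ 'n) set"
  where "dist_support f =
    {x. \<forall>U. open U \<longrightarrow> x \<in> U \<longrightarrow> (\<exists>\<phi>\<in>test_fun. fun_support \<phi> \<subseteq> U \<and> f \<phi> \<noteq> 0)}"

definition dirac :: "real ^ 'n \<Rightarrow> ('n::finite) functional"
  where "dirac l = (\<lambda>\<phi>. \<phi> l)"

definition dist_deriv :: "('n::finite) multi_index \<Rightarrow> 'n functional \<Rightarrow> 'n functional"
  where "dist_deriv k f = (\<lambda>\<phi>. (- 1) ^ mi_size k * f (mi_deriv k \<phi>))"

definition fourier :: "(real ^ 'n::finite \<Rightarrow> complex) \<Rightarrow> real ^ 'n \<Rightarrow> complex"
  where "fourier \<phi> y =
    (\<integral>x. \<phi> x * exp (- (2 * of_real pi * \<i> * of_real (x \<bullet> y))) \<partial>lborel)"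

definition dist_fourier :: "('n::finite) functional \<Rightarrow> 'n functional"
  where "dist_fourier f = (\<lambda>\<phi>. f (fourier \<phi>))"


section \<open>Distributions with discrete support\<close>

definition discrete_set :: "'a::topological_space set \<Rightarrow> bool"
  where "discrete_set A \<longleftrightarrow> (\<forall>x. \<not> x islimpt A)"

text \<open>The expansion of \<open>f\<close> into derivatives of point masses at the points of its support. The
  identity is one of distributions, i.e. it is tested on compactly supported smooth functions,
  where only finitely many points of a discrete support contribute; on a general Schwartz function
  the series need not converge unconditionally. By density it still determines a tempered \<open>f\<close>.\<close>

definition point_expansion ::
    "('n::finite) functional \<Rightarrow> nat \<Rightarrow> (real ^ 'n \<Rightarrow> 'n multi_index \<Rightarrow> complex) \<Rightarrow> bool"
  where "point_expansion f m p \<longleftrightarrow>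
    (\<forall>\<phi>\<in>test_fun.
      ((\<lambda>l. \<Sum>k | mi_size k \<le> m. p l k * dist_deriv k (dirac l) \<phi>) has_sum f \<phi>)
        (dist_support f))"

definition dist_ord :: "('n::finite) functional \<Rightarrow> nat"
  where "dist_ord f = (LEAST m. \<exists>p. point_expansion f m p)"

text \<open>The coefficients \<open>dist_coeff f l k\<close> are uniquely determined for \<open>l\<close> in a discrete support
  and \<open>mi_size k \<le> dist_ord f\<close>; all other values are irrelevant.\<close>

definition dist_coeff :: "('n::finite) functional \<Rightarrow> real ^ 'n \<Rightarrow> 'n multi_index \<Rightarrow> complex"
  where "dist_coeff f = (SOME p. point_expansion f (dist_ord f) p)"

definition kappa :: "('n::finite) functional \<Rightarrow> real ^ 'n \<Rightarrow> real"
  where "kappa f l = (SUP k \<in> {k. mi_size k \<le> dist_ord f}. norm (dist_coeff f l k))"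


section \<open>Purely atomic measures\<close>

text \<open>\<open>f\<close> is the measure with masses \<open>q \<gamma>\<close> at the points \<open>\<gamma> \<in> \<Gamma>\<close>. The summability condition says
  that the total variation is finite on bounded sets; it also makes \<open>mass_growth\<close> below meaningful,
  since \<open>infsum\<close> is 0 on families that are not summable.\<close>

definition is_atomic_measure ::
    "('n::finite) functional \<Rightarrow> (real ^ 'n) set \<Rightarrow> (real ^ 'n \<Rightarrow> complex) \<Rightarrow> bool"
  where "is_atomic_measure f \<Gamma> q \<longleftrightarrow>
    countable \<Gamma> \<and>
    (\<forall>r. (\<lambda>\<gamma>. norm (q \<gamma>)) summable_on {\<gamma>\<in>\<Gamma>. norm \<gamma> < r}) \<and>
    (\<forall>\<phi>\<in>test_fun. ((\<lambda>\<gamma>. q \<gamma> * dirac \<gamma> \<phi>) has_sum f \<phi>) \<Gamma>)"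

definition mass_growth :: "(real ^ 'n::finite) set \<Rightarrow> (real ^ 'n \<Rightarrow> complex) \<Rightarrow> real \<Rightarrow> real"
  where "mass_growth \<Gamma> q r = (\<Sum>\<^sub>\<infinity>\<gamma>\<in>{\<gamma>\<in>\<Gamma>. norm \<gamma> < r}. norm (q \<gamma>))"


section \<open>Lattices and pure crystals\<close>

definition full_rank_lattice :: "(real ^ 'n::finite) set \<Rightarrow> bool"
  where "full_rank_lattice L \<longleftrightarrow>
    (\<exists>T :: real ^ 'n \<Rightarrow> real ^ 'n. linear T \<and> bij T \<and> L = T ` {x. \<forall>i. x $ i \<in> \<int>})"

definition pure_crystal :: "(real ^ 'n::finite) set \<Rightarrow> (real ^ 'n) set \<Rightarrow> bool"
  where "pure_crystal L A \<longleftrightarrow> (\<exists>F. finite F \<and> A = (\<Union>c\<in>F. (\<lambda>x. c + x) ` L))"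

end

theory Submission imports Defs
begin

text \<open>Since \<open>\<rho>\<close> grows polynomially, pairing \<open>f\<^sub>j\<close> with the translates of a test function gives an
  absolutely convergent exponential series, hence an almost periodic function. Test functions dual to
  the derivatives at a point read off the coefficients of \<open>f\<^sub>j\<close>; as these are bounded below, for a common
  almost period \<open>\<tau>\<close> every \<open>\<lambda> + \<tau>\<close> with \<open>\<lambda> \<in> \<Lambda>\<^sub>j\<close> lies near a point of \<open>\<Lambda>\<^sub>j\<close>. The differences
  \<open>\<lambda> - \<lambda>'\<close> of neighbouring points \<open>\<lambda> \<in> \<Lambda>\<^sub>1\<close>, \<open>\<lambda>' \<in> \<Lambda>\<^sub>2\<close> form a finite set, so neighbours are displaced by
  the same vector, and by connecting points through neighbours \<open>\<tau>\<close> is close to a period of both sets.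
  The common periods thus form a discrete relatively dense subgroup, i.e. a lattice.\<close>

subsection \<open>Smooth functions\<close>

text \<open>The formula for the transform of \<open>f\<close> holds on compactly supported functions
  only, while the series for \<open>f \<phi>\<close> samples \<open>inv_fourier \<phi>\<close>,
  whose support is in general not compact. A cutoff \<open>\<theta>\<close> dilated by
  \<open>N\<close> bridges the gap: after the transform it acts as an approximate identity, and the
  limit gives the series up to the factor \<open>\<theta> 0 / c\<close>, with \<open>c\<close> the
  integral of \<open>fourier \<theta>\<close>; any nonzero \<open>c\<close> will do. The bound on
  \<open>kappa\<close> concerns \<open>dist_ord\<close> and \<open>dist_coeff\<close>, a minimum and
  a choice, which carry no information until some expansion exists. Hence the structure theorem for
  discrete supports, with one order for all points. Which coefficient is large varies from point to
  point, but only finitely many multi-indices occur, so finitely many dual functions suffice and one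
  almost period serves them all and both distributions. Matching by nearby points maps a support
  into itself, not yet onto. With \<open>\<tau>\<close> also \<open>- \<tau>\<close> is an almost
  period, and separation of the points makes the two resulting translations inverse to each
  other.\<close>

abbreviation pderivs :: "'n list \<Rightarrow> (real ^ 'n::finite \<Rightarrow> complex) \<Rightarrow> real ^ 'n \<Rightarrow> complex"
  where "pderivs is \<equiv> foldr partial_deriv is"

lemma partial_deriv_eqI:
  "(\<phi> has_derivative D) (at x) \<Longrightarrow> partial_deriv i \<phi> x = D (axis i 1)"
  unfolding partial_deriv_def by (metis frechet_derivative_at)

text \<open>Functions that agree near \<open>x\<close> have the same set of derivatives there, so
  the choice in \<open>frechet_derivative\<close> returns the same value, even at points where there
  is no derivative.\<close>

lemma partial_deriv_local:
  assumes "open U" "x \<in> U" "\<And>y. y \<in> U \<Longrightarrow> \<phi> y = \<psi> y"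
  shows "partial_deriv i \<phi> x = partial_deriv i \<psi> x"
proof -
  have "(\<phi> has_derivative D) (at x) \<longleftrightarrow> (\<psi> has_derivative D) (at x)" for D
    using has_derivative_transform_within_open[of \<phi> D x UNIV U \<psi>]
      has_derivative_transform_within_open[of \<psi> D x UNIV U \<phi>] assms by auto
  then show ?thesis unfolding partial_deriv_def frechet_derivative_def by simp
qed

lemma pderivs_local:
  assumes "open U" "x \<in> U" "\<And>y. y \<in> U \<Longrightarrow> \<phi> y = \<psi> y"
  shows "pderivs is \<phi> x = pderivs is \<psi> x"
proof -
  have "\<forall>y\<in>U. pderivs is \<phi> y = pderivs is \<psi> y"
  proof (induction "is")
    case Nil then show ?case using assms by simp
  next
    case (Cons i "is")
    then have "partial_deriv i (pderivs is \<phi>) y = partial_deriv i (pderivs is \<psi>) y" if "y \<in> U" for y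
      using partial_deriv_local[OF assms(1) that] by blast
    then show ?case by simp
  qed
  then show ?thesis using assms by auto
qed

lemma smooth_differentiable: assumes "smooth \<phi>" shows "\<phi> differentiable (at x)"
proof -
  have "pderivs [] \<phi> differentiable_on UNIV" using assms unfolding smooth_def by blast
  then show ?thesis by (simp add: differentiable_on_def)
qed

lemma smooth_pderivs: assumes "smooth \<phi>" shows "smooth (pderivs is \<phi>)"
proof -
  have "pderivs js (pderivs is \<phi>) = pderivs (js @ is) \<phi>" for js by simp
  then show ?thesis using assms unfolding smooth_def by metis
qed

lemma smooth_partial_deriv: "smooth \<phi> \<Longrightarrow> smooth (partial_deriv i \<phi>)"
  using smooth_pderivs[of \<phi> "[i]"] by simp

text \<open>Coinduction principle: guessing a family that is closed under differentiation replaces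
  closed formulas for the iterated derivatives of products, compositions and integrals.\<close>

lemma smooth_coinduct:
  assumes "\<phi> \<in> S" "\<And>\<psi> x. \<psi> \<in> S \<Longrightarrow> \<psi> differentiable (at x)"
    "\<And>\<psi> i. \<psi> \<in> S \<Longrightarrow> partial_deriv i \<psi> \<in> S"
  shows "smooth \<phi>"
proof -
  have "pderivs is \<phi> \<in> S" for "is" by (induction "is") (use assms in auto)
  then show ?thesis using assms(2) unfolding smooth_def differentiable_on_def by blast
qed

lemma smooth_has_derivative:
  "smooth \<phi> \<Longrightarrow> (\<phi> has_derivative frechet_derivative \<phi> (at x)) (at x)"
  using frechet_derivative_works smooth_differentiable by blast

lemma has_derivative_partial_derivs:
  fixes \<phi> :: "real ^ 'n::finite \<Rightarrow> complex"
  assumes "\<phi> differentiable (at x)"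
  shows "(\<phi> has_derivative (\<lambda>v. \<Sum>i\<in>UNIV. v $ i *\<^sub>R partial_deriv i \<phi> x)) (at x)"
proof -
  define D where "D = frechet_derivative \<phi> (at x)"
  have D: "(\<phi> has_derivative D) (at x)" using assms frechet_derivative_works D_def by blast
  then have l: "linear D" using has_derivative_linear by blast
  have "D v = (\<Sum>i\<in>UNIV. v $ i *\<^sub>R partial_deriv i \<phi> x)" for v
  proof -
    have "D v = D (\<Sum>i\<in>UNIV. v $ i *\<^sub>R axis i 1)"
      using basis_expansion[of v] by (simp add: scalar_mult_eq_scaleR)
    also have "\<dots> = (\<Sum>i\<in>UNIV. v $ i *\<^sub>R D (axis i 1))"
      by (simp add: linear_sum[OF l] linear_cmul[OF l])
    finally show ?thesis unfolding D_def partial_deriv_def .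
  qed
  then show ?thesis using D by presburger
qed

lemma has_derivative_partial_derivs_smooth:
  "smooth \<phi> \<Longrightarrow> (\<phi> has_derivative (\<lambda>v. \<Sum>i\<in>UNIV. v $ i *\<^sub>R partial_deriv i \<phi> x)) (at x)"
  using has_derivative_partial_derivs smooth_differentiable by blast

section \<open>Rules for partial derivatives\<close>

lemma partial_deriv_add:
  assumes "\<And>x. \<phi> differentiable (at x)" "\<And>x. \<psi> differentiable (at x)"
  shows "partial_deriv i (\<lambda>x. \<phi> x + \<psi> x) = (\<lambda>x. partial_deriv i \<phi> x + partial_deriv i \<psi> x)"
proof
  fix x
  show "partial_deriv i (\<lambda>x. \<phi> x + \<psi> x) x = partial_deriv i \<phi> x + partial_deriv i \<psi> x"
    using partial_deriv_eqI[OF has_derivative_add[of \<phi> "frechet_derivative \<phi> (at x)" _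
        \<psi> "frechet_derivative \<psi> (at x)"]] assms
    by (simp add: frechet_derivative_works[symmetric] partial_deriv_def)
qed

lemma partial_deriv_mult:
  assumes "\<And>x. \<phi> differentiable (at x)" "\<And>x. \<psi> differentiable (at x)"
  shows "partial_deriv i (\<lambda>x. \<phi> x * \<psi> x) =
    (\<lambda>x. partial_deriv i \<phi> x * \<psi> x + \<phi> x * partial_deriv i \<psi> x)"
proof
  fix x
  show "partial_deriv i (\<lambda>x. \<phi> x * \<psi> x) x =
      partial_deriv i \<phi> x * \<psi> x + \<phi> x * partial_deriv i \<psi> x"
    using partial_deriv_eqI[OF has_derivative_mult[of \<phi> "frechet_derivative \<phi> (at x)" _ _
        \<psi> "frechet_derivative \<psi> (at x)"]] assms
    by (simp add: frechet_derivative_works[symmetric] partial_deriv_def)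
qed

lemma partial_deriv_const: "partial_deriv i (\<lambda>x. c) = (\<lambda>x. 0)"
  by (rule ext, subst partial_deriv_eqI[OF has_derivative_const]) auto

lemma partial_deriv_affine:
  fixes \<phi> :: "real ^ 'n::finite \<Rightarrow> complex"
  assumes "smooth \<phi>"
  shows "partial_deriv i (\<lambda>x. \<phi> (a + s *\<^sub>R x)) = (\<lambda>x. of_real s * partial_deriv i \<phi> (a + s *\<^sub>R x))"
proof
  fix x :: "real ^ 'n"
  let ?D = "frechet_derivative \<phi> (at (a + s *\<^sub>R x))"
  have D: "(\<phi> has_derivative ?D) (at (a + s *\<^sub>R x))" using smooth_has_derivative[OF assms] .
  have "((\<lambda>x. a + s *\<^sub>R x) has_derivative (\<lambda>v. s *\<^sub>R v)) (at x)"
    by (auto intro!: derivative_eq_intros)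
  from has_derivative_compose[OF this D]
  have "((\<lambda>x. \<phi> (a + s *\<^sub>R x)) has_derivative (\<lambda>v. ?D (s *\<^sub>R v))) (at x)" .
  then have "partial_deriv i (\<lambda>x. \<phi> (a + s *\<^sub>R x)) x = ?D (s *\<^sub>R axis i 1)"
    using partial_deriv_eqI by fast
  also have "\<dots> = of_real s * ?D (axis i 1)"
    using linear_cmul[OF has_derivative_linear[OF D]] by (simp add: scaleR_conv_of_real)
  finally show "partial_deriv i (\<lambda>x. \<phi> (a + s *\<^sub>R x)) x = of_real s * partial_deriv i \<phi> (a + s *\<^sub>R x)"
    unfolding partial_deriv_def .
qed

lemma pderivs_add:
  assumes "smooth \<phi>" "smooth \<psi>"
  shows "pderivs is (\<lambda>x. \<phi> x + \<psi> x) = (\<lambda>x. pderivs is \<phi> x + pderivs is \<psi> x)"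
proof (induction "is")
  case (Cons i "is")
  then show ?case
    using partial_deriv_add[of "pderivs is \<phi>" "pderivs is \<psi>"] assms
    by (auto simp: smooth_pderivs smooth_differentiable)
qed simp

lemma smooth_const: "smooth (\<lambda>x. c)"
  by (rule smooth_coinduct[of _ "range (\<lambda>c x. c)"]) (auto simp: partial_deriv_const)

inductive_set product_sums :: "(real ^ 'n::finite \<Rightarrow> complex) set" where
  prod: "smooth \<phi> \<Longrightarrow> smooth \<psi> \<Longrightarrow> (\<lambda>x. \<phi> x * \<psi> x) \<in> product_sums"
| add: "\<phi> \<in> product_sums \<Longrightarrow> \<psi> \<in> product_sums \<Longrightarrow> (\<lambda>x. \<phi> x + \<psi> x) \<in> product_sums"

lemma product_sums_partial_deriv:
  assumes "\<phi> \<in> product_sums"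
  shows "(\<forall>x. \<phi> differentiable (at x)) \<and> (\<forall>i. partial_deriv i \<phi> \<in> product_sums)"
  using assms
proof induction
  case (prod \<phi> \<psi>)
  then have d: "\<And>x. \<phi> differentiable (at x)" "\<And>x. \<psi> differentiable (at x)"
    using smooth_differentiable by blast+
  show ?case unfolding partial_deriv_mult[OF d]
    using d prod by (auto intro!: differentiable_mult product_sums.intros smooth_partial_deriv)
next
  case (add \<phi> \<psi>)
  then have d: "\<And>x. \<phi> differentiable (at x)" "\<And>x. \<psi> differentiable (at x)" by blast+
  show ?case unfolding partial_deriv_add[OF d]
    using d add by (auto intro!: differentiable_add product_sums.intros)
qed

lemma smooth_mult:
  assumes "smooth \<phi>" "smooth \<psi>" shows "smooth (\<lambda>x. \<phi> x * \<psi> x)"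
  using smooth_coinduct[OF product_sums.prod[OF assms]] product_sums_partial_deriv by blast

lemma smooth_add:
  assumes "smooth \<phi>" "smooth \<psi>" shows "smooth (\<lambda>x. \<phi> x + \<psi> x)"
  \<comment> \<open>The summands are written as products with the constant 1, which puts the sum
    into \<open>product_sums\<close>.\<close>
  using smooth_coinduct[OF product_sums.add[OF product_sums.prod product_sums.prod,
      OF assms(1) smooth_const[of 1] assms(2) smooth_const[of 1]]]
    product_sums_partial_deriv by auto

lemma smooth_cmult: "smooth \<phi> \<Longrightarrow> smooth (\<lambda>x. c * \<phi> x)"
  using smooth_mult[OF smooth_const] .

lemma smooth_diff: "smooth \<phi> \<Longrightarrow> smooth \<psi> \<Longrightarrow> smooth (\<lambda>x. \<phi> x - \<psi> x)"
  using smooth_add[OF _ smooth_cmult[of \<psi> "-1"], of \<phi>] by simp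

lemma smooth_sum:
  "(\<And>j. j \<in> J \<Longrightarrow> smooth (\<phi> j)) \<Longrightarrow> smooth (\<lambda>x. \<Sum>j\<in>J. \<phi> j x)"
  by (induction J rule: infinite_finite_induct) (auto simp: smooth_const smooth_add)

lemma smooth_affine:
  fixes \<phi> :: "real ^ 'n::finite \<Rightarrow> complex"
  assumes "smooth \<phi>" shows "smooth (\<lambda>x. \<phi> (a + s *\<^sub>R x))"
\<comment> \<open>The scalar \<open>c\<close> collects the factors \<open>s\<close> that successive
  derivatives produce.\<close>
proof (rule smooth_coinduct[of _ "{\<lambda>x. c * \<psi> (a + s *\<^sub>R x) | c \<psi>. smooth \<psi>}"])
  show "(\<lambda>x. \<phi> (a + s *\<^sub>R x)) \<in> {\<lambda>x. c * \<psi> (a + s *\<^sub>R x) |c \<psi>. smooth \<psi>}"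
    using assms by (intro CollectI exI[of _ 1] exI[of _ \<phi>]) auto
next
  fix \<rho> :: "real ^ 'n \<Rightarrow> complex" and x i
  assume "\<rho> \<in> {\<lambda>x. c * \<psi> (a + s *\<^sub>R x) |c \<psi>. smooth \<psi>}"
  then obtain c \<psi> where r: "\<rho> = (\<lambda>x. c * \<psi> (a + s *\<^sub>R x))" "smooth \<psi>" by blast
  then have 1: "\<rho> = (\<lambda>x. (\<lambda>y. c * \<psi> y) (a + s *\<^sub>R x))" and 2: "smooth (\<lambda>y. c * \<psi> y)"
    by (auto simp: smooth_cmult)
  have lin: "((\<lambda>x. a + s *\<^sub>R x) has_derivative (\<lambda>v. s *\<^sub>R v)) (at x)"
    by (auto intro!: derivative_eq_intros)
  obtain D where D: "((\<lambda>y. c * \<psi> y) has_derivative D) (at (a + s *\<^sub>R x))"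
    using smooth_has_derivative[OF 2] by blast
  have "((\<lambda>x. (\<lambda>y. c * \<psi> y) (a + s *\<^sub>R x)) has_derivative (\<lambda>v. D (s *\<^sub>R v))) (at x)"
    using has_derivative_compose[OF lin D] .
  then show "\<rho> differentiable (at x)" unfolding 1 differentiable_def by blast
  show "partial_deriv i \<rho> \<in> {\<lambda>x. c * \<psi> (a + s *\<^sub>R x) |c \<psi>. smooth \<psi>}"
    using partial_deriv_affine[OF 2, of i a s] smooth_partial_deriv[OF 2, of i] unfolding r
    by (intro CollectI exI[of _ "of_real s"] exI[of _ "partial_deriv i (\<lambda>y. c * \<psi> y)"]) auto
qed

lemma pderivs_affine:
  assumes "smooth \<phi>"
  shows "pderivs is (\<lambda>x. \<phi> (a + s *\<^sub>R x)) = (\<lambda>x. of_real s ^ length is * pderivs is \<phi> (a + s *\<^sub>R x))"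
proof (induction "is")
  case (Cons i "is")
  let ?c = "of_real s ^ length is"
  have "partial_deriv i (\<lambda>x. (\<lambda>y. ?c * pderivs is \<phi> y) (a + s *\<^sub>R x)) =
      (\<lambda>x. of_real s * partial_deriv i (\<lambda>y. ?c * pderivs is \<phi> y) (a + s *\<^sub>R x))"
    by (intro partial_deriv_affine smooth_cmult smooth_pderivs assms)
  moreover have "partial_deriv i (\<lambda>y. ?c * pderivs is \<phi> y) = (\<lambda>y. ?c * partial_deriv i (pderivs is \<phi>) y)"
    using partial_deriv_mult[of "\<lambda>y. ?c" "pderivs is \<phi>"]
    by (simp add: smooth_differentiable smooth_pderivs assms partial_deriv_const)
  ultimately show ?case using Cons by (simp add: mult_ac)
qed simp

lemma pderivs_cmult:
  assumes "smooth \<phi>"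
  shows "pderivs is (\<lambda>x. c * \<phi> x) = (\<lambda>x. c * pderivs is \<phi> x)"
proof (induction "is")
  case (Cons i "is")
  then show ?case
    using partial_deriv_mult[of "\<lambda>y. c" "pderivs is \<phi>"]
    by (simp add: smooth_differentiable smooth_pderivs assms partial_deriv_const)
qed simp

lemma pderivs_diff:
  assumes "smooth \<phi>" "smooth \<psi>"
  shows "pderivs is (\<lambda>x. \<phi> x - \<psi> x) = (\<lambda>x. pderivs is \<phi> x - pderivs is \<psi> x)"
  using pderivs_add[OF assms(1) smooth_cmult[OF assms(2)], of "is" "-1"]
    pderivs_cmult[OF assms(2), of "is" "-1"] by simp

lemma pderivs_const: "pderivs is (\<lambda>x. c) = (\<lambda>x. if is = [] then c else 0)"
  by (induction "is") (auto simp: partial_deriv_const)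

lemma pderivs_sum:
  assumes "\<And>j. j \<in> J \<Longrightarrow> smooth (\<phi> j)"
  shows "pderivs is (\<lambda>x. \<Sum>j\<in>J. \<phi> j x) = (\<lambda>x. \<Sum>j\<in>J. pderivs is (\<phi> j) x)"
  using assms
proof (induction J rule: infinite_finite_induct)
  case (insert j J)
  then show ?case using pderivs_add[of "\<phi> j" "\<lambda>x. \<Sum>j\<in>J. \<phi> j x"] by (simp add: smooth_sum)
qed (auto simp: pderivs_const)

text \<open>Measured at scale \<open>s\<close>, each derivative costs \<open>1 / s\<close> whichever
  factor it falls on, so the product rule merely doubles the number of equal bounds and no binomial
  coefficients appear. It is applied with \<open>s\<close> the radius of a shrinking cutoff and with
  \<open>s = 1\<close>.\<close>

lemma norm_pderivs_mult_le:
  fixes \<phi> \<psi> :: "real ^ 'n::finite \<Rightarrow> complex"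
  assumes "s > 0" "smooth \<phi>" "smooth \<psi>"
    "\<And>js. length js \<le> length is \<Longrightarrow> norm (pderivs js \<phi> x) \<le> A / s ^ length js"
    "\<And>js. length js \<le> length is \<Longrightarrow> norm (pderivs js \<psi> x) \<le> B / s ^ length js"
  shows "norm (pderivs is (\<lambda>x. \<phi> x * \<psi> x) x) \<le> A * B * (2 / s) ^ length is"
  using assms
\<comment> \<open>\<open>foldr\<close> applies the last list element first. Removing it from the end
  lets the hypothesis act on the pairs with one factor differentiated, with \<open>A / s\<close> or
  \<open>B / s\<close> as the new constant.\<close>
proof (induction "is" arbitrary: \<phi> \<psi> A B rule: rev_induct)
  case Nil
  from Nil(4)[of "[]"] Nil(5)[of "[]"] show ?case by (auto simp: norm_mult intro!: mult_mono)
     (meson norm_ge_zero order_trans)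
next
  case (snoc i "is")
  have s1: "smooth (partial_deriv i \<phi>)" "smooth (partial_deriv i \<psi>)"
    using smooth_partial_deriv snoc by blast+
  have eq: "pderivs (is @ [i]) (\<lambda>x. \<phi> x * \<psi> x) =
      (\<lambda>x. pderivs is (\<lambda>x. partial_deriv i \<phi> x * \<psi> x) x + pderivs is (\<lambda>x. \<phi> x * partial_deriv i \<psi> x) x)"
    using partial_deriv_mult[of \<phi> \<psi> i] snoc.prems s1
    by (simp add: smooth_differentiable pderivs_add smooth_mult)
  have b1: "norm (pderivs is (\<lambda>x. partial_deriv i \<phi> x * \<psi> x) x) \<le> (A / s) * B * (2 / s) ^ length is"
  proof (rule snoc.IH)
    fix js :: "'n list" assume l: "length js \<le> length is"
    show "norm (pderivs js (partial_deriv i \<phi>) x) \<le> A / s / s ^ length js"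
      using snoc.prems(4)[of "js @ [i]"] l by simp
    show "norm (pderivs js \<psi> x) \<le> B / s ^ length js"
      using snoc.prems(5)[of js] l by simp
  qed (use snoc s1 in auto)
  have b2: "norm (pderivs is (\<lambda>x. \<phi> x * partial_deriv i \<psi> x) x) \<le> A * (B / s) * (2 / s) ^ length is"
  proof (rule snoc.IH)
    fix js :: "'n list" assume l: "length js \<le> length is"
    show "norm (pderivs js (partial_deriv i \<psi>) x) \<le> B / s / s ^ length js"
      using snoc.prems(5)[of "js @ [i]"] l by simp
    show "norm (pderivs js \<phi> x) \<le> A / s ^ length js"
      using snoc.prems(4)[of js] l by simp
  qed (use snoc s1 in auto)
  have "norm (pderivs (is @ [i]) (\<lambda>x. \<phi> x * \<psi> x) x) \<le>
     (A / s) * B * (2 / s) ^ length is + A * (B / s) * (2 / s) ^ length is"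
    unfolding eq using norm_triangle_le[OF add_mono[OF b1 b2]] .
  also have "\<dots> = A * B * (2 / s) ^ length (is @ [i])" by simp
  finally show ?case .
qed

text \<open>The second difference is symmetric in \<open>i\<close> and \<open>j\<close>, while the
  derivative it is compared with is formed in a fixed order; exchanging the two directions therefore
  proves that mixed derivatives commute.\<close>

lemma second_difference_bound:
  fixes \<phi> :: "real ^ 'n::finite \<Rightarrow> complex"
  assumes "smooth \<phi>" "e > 0"
  shows "\<exists>d>0. \<forall>h. 0 < h \<longrightarrow> h < d \<longrightarrow>
    norm (\<phi> (x + h *\<^sub>R axis i 1 + h *\<^sub>R axis j 1) - \<phi> (x + h *\<^sub>R axis i 1)
        - \<phi> (x + h *\<^sub>R axis j 1) + \<phi> x - of_real (h^2) * partial_deriv j (partial_deriv i \<phi>) x) \<le> e * h^2"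
proof -
  define u where "u = partial_deriv i \<phi>"
  define D where "D = frechet_derivative u (at x)"
  have su: "smooth u" unfolding u_def using smooth_partial_deriv assms by blast
  have D: "(u has_derivative D) (at x)" unfolding D_def using smooth_has_derivative[OF su] .
  then have l: "linear D" using has_derivative_linear by blast
  define Ei Ej :: "real ^ 'n" where "Ei = axis i 1" and "Ej = axis j 1"
  obtain d where d: "d > 0" "\<And>y. norm (y - x) < d \<Longrightarrow> norm (u y - u x - D (y - x)) \<le> e/4 * norm (y - x)"
    using D assms(2) unfolding has_derivative_at_alt
    by (metis zero_less_divide_iff zero_less_numeral)
  show ?thesis
  proof (intro exI[of _ "d/2"] conjI allI impI)
    show "d/2 > 0" using d by simp
    fix h :: real assume h: "0 < h" "h < d/2"
    \<comment> \<open>The increment of \<open>g\<close> over \<open>[0, h]\<close> is the second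
      difference minus \<open>h^2\<close> times the mixed derivative. Its derivative
      \<open>g'\<close> compares \<open>u\<close> at points at distance at most \<open>2 * h\<close>
      and \<open>h\<close> from \<open>x\<close>; with error rate \<open>e / 4\<close> these
      contribute at most \<open>3 / 4 * e * h\<close>.\<close>
    define g where "g s = \<phi> (x + s *\<^sub>R Ei + h *\<^sub>R Ej) - \<phi> (x + s *\<^sub>R Ei) - of_real (s * h) * D Ej" for s
    define g' where "g' s = u (x + s *\<^sub>R Ei + h *\<^sub>R Ej) - u (x + s *\<^sub>R Ei) - of_real h * D Ej" for s
    have line: "((\<lambda>s. \<phi> (z + s *\<^sub>R Ei)) has_vector_derivative u (z + s *\<^sub>R Ei)) (at s within S)" for z s S
    proof -
      have "((\<lambda>s. \<phi> (z + s *\<^sub>R Ei)) has_derivative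
           (\<lambda>r. frechet_derivative \<phi> (at (z + s *\<^sub>R Ei)) (r *\<^sub>R Ei))) (at s within S)"
        by (rule has_derivative_compose[OF _ smooth_has_derivative[OF assms(1)]])
           (auto intro!: derivative_eq_intros)
      moreover have "frechet_derivative \<phi> (at (z + s *\<^sub>R Ei)) (r *\<^sub>R Ei) = r *\<^sub>R u (z + s *\<^sub>R Ei)" for r
        unfolding u_def partial_deriv_def Ei_def
        using linear_cmul[OF has_derivative_linear[OF smooth_has_derivative[OF assms(1)]]] by blast
      ultimately show ?thesis by (simp add: has_vector_derivative_def)
    qed
    have lin: "((\<lambda>s. of_real (s * h) * D Ej) has_vector_derivative of_real h * D Ej) (at s within S)" for s S
      unfolding has_vector_derivative_def
      by (auto intro!: derivative_eq_intros simp: scaleR_conv_of_real)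
    have gder: "(g has_vector_derivative g' s) (at s within {0..h})" for s
      unfolding g_def g'_def
      using has_vector_derivative_diff[OF has_vector_derivative_diff[OF line[of "x + h *\<^sub>R Ej" s] line[of x s]] lin]
      by (simp add: add_ac)
    have gb: "norm (g' s) \<le> e * h" if s: "s \<in> {0..h}" for s
    proof -
      have n1: "norm (s *\<^sub>R Ei + h *\<^sub>R Ej) \<le> 2 * h"
        using s h by (intro norm_triangle_le) (auto simp: Ei_def Ej_def norm_axis_1)
      have n2: "norm (s *\<^sub>R Ei) \<le> h" using s h by (auto simp: Ei_def norm_axis_1)
      have bd: "norm (u (x + v) - u x - D v) \<le> e/4 * r" if "norm v \<le> r" "r < d" for v r
      proof -
        have "norm (u (x + v) - u x - D v) \<le> e/4 * norm v" using d(2)[of "x + v"] that by simp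
        also have "\<dots> \<le> e/4 * r" using that assms(2) by (intro mult_left_mono) auto
        finally show ?thesis .
      qed
      have a1: "norm (u (x + s *\<^sub>R Ei + h *\<^sub>R Ej) - u x - D (s *\<^sub>R Ei + h *\<^sub>R Ej)) \<le> e/4 * (2 * h)"
        using bd[OF n1] h by (simp add: add.assoc)
      have a2: "norm (u (x + s *\<^sub>R Ei) - u x - D (s *\<^sub>R Ei)) \<le> e/4 * h"
        using bd[OF n2] h by simp
      have "g' s = (u (x + s *\<^sub>R Ei + h *\<^sub>R Ej) - u x - D (s *\<^sub>R Ei + h *\<^sub>R Ej))
          - (u (x + s *\<^sub>R Ei) - u x - D (s *\<^sub>R Ei))"
      proof -
        have e1: "D (s *\<^sub>R Ei + h *\<^sub>R Ej) = s *\<^sub>R D Ei + h *\<^sub>R D Ej" and e2: "D (s *\<^sub>R Ei) = s *\<^sub>R D Ei"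
          by (simp_all only: linear_add[OF l] linear_cmul[OF l])
        have e3: "of_real h * D Ej = h *\<^sub>R D Ej" by (rule scaleR_conv_of_real[symmetric])
        have "U - V - h *\<^sub>R D Ej = (U - u x - (s *\<^sub>R D Ei + h *\<^sub>R D Ej)) - (V - u x - s *\<^sub>R D Ei)" for U V
          by (simp del: scaleR_conv_of_real)
        then show ?thesis unfolding g'_def e1 e2 e3 .
      qed
      then have "norm (g' s) \<le> e/4 * (2 * h) + e/4 * h"
        using order_trans[OF norm_triangle_ineq4 add_mono[OF a1 a2]] by (simp only:)
      also have "\<dots> \<le> e * h" using h assms(2) by simp
      finally show ?thesis .
    qed
    have "norm (g h - g 0) \<le> e * h * norm (h - 0)"
      by (rule differentiable_bound[of "{0..h}" g "\<lambda>s r. r *\<^sub>R g' s"])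
         (use gder gb h assms(2) in \<open>auto simp: has_vector_derivative_def intro!: onorm_le mult_right_mono simp: mult.commute[of "\<bar>_\<bar>"]\<close>)
    moreover have "g h - g 0 = \<phi> (x + h *\<^sub>R Ei + h *\<^sub>R Ej) - \<phi> (x + h *\<^sub>R Ei)
        - \<phi> (x + h *\<^sub>R Ej) + \<phi> x - of_real (h^2) * partial_deriv j (partial_deriv i \<phi>) x"
      unfolding g_def partial_deriv_def[of j] D_def[symmetric] u_def[symmetric] Ej_def[symmetric]
      by (simp add: power2_eq_square)
    ultimately show "norm (\<phi> (x + h *\<^sub>R axis i 1 + h *\<^sub>R axis j 1) - \<phi> (x + h *\<^sub>R axis i 1)
        - \<phi> (x + h *\<^sub>R axis j 1) + \<phi> x - of_real (h^2) * partial_deriv j (partial_deriv i \<phi>) x) \<le> e * h^2"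
      using h unfolding Ei_def Ej_def by (simp add: power2_eq_square mult_ac)
  qed
qed

lemma partial_deriv_commute:
  assumes "smooth \<phi>"
  shows "partial_deriv i (partial_deriv j \<phi>) = partial_deriv j (partial_deriv i \<phi>)"
proof
  fix x
  define A where "A = partial_deriv j (partial_deriv i \<phi>) x"
  define B where "B = partial_deriv i (partial_deriv j \<phi>) x"
  have "norm (A - B) \<le> e" if e: "e > 0" for e
  proof -
    obtain d1 where d1: "d1 > 0" "\<And>h. 0 < h \<Longrightarrow> h < d1 \<Longrightarrow>
      norm (\<phi> (x + h *\<^sub>R axis i 1 + h *\<^sub>R axis j 1) - \<phi> (x + h *\<^sub>R axis i 1)
        - \<phi> (x + h *\<^sub>R axis j 1) + \<phi> x - of_real (h^2) * A) \<le> e/2 * h^2"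
      using second_difference_bound[OF assms, of "e/2" x i j] e unfolding A_def by auto
    obtain d2 where d2: "d2 > 0" "\<And>h. 0 < h \<Longrightarrow> h < d2 \<Longrightarrow>
      norm (\<phi> (x + h *\<^sub>R axis j 1 + h *\<^sub>R axis i 1) - \<phi> (x + h *\<^sub>R axis j 1)
        - \<phi> (x + h *\<^sub>R axis i 1) + \<phi> x - of_real (h^2) * B) \<le> e/2 * h^2"
      using second_difference_bound[OF assms, of "e/2" x j i] e unfolding B_def by auto
    define h where "h = min d1 d2 / 2"
    have h: "0 < h" "h < d1" "h < d2" using d1 d2 by (auto simp: h_def min_def)
    define \<Delta> where "\<Delta> = \<phi> (x + h *\<^sub>R axis i 1 + h *\<^sub>R axis j 1) - \<phi> (x + h *\<^sub>R axis i 1)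
        - \<phi> (x + h *\<^sub>R axis j 1) + \<phi> x"
    have 1: "norm (\<Delta> - of_real (h^2) * A) \<le> e/2 * h^2" using d1(2)[OF h(1,2)] \<Delta>_def by simp
    have 2: "norm (\<Delta> - of_real (h^2) * B) \<le> e/2 * h^2" using d2(2)[OF h(1,3)] unfolding \<Delta>_def
      by (simp only: add.assoc[of x] add.commute[of "h *\<^sub>R axis j 1"] diff_diff_eq)
         (simp only: add.commute)
    have "of_real (h^2) * (A - B) = (\<Delta> - of_real (h^2) * B) - (\<Delta> - of_real (h^2) * A)"
      by (simp add: algebra_simps)
    then have "norm (of_real (h^2) * (A - B)) \<le> e/2 * h^2 + e/2 * h^2"
      using order_trans[OF norm_triangle_ineq4 add_mono[OF 2 1]] by (simp only:)
    then have "h^2 * norm (A - B) \<le> h^2 * e" by (simp add: norm_mult norm_power mult.commute)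
    then show ?thesis using h by simp
  qed
  then have "norm (A - B) \<le> 0" using field_le_epsilon[of "norm (A - B)" 0] by simp
  then show "partial_deriv i (partial_deriv j \<phi>) x = partial_deriv j (partial_deriv i \<phi>) x"
    unfolding A_def B_def by simp
qed

lemma pderivs_perm:
  assumes "smooth \<phi>" "mset is = mset js" shows "pderivs is \<phi> = pderivs js \<phi>"
  using assms(2)
proof (induction "is" arbitrary: js)
  case (Cons i "is")
  have comm: "partial_deriv i (pderivs ks \<psi>) = pderivs ks (partial_deriv i \<psi>)" if "smooth \<psi>" for ks \<psi>
  proof (induction ks)
    case (Cons k ks)
    then show ?case using partial_deriv_commute[OF smooth_pderivs[OF that], of i k ks] by simp
  qed simp
  obtain ks ls where js: "js = ks @ i # ls"
    using Cons.prems by (metis list.set_intros(1) mset_eq_setD split_list)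
  have "pderivs js \<phi> = pderivs ks (partial_deriv i (pderivs ls \<phi>))" unfolding js by simp
  also have "\<dots> = partial_deriv i (pderivs ks (pderivs ls \<phi>))"
    using comm[OF smooth_pderivs[OF assms(1)], of ks ls] by simp
  also have "\<dots> = partial_deriv i (pderivs (ks @ ls) \<phi>)" by simp
  also have "pderivs (ks @ ls) \<phi> = pderivs is \<phi>"
    using Cons.IH[of "ks @ ls"] Cons.prems unfolding js by simp
  finally show ?case by simp
qed simp

section \<open>Lists of directions and multi-indices\<close>

lemma index_list: "distinct (index_list :: 'n::finite list)" "set (index_list :: 'n list) = UNIV"
proof -
  have "\<exists>is :: 'n list. distinct is \<and> set is = UNIV" using finite_distinct_list[of "UNIV :: 'n set"] by auto
  then have "distinct (index_list :: 'n list) \<and> set (index_list :: 'n list) = UNIV"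
    unfolding index_list_def by (rule someI_ex)
  then show "distinct (index_list :: 'n::finite list)" "set (index_list :: 'n list) = UNIV" by auto
qed

definition mi_list :: "'n::finite multi_index \<Rightarrow> 'n list"
  where "mi_list k = concat (map (\<lambda>i. replicate (k i) i) index_list)"

lemma mi_deriv_eq_pderivs: "mi_deriv k \<phi> = pderivs (mi_list k) \<phi>"
proof -
  have r: "pderivs (replicate n i) \<psi> = (partial_deriv i ^^ n) \<psi>" for n i and \<psi> :: "real ^ 'a \<Rightarrow> complex"
    by (induction n) auto
  have "pderivs (concat (map (\<lambda>i. replicate (k i) i) is)) \<phi> =
      foldr (\<lambda>i. partial_deriv i ^^ k i) is \<phi>" for "is"
    by (induction "is") (auto simp: r)
  then show ?thesis unfolding mi_deriv_def mi_list_def by simp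
qed

lemma count_mi_list: "count (mset (mi_list k)) i = k i"
proof -
  have *: "count (mset (concat (map (\<lambda>i. replicate (k i) i) is))) i = (if i \<in> set is then k i else 0)"
    if "distinct is" for "is"
    using that by (induction "is") auto
  then show ?thesis unfolding mi_list_def by (simp add: *[OF index_list(1)] index_list(2))
qed

lemma length_mi_list: "length (mi_list k) = mi_size k"
  unfolding mi_list_def mi_size_def
  by (simp add: length_concat comp_def sum_list_distinct_conv_sum_set[OF index_list(1)] index_list(2))

lemma mi_size_count_list: "mi_size (count_list is) = length is"
  unfolding mi_size_def using sum_count_set[of "is" UNIV] by simp

text \<open>Because mixed derivatives commute, only the number of occurrences of each coordinate
  matters. Inductions can thus run over lists, one derivative at a time, while the seminorms are
  indexed by multi-indices in the arbitrary order of \<open>index_list\<close>.\<close>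

lemma pderivs_eq_mi_deriv:
  assumes "smooth \<phi>" shows "pderivs is \<phi> = mi_deriv (count_list is) \<phi>"
  unfolding mi_deriv_eq_pderivs
proof (rule pderivs_perm[OF assms], rule multiset_eqI)
  show "count (mset is) i = count (mset (mi_list (count_list is))) i" for i
    unfolding count_mi_list by (simp add: count_mset)
qed

lemma mi_size_zero: "mi_size (\<lambda>_. 0) = 0" by (simp add: mi_size_def)

lemma mi_le_size: "k i \<le> mi_size k"
  unfolding mi_size_def by (rule member_le_sum) auto

lemma finite_mi_size_le: "finite {k :: 'n::finite multi_index. mi_size k \<le> m}"
proof -
  have "{k :: 'n multi_index. mi_size k \<le> m} \<subseteq> Pi\<^sub>E UNIV (\<lambda>_. {..m})"
    using mi_le_size order_trans by (fastforce simp: PiE_def)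
  then show ?thesis using finite_PiE finite_subset by (metis finite finite_atMost)
qed

section \<open>Supports and test functions\<close>

lemma fun_support_subset:
  "closed S \<Longrightarrow> (\<And>x. \<phi> x \<noteq> 0 \<Longrightarrow> x \<in> S) \<Longrightarrow> fun_support \<phi> \<subseteq> S"
  unfolding fun_support_def by (intro closure_minimal) auto

lemma closed_fun_support: "closed (fun_support \<phi>)"
  unfolding fun_support_def by simp

lemma notin_fun_support: "x \<notin> fun_support \<phi> \<Longrightarrow> \<phi> x = 0"
  using closure_subset[of "{x. \<phi> x \<noteq> 0}"] unfolding fun_support_def by auto

lemma pderivs_notin_fun_support:
  assumes "x \<notin> fun_support \<phi>" shows "pderivs is \<phi> x = 0"
proof -
  have "pderivs is \<phi> x = pderivs is (\<lambda>x. 0) x"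
    by (rule pderivs_local[of "- fun_support \<phi>"])
       (use assms closed_fun_support notin_fun_support in auto)
  then show ?thesis by (simp add: pderivs_const)
qed

text \<open>Common end of the limit arguments below: an approximation at scale \<open>N\<close>
  leaves an error of order \<open>1 / N\<close>, so explicit bounds stand in for convergence in
  function spaces.\<close>

lemma zero_if_norm_le_inverse:
  fixes z :: "'a::real_normed_vector"
  assumes "\<And>N::real. N \<ge> 1 \<Longrightarrow> norm z \<le> K / N" shows "z = 0"
proof -
  have "norm z \<le> 0"
  proof (rule field_le_epsilon)
    fix d :: real assume d: "d > 0"
    define N where "N = max 1 (K / d)"
    have N: "N \<ge> 1" "N \<ge> K / d" by (auto simp: N_def)
    have "norm z \<le> K / N" using assms[OF N(1)] by simp
    also have "\<dots> \<le> d" using N d by (simp add: field_simps)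
    finally show "norm z \<le> 0 + d" by simp
  qed
  then show ?thesis by simp
qed

lemma smooth_continuous_on: "smooth \<phi> \<Longrightarrow> continuous_on S \<phi>"
  using smooth_differentiable differentiable_imp_continuous_within
  by (metis continuous_at_imp_continuous_on)

lemma fun_support_cutoff_complement:
  assumes "\<And>y. dist a y < r \<Longrightarrow> \<eta> y = 1"
  shows "fun_support (\<lambda>x. \<phi> x * (1 - \<eta> x)) \<subseteq> fun_support \<phi> - ball a r"
  unfolding Diff_eq
proof (rule fun_support_subset)
  show "closed (fun_support \<phi> \<inter> - ball a r)" using closed_fun_support by (intro closed_Int) auto
  show "y \<in> fun_support \<phi> \<inter> - ball a r" if "\<phi> y * (1 - \<eta> y) \<noteq> 0" for y
    using that assms[of y] notin_fun_support[of y \<phi>] by auto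
qed

lemma test_funI:
  assumes "smooth \<phi>" "\<And>x. \<phi> x \<noteq> 0 \<Longrightarrow> norm x \<le> r"
  shows "\<phi> \<in> test_fun"
proof -
  have "fun_support \<phi> \<subseteq> cball 0 r" using assms by (intro fun_support_subset) auto
  then have "compact (fun_support \<phi>)"
    unfolding compact_eq_bounded_closed
    using closed_fun_support[of \<phi>] bounded_subset[OF bounded_cball, of "fun_support \<phi>" 0 r] by simp
  then show ?thesis using assms(1) by (simp add: test_fun_def)
qed

lemma test_fun_smooth: "\<phi> \<in> test_fun \<Longrightarrow> smooth \<phi>"
  by (simp add: test_fun_def)

lemma test_fun_radius:
  assumes "\<phi> \<in> test_fun"
  obtains r where "r > 0" "fun_support \<phi> \<subseteq> cball 0 r" "\<And>x. norm x > r \<Longrightarrow> \<phi> x = 0"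
proof -
  have "bounded (fun_support \<phi>)" using assms compact_imp_bounded[of "fun_support \<phi>"] by (simp add: test_fun_def)
  then obtain r where r: "r > 0" "\<forall>x\<in>fun_support \<phi>. norm x \<le> r" unfolding bounded_pos by metis
  then have "fun_support \<phi> \<subseteq> cball 0 r" by (simp add: subset_iff)
  moreover have "\<phi> x = 0" if "norm x > r" for x using that r(2) notin_fun_support[of x \<phi>]
    by (metis not_less)
  ultimately show ?thesis using that[of r] r(1) by metis
qed

lemma pderivs_test_fun:
  assumes "\<phi> \<in> test_fun" shows "pderivs is \<phi> \<in> test_fun"
proof -
  obtain r where "r > 0" "fun_support \<phi> \<subseteq> cball 0 r" using test_fun_radius[OF assms] by metis
  then have "norm x \<le> r" if "pderivs is \<phi> x \<noteq> 0" for x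
    using pderivs_notin_fun_support[of x \<phi> "is"] that by (auto simp: subset_iff)
  then show ?thesis using smooth_pderivs[OF test_fun_smooth[OF assms]] test_funI by blast
qed

lemma partial_deriv_test_fun: "\<phi> \<in> test_fun \<Longrightarrow> partial_deriv i \<phi> \<in> test_fun"
  using pderivs_test_fun[of \<phi> "[i]"] by simp

lemma test_fun_mult:
  assumes "\<phi> \<in> test_fun" "smooth \<psi>" shows "(\<lambda>x. \<phi> x * \<psi> x) \<in> test_fun"
proof -
  obtain r where "r > 0" "fun_support \<phi> \<subseteq> cball 0 r" using test_fun_radius[OF assms(1)] by metis
  then have "norm x \<le> r" if "\<phi> x * \<psi> x \<noteq> 0" for x
    using notin_fun_support[of x \<phi>] that by (auto simp: subset_iff)
  then show ?thesis using smooth_mult[OF test_fun_smooth[OF assms(1)] assms(2)] test_funI by blast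
qed

lemma test_fun_cmult: "\<phi> \<in> test_fun \<Longrightarrow> (\<lambda>x. c * \<phi> x) \<in> test_fun"
  using test_fun_mult[OF _ smooth_const, of \<phi> c] by (simp add: mult.commute)

lemma test_fun_add:
  assumes "\<phi> \<in> test_fun" "\<psi> \<in> test_fun" shows "(\<lambda>x. \<phi> x + \<psi> x) \<in> test_fun"
proof -
  obtain r where r: "r > 0" "\<And>x. norm x > r \<Longrightarrow> \<phi> x = 0"
    using test_fun_radius[OF assms(1)] by metis
  obtain s where s: "s > 0" "\<And>x. norm x > s \<Longrightarrow> \<psi> x = 0"
    using test_fun_radius[OF assms(2)] by metis
  show ?thesis
  proof (rule test_funI[of _ "max r s"])
    fix x assume "\<phi> x + \<psi> x \<noteq> 0"
    then show "norm x \<le> max r s" using r(2)[of x] s(2)[of x] by (auto simp: le_max_iff_disj) (metis add_0 not_less)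
  qed (use assms smooth_add test_fun_smooth in auto)
qed

lemma test_fun_diff: "\<phi> \<in> test_fun \<Longrightarrow> \<psi> \<in> test_fun \<Longrightarrow> (\<lambda>x. \<phi> x - \<psi> x) \<in> test_fun"
  using test_fun_add[OF _ test_fun_cmult[of \<psi> "-1"], of \<phi>] by simp

lemma test_fun_zero: "(\<lambda>x. 0) \<in> test_fun"
  by (rule test_funI[of _ 0]) (auto simp: smooth_const)

lemma test_fun_sum:
  "(\<And>j. j \<in> J \<Longrightarrow> \<phi> j \<in> test_fun) \<Longrightarrow> (\<lambda>x. \<Sum>j\<in>J. \<phi> j x) \<in> test_fun"
  by (induction J rule: infinite_finite_induct) (auto simp: test_fun_zero test_fun_add)

lemma test_fun_affine:
  assumes "\<phi> \<in> test_fun" "s \<noteq> 0" shows "(\<lambda>x. \<phi> (a + s *\<^sub>R x)) \<in> test_fun"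
proof -
  obtain r where r: "r > 0" "\<And>x. norm x > r \<Longrightarrow> \<phi> x = 0"
    using test_fun_radius[OF assms(1)] by metis
  show ?thesis
  proof (rule test_funI[of _ "(r + norm a) / \<bar>s\<bar>"])
    fix x assume "\<phi> (a + s *\<^sub>R x) \<noteq> 0"
    then have "norm (a + s *\<^sub>R x) \<le> r" using r(2) by force
    then have "\<bar>s\<bar> * norm x \<le> r + norm a"
      using norm_diff_ineq[of "s *\<^sub>R x" a] by (simp add: add.commute)
    then show "norm x \<le> (r + norm a) / \<bar>s\<bar>" using assms(2) by (simp add: field_simps)
  qed (use assms smooth_affine test_fun_smooth in auto)
qed

lemma test_fun_bounded:
  assumes "\<phi> \<in> test_fun" obtains B where "B \<ge> 0" "\<And>x. norm (\<phi> x) \<le> B"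
proof -
  have "compact (\<phi> ` fun_support \<phi>)"
    using assms by (intro compact_continuous_image smooth_continuous_on) (auto simp: test_fun_def)
  then obtain B where B: "B > 0" "\<forall>y\<in>\<phi> ` fun_support \<phi>. norm y \<le> B"
    using compact_imp_bounded bounded_pos by metis
  have "norm (\<phi> x) \<le> B" for x
    by (cases "x \<in> fun_support \<phi>") (use B notin_fun_support[of x \<phi>] in auto)
  then show ?thesis using B that[of B] by auto
qed

section \<open>Schwartz functions and Taylor estimates\<close>

lemma schwartz_smooth: "\<phi> \<in> schwartz \<Longrightarrow> smooth \<phi>" by (simp add: schwartz_def)

lemma schwartzI:
  assumes "smooth \<phi>" "\<And>n k. \<exists>B. \<forall>x. (1 + norm x) ^ n * norm (mi_deriv k \<phi> x) \<le> B"
  shows "\<phi> \<in> schwartz"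
  using assms unfolding schwartz_def bdd_above_def by fastforce

lemma schwartzD:
  assumes "\<phi> \<in> schwartz" obtains B where "\<And>x. (1 + norm x) ^ n * norm (mi_deriv k \<phi> x) \<le> B"
  using assms unfolding schwartz_def bdd_above_def by fastforce

lemma test_fun_schwartz:
  assumes "\<phi> \<in> test_fun" shows "\<phi> \<in> schwartz"
proof (rule schwartzI[OF test_fun_smooth[OF assms]])
  fix n k
  let ?\<psi> = "mi_deriv k \<phi>"
  have t: "?\<psi> \<in> test_fun" unfolding mi_deriv_eq_pderivs using pderivs_test_fun[OF assms] .
  obtain r where r: "r > 0" "\<And>x. norm x > r \<Longrightarrow> ?\<psi> x = 0" using test_fun_radius[OF t] by metis
  obtain B where B: "B \<ge> 0" "\<And>x. norm (?\<psi> x) \<le> B" using test_fun_bounded[OF t] by metis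
  have "(1 + norm x) ^ n * norm (?\<psi> x) \<le> (1 + r) ^ n * B" for x
  proof (cases "norm x > r")
    case False
    then show ?thesis using B r by (intro mult_mono power_mono) auto
  qed (use r B in auto)
  then show "\<exists>B. \<forall>x. (1 + norm x) ^ n * norm (mi_deriv k \<phi> x) \<le> B" by blast
qed

lemma finite_lists_le: "finite {js :: 'n::finite list. length js \<le> m}"
  using finite_lists_length_le[of "UNIV :: 'n set" m] by simp

lemma schwartz_pderivs_bounded:
  fixes \<phi> :: "real ^ 'n::finite \<Rightarrow> complex"
  assumes "\<phi> \<in> schwartz"
  obtains B where "B \<ge> 0" "\<And>x js. length js \<le> m \<Longrightarrow> (1 + norm x) ^ n * norm (pderivs js \<phi> x) \<le> B"
proof -
  have "\<forall>js. \<exists>B. \<forall>x. (1 + norm x) ^ n * norm (pderivs js \<phi> x) \<le> B"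
    unfolding pderivs_eq_mi_deriv[OF schwartz_smooth[OF assms]] using schwartzD[OF assms] by metis
  then obtain B where B: "\<And>js x. (1 + norm x) ^ n * norm (pderivs js \<phi> x) \<le> B js" by metis
  have B0: "B js \<ge> 0" for js using order_trans[OF norm_ge_zero, of _ "B js"] B[of 0 js] by simp
  define C where "C = (\<Sum>js | length js \<le> m. B js)"
  have "(1 + norm x) ^ n * norm (pderivs js \<phi> x) \<le> C" if "length js \<le> m" for x and js :: "'n list"
    using order_trans[OF B[of x js] member_le_sum[of js "{js. length js \<le> m}" B]] that B0
    unfolding C_def by (simp add: finite_lists_le)
  moreover have "C \<ge> 0" unfolding C_def using B0 by (intro sum_nonneg) auto
  ultimately show ?thesis using that by blast
qed

lemma test_fun_pderivs_bounded:
  assumes "\<phi> \<in> test_fun"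
  obtains B where "B \<ge> 0" "\<And>x js. length js \<le> m \<Longrightarrow> norm (pderivs js \<phi> x) \<le> B"
  using schwartz_pderivs_bounded[OF test_fun_schwartz[OF assms], of m 0] by auto

lemma norm_sum_partials_le:
  fixes v :: "real ^ 'n::finite" and c :: "'n \<Rightarrow> complex"
  assumes "\<And>i. norm (c i) \<le> B"
  shows "norm (\<Sum>i\<in>UNIV. v $ i *\<^sub>R c i) \<le> real CARD('n) * B * norm v"
proof -
  have "norm (\<Sum>i\<in>UNIV. v $ i *\<^sub>R c i) \<le> (\<Sum>i\<in>(UNIV::'n set). norm v * B)"
  proof (rule order_trans[OF norm_sum sum_mono])
    fix i show "norm (v $ i *\<^sub>R c i) \<le> norm v * B"
      using assms[of i] component_le_norm_cart[of v i] by (auto intro!: mult_mono)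
  qed
  then show ?thesis by (simp add: mult_ac)
qed

text \<open>Mean value inequality for \<open>\<phi>\<close> minus a linear map. With all
  \<open>c i = 0\<close> it gives Lipschitz bounds, with \<open>c i\<close> the partial derivatives
  at \<open>x\<close> a second-order Taylor bound.\<close>

lemma norm_diff_le_partials:
  fixes \<phi> :: "real ^ 'n::finite \<Rightarrow> complex"
  assumes "smooth \<phi>" "convex S" "x \<in> S" "y \<in> S"
    "\<And>z i. z \<in> S \<Longrightarrow> norm (partial_deriv i \<phi> z - c i) \<le> B"
  shows "norm (\<phi> y - \<phi> x - (\<Sum>i\<in>UNIV. (y - x) $ i *\<^sub>R c i)) \<le> real CARD('n) * B * norm (y - x)"
proof -
  define g where "g z = \<phi> z - (\<Sum>i\<in>UNIV. (z - x) $ i *\<^sub>R c i)" for z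
  have lin: "bounded_linear (\<lambda>v::real^'n. \<Sum>i\<in>UNIV. v $ i *\<^sub>R c i)"
    by (intro bounded_linear_sum bounded_linear_scaleR_const bounded_linear_vec_nth)
  have der: "(g has_derivative (\<lambda>v. \<Sum>i\<in>UNIV. v $ i *\<^sub>R (partial_deriv i \<phi> z - c i))) (at z within S)" for z
  proof -
    have "((\<lambda>z. \<Sum>i\<in>UNIV. (z - x) $ i *\<^sub>R c i) has_derivative (\<lambda>v. \<Sum>i\<in>UNIV. v $ i *\<^sub>R c i)) (at z)"
      by (auto intro!: derivative_eq_intros bounded_linear.has_derivative[OF bounded_linear_vec_nth])
    then have "(g has_derivative (\<lambda>v. (\<Sum>i\<in>UNIV. v $ i *\<^sub>R partial_deriv i \<phi> z) - (\<Sum>i\<in>UNIV. v $ i *\<^sub>R c i))) (at z)"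
      unfolding g_def using has_derivative_partial_derivs_smooth[OF assms(1)] by (intro has_derivative_diff)
    then show ?thesis by (simp add: scaleR_diff_right sum_subtractf has_derivative_at_withinI)
  qed
  have "onorm (\<lambda>v. \<Sum>i\<in>UNIV. v $ i *\<^sub>R (partial_deriv i \<phi> z - c i)) \<le> real CARD('n) * B" if "z \<in> S" for z
    using norm_sum_partials_le[of "\<lambda>i. partial_deriv i \<phi> z - c i" B, OF assms(5)[OF that]]
    by (intro onorm_le) auto
  then have "norm (g y - g x) \<le> real CARD('n) * B * norm (y - x)"
    by (rule differentiable_bound[OF assms(2) der _ assms(4,3)])
  moreover have "g y - g x = \<phi> y - \<phi> x - (\<Sum>i\<in>UNIV. (y - x) $ i *\<^sub>R c i)"
    unfolding g_def by simp
  ultimately show ?thesis by metis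
qed

lemma test_fun_lipschitz:
  fixes \<phi> :: "real ^ 'n::finite \<Rightarrow> complex"
  assumes "\<phi> \<in> test_fun"
  obtains L where "L \<ge> 0" "\<And>x y. norm (\<phi> y - \<phi> x) \<le> L * norm (y - x)"
proof -
  obtain B where B: "B \<ge> 0" "\<And>x js. length js \<le> 1 \<Longrightarrow> norm (pderivs js \<phi> x) \<le> B"
    using test_fun_pderivs_bounded[OF assms] by metis
  have "norm (partial_deriv i \<phi> z) \<le> B" for i z using B(2)[of "[i]"] by simp
  then have "norm (\<phi> y - \<phi> x) \<le> (real CARD('n) * B) * norm (y - x)" for x y
    using norm_diff_le_partials[OF test_fun_smooth[OF assms], of UNIV x y "\<lambda>i. 0" B] by simp
  moreover have "real CARD('n) * B \<ge> 0" using B by simp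
  ultimately show ?thesis using that by blast
qed

text \<open>The first partial derivatives are globally Lipschitz, so the constant is uniform in
  \<open>x\<close>; this uniformity allows differentiation under an integral over translates of
  \<open>\<phi>\<close>.\<close>

lemma test_fun_second_order:
  fixes \<phi> :: "real ^ 'n::finite \<Rightarrow> complex"
  assumes "\<phi> \<in> test_fun"
  obtains C where "C \<ge> 0"
    "\<And>x v. norm (\<phi> (x + v) - \<phi> x - (\<Sum>i\<in>UNIV. v $ i *\<^sub>R partial_deriv i \<phi> x)) \<le> C * (norm v)^2"
proof -
  have "\<forall>i. \<exists>L\<ge>0. \<forall>x y. norm (partial_deriv i \<phi> y - partial_deriv i \<phi> x) \<le> L * norm (y - x)"
    using test_fun_lipschitz[OF partial_deriv_test_fun[OF assms]] by metis
  then obtain L where L: "\<And>i. L i \<ge> 0"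
    "\<And>i x y. norm (partial_deriv i \<phi> y - partial_deriv i \<phi> x) \<le> L i * norm (y - x)" by metis
  define M where "M = (\<Sum>i\<in>UNIV. L i)"
  have M: "M \<ge> 0" "L i \<le> M" for i unfolding M_def
    using L by (auto intro: sum_nonneg member_le_sum)
  have "norm (\<phi> (x + v) - \<phi> x - (\<Sum>i\<in>UNIV. v $ i *\<^sub>R partial_deriv i \<phi> x)) \<le> real CARD('n) * M * (norm v)^2" for x v
  proof -
    have "norm (partial_deriv i \<phi> z - partial_deriv i \<phi> x) \<le> M * norm v" if "z \<in> cball x (norm v)" for z i
    proof -
      have "L i * norm (z - x) \<le> M * norm v"
        using that M L(1) by (intro mult_mono) (auto simp: dist_norm norm_minus_commute)
      then show ?thesis using L(2)[of i z x] by linarith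
    qed
    from norm_diff_le_partials[OF test_fun_smooth[OF assms] convex_cball[of x "norm v"] _ _ this, of x "x + v"]
    show ?thesis by (simp add: dist_norm power2_eq_square mult_ac)
  qed
  moreover have "real CARD('n) * M \<ge> 0" using M by simp
  ultimately show ?thesis using that by blast
qed

lemma schwartz_add:
  assumes "\<phi> \<in> schwartz" "\<psi> \<in> schwartz" shows "(\<lambda>x. \<phi> x + \<psi> x) \<in> schwartz"
proof (rule schwartzI[OF smooth_add])
  fix n k
  obtain A where A: "\<And>x. (1 + norm x) ^ n * norm (mi_deriv k \<phi> x) \<le> A" using schwartzD[OF assms(1)] by metis
  obtain B where B: "\<And>x. (1 + norm x) ^ n * norm (mi_deriv k \<psi> x) \<le> B" using schwartzD[OF assms(2)] by metis
  have "(1 + norm x) ^ n * norm (mi_deriv k (\<lambda>x. \<phi> x + \<psi> x) x) \<le> A + B" for x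
  proof -
    have "(1 + norm x) ^ n * norm (mi_deriv k (\<lambda>x. \<phi> x + \<psi> x) x)
      \<le> (1 + norm x) ^ n * (norm (mi_deriv k \<phi> x) + norm (mi_deriv k \<psi> x))"
      unfolding mi_deriv_eq_pderivs
      using assms by (intro mult_left_mono) (auto simp: pderivs_add schwartz_smooth norm_triangle_ineq)
    also have "\<dots> \<le> A + B" using A[of x] B[of x] by (simp add: ring_distribs)
    finally show ?thesis .
  qed
  then show "\<exists>B. \<forall>x. (1 + norm x) ^ n * norm (mi_deriv k (\<lambda>x. \<phi> x + \<psi> x) x) \<le> B" by blast
qed (use assms schwartz_smooth in auto)

lemma schwartz_cmult:
  assumes "\<phi> \<in> schwartz" shows "(\<lambda>x. c * \<phi> x) \<in> schwartz"
proof (rule schwartzI[OF smooth_cmult])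
  fix n k
  obtain A where A: "\<And>x. (1 + norm x) ^ n * norm (mi_deriv k \<phi> x) \<le> A" using schwartzD[OF assms(1)] by metis
  have "(1 + norm x) ^ n * norm (mi_deriv k (\<lambda>x. c * \<phi> x) x) \<le> norm c * A" for x
    using mult_left_mono[OF A[of x], of "norm c"] assms unfolding mi_deriv_eq_pderivs
    by (simp add: pderivs_cmult schwartz_smooth norm_mult mult_ac)
  then show "\<exists>B. \<forall>x. (1 + norm x) ^ n * norm (mi_deriv k (\<lambda>x. c * \<phi> x) x) \<le> B" by blast
qed (use assms schwartz_smooth in auto)

lemma schwartz_diff:
  assumes "\<phi> \<in> schwartz" "\<psi> \<in> schwartz" shows "(\<lambda>x. \<phi> x - \<psi> x) \<in> schwartz"
  using schwartz_add[OF assms(1) schwartz_cmult[OF assms(2), of "-1"]] by simp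

lemma schwartz_norm_le:
  fixes \<phi> :: "real ^ 'n::finite \<Rightarrow> complex"
  assumes "\<And>x k. mi_size k \<le> m \<Longrightarrow> (1 + norm x) ^ n * norm (mi_deriv k \<phi> x) \<le> B"
  shows "schwartz_norm n m \<phi> \<le> B"
  unfolding schwartz_norm_def
proof (rule cSUP_least)
  have "(0 :: real^'n, \<lambda>_. 0 :: nat) \<in> UNIV \<times> {k. mi_size k \<le> m}" by (simp add: mi_size_zero)
  then show "(UNIV :: (real^'n) set) \<times> {k. mi_size k \<le> m} \<noteq> {}" by blast
qed (use assms in auto)

subsection \<open>Bump functions\<close>

lemma poly_div_exp_tendsto_0: "((\<lambda>z::real. poly p z / exp z) \<longlongrightarrow> 0) at_top"
proof -
  have "((\<lambda>z. \<Sum>i\<le>degree p. coeff p i * (z ^ i / exp z)) \<longlongrightarrow> (\<Sum>i\<le>degree p. coeff p i * 0)) at_top"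
    by (intro tendsto_intros tendsto_power_div_exp_0)
  then show ?thesis by (simp add: poly_altdef sum_divide_distrib)
qed

text \<open>With \<open>z = 1 / t\<close>, differentiating \<open>P(z) exp(-z)\<close> in
  \<open>t\<close> gives \<open>z^2 (P(z) - P'(z)) exp(-z)\<close>, since
  \<open>dz/dt = -z^2\<close>.\<close>

primrec flat_poly :: "nat \<Rightarrow> real poly" where
  "flat_poly 0 = 1"
| "flat_poly (Suc n) = [:0, 0, 1:] * (flat_poly n - pderiv (flat_poly n))"

text \<open>\<open>flat n\<close> is the \<open>n\<close>-th derivative of the function that equals \<open>exp (- 1 / t)\<close> for positive \<open>t\<close>
  and vanishes elsewhere.\<close>

definition flat :: "nat \<Rightarrow> real \<Rightarrow> real"
  where "flat n t = (if t > 0 then poly (flat_poly n) (1 / t) / exp (1 / t) else 0)"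

lemma flat_has_derivative: "(flat n has_real_derivative flat (Suc n) t) (at t)"
proof -
  consider "t > 0" | "t < 0" | "t = 0" by linarith
  then show ?thesis
  proof cases
    case 1
    have "((\<lambda>t. poly (flat_poly n) (1 / t) / exp (1 / t)) has_real_derivative flat (Suc n) t) (at t)"
      using 1 by (auto intro!: derivative_eq_intros poly_DERIV[THEN DERIV_chain2]
          simp: flat_def field_simps power2_eq_square)
    then show ?thesis
      by (rule has_field_derivative_transform_within_open[of _ _ _ "{0<..}"]) (use 1 in \<open>auto simp: flat_def\<close>)
  next
    case 2
    have "((\<lambda>t. 0) has_real_derivative flat (Suc n) t) (at t)" using 2 by (simp add: flat_def)
    then show ?thesis
      by (rule has_field_derivative_transform_within_open[of _ _ _ "{..<0}"]) (use 2 in \<open>auto simp: flat_def\<close>)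
  next
    case 3
    \<comment> \<open>At 0 the right difference quotient is a polynomial in \<open>1 / h\<close>
      divided by \<open>exp (1 / h)\<close>; the division by \<open>h\<close> supplies the extra
      factor \<open>[:0, 1:]\<close>.\<close>
    have "((\<lambda>h. poly ([:0, 1:] * flat_poly n) (inverse h) / exp (inverse h)) \<longlongrightarrow> 0) (at_right (0::real))"
      using filterlim_compose[OF poly_div_exp_tendsto_0 filterlim_inverse_at_top_right] .
    then have r: "((\<lambda>h. (flat n (0 + h) - flat n 0) / h) \<longlongrightarrow> 0) (at_right 0)"
      by (rule Lim_transform_eventually)
         (auto simp: eventually_at_right_field flat_def field_simps intro!: exI[of _ 1])
    have l: "((\<lambda>h. (flat n (0 + h) - flat n 0) / h) \<longlongrightarrow> 0) (at_left 0)"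
      by (rule Lim_transform_eventually[of "\<lambda>_. 0"])
         (auto simp: eventually_at_left_field flat_def intro!: exI[of _ "-1"])
    show ?thesis using filterlim_split_at[OF l r] 3 by (simp add: DERIV_def flat_def)
  qed
qed

lemma flat_zero: "flat 0 t = (if t > 0 then exp (- 1 / t) else 0)"
  by (simp add: flat_def exp_minus divide_inverse)

text \<open>The chain rule replaces \<open>G n\<close> by \<open>G (Suc n)\<close> and yields a
  smooth factor, the product rule a sum. Hence the whole sequence \<open>G\<close> of derivatives is
  carried along, with an arbitrary smooth factor \<open>\<eta>\<close>.\<close>

inductive_set comp_sums :: "(nat \<Rightarrow> real \<Rightarrow> real) \<Rightarrow> (real ^ 'n::finite \<Rightarrow> real) \<Rightarrow> (real ^ 'n \<Rightarrow> complex) set"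
  for G \<psi> where
  comp: "smooth \<eta> \<Longrightarrow> (\<lambda>x. of_real (G n (\<psi> x)) * \<eta> x) \<in> comp_sums G \<psi>"
| add: "\<phi> \<in> comp_sums G \<psi> \<Longrightarrow> \<rho> \<in> comp_sums G \<psi> \<Longrightarrow> (\<lambda>x. \<phi> x + \<rho> x) \<in> comp_sums G \<psi>"

lemma smooth_compose:
  fixes \<psi> :: "real ^ 'n::finite \<Rightarrow> real"
  assumes G: "\<And>n t. (G n has_real_derivative G (Suc n) t) (at t)"
    and \<psi>: "smooth (\<lambda>x. of_real (\<psi> x))"
  shows "smooth (\<lambda>x. of_real (G 0 (\<psi> x)))"
proof -
  let ?\<Psi> = "\<lambda>x. complex_of_real (\<psi> x)"
  have der: "((\<lambda>x. complex_of_real (G n (\<psi> x))) has_derivative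
      (\<lambda>v. of_real (G (Suc n) (\<psi> x)) * frechet_derivative ?\<Psi> (at x) v)) (at x)" for n x
  proof -
    let ?D = "frechet_derivative ?\<Psi> (at x)"
    have D: "(?\<Psi> has_derivative ?D) (at x)" using smooth_has_derivative[OF \<psi>] .
    \<comment> \<open>To apply the real chain rule, the derivative of the embedded
      \<open>\<psi>\<close> must be real: its imaginary part is the derivative of the zero
      function.\<close>
    have "((\<lambda>x. Im (?\<Psi> x)) has_derivative (\<lambda>v. Im (?D v))) (at x)"
      using has_derivative_Im[OF D] .
    then have "((\<lambda>x. 0) has_derivative (\<lambda>v. Im (?D v))) (at x)" by simp
    then have "(\<lambda>v. Im (?D v)) = (\<lambda>v. 0)"
      using has_derivative_unique[OF _ has_derivative_const] by metis
    then have im: "of_real (Re (?D v)) = ?D v" for v by (metis complex_eq_iff complex_of_real_def Re_complex_of_real Im_complex_of_real)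
    have "((\<lambda>x. Re (?\<Psi> x)) has_derivative (\<lambda>v. Re (?D v))) (at x)"
      using has_derivative_Re[OF D] .
    then have "((\<lambda>x. \<psi> x) has_derivative (\<lambda>v. Re (?D v))) (at x)" by simp
    from has_derivative_compose[OF this G[of n "\<psi> x", unfolded has_field_derivative_def]]
    have "((\<lambda>x. G n (\<psi> x)) has_derivative (\<lambda>v. G (Suc n) (\<psi> x) * Re (?D v))) (at x)" .
    from has_derivative_of_real[OF this, where 'a=complex] show ?thesis
      unfolding of_real_mult im .
  qed
  have diff: "(\<lambda>x. complex_of_real (G n (\<psi> x))) differentiable (at x)" for n x
    using der differentiable_def by blast
  have pd: "partial_deriv i (\<lambda>x. complex_of_real (G n (\<psi> x))) =
      (\<lambda>x. of_real (G (Suc n) (\<psi> x)) * partial_deriv i ?\<Psi> x)" for n i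
    by (rule ext, subst partial_deriv_eqI[OF der]) (simp only: partial_deriv_def)
  have "(\<forall>x. \<phi> differentiable (at x)) \<and> (\<forall>i. partial_deriv i \<phi> \<in> comp_sums G \<psi>)" if "\<phi> \<in> comp_sums G \<psi>" for \<phi>
    using that
  proof induction
    case (comp \<eta> n)
    have d: "\<And>x. \<eta> differentiable (at x)" using comp smooth_differentiable by blast
    have "partial_deriv i (\<lambda>x. of_real (G n (\<psi> x)) * \<eta> x) =
      (\<lambda>x. of_real (G (Suc n) (\<psi> x)) * (partial_deriv i ?\<Psi> x * \<eta> x) + of_real (G n (\<psi> x)) * partial_deriv i \<eta> x)" for i
      using partial_deriv_mult[OF diff d] by (simp add: pd mult.assoc)
    then show ?case using comp \<psi> diff d
      by (auto intro!: comp_sums.intros smooth_mult smooth_partial_deriv differentiable_mult)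
  next
    case (add \<phi> \<rho>)
    then have d: "\<And>x. \<phi> differentiable (at x)" "\<And>x. \<rho> differentiable (at x)" by blast+
    show ?case unfolding partial_deriv_add[OF d]
      using d add by (auto intro!: differentiable_add comp_sums.intros)
  qed
  from smooth_coinduct[OF comp_sums.comp[OF smooth_const[of 1], of G 0 \<psi>]] this
  show ?thesis by simp
qed

lemma smooth_component: "smooth (\<lambda>x. of_real (x $ i))"
proof (rule smooth_coinduct[of _ "insert (\<lambda>x. of_real (x $ i)) (range (\<lambda>c x. c))"])
  have d: "((\<lambda>x. complex_of_real (x $ i)) has_derivative (\<lambda>v. of_real (v $ i))) (at x)" for x :: "real^'a"
    by (intro has_derivative_of_real bounded_linear.has_derivative[OF bounded_linear_vec_nth] has_derivative_ident)
  have e: "partial_deriv j (\<lambda>x. complex_of_real (x $ i)) = (\<lambda>x. of_real (axis j 1 $ i))" for j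
    by (rule ext) (rule partial_deriv_eqI[OF d])
  fix \<psi> :: "real^'a \<Rightarrow> complex" and x j
  assume "\<psi> \<in> insert (\<lambda>x. of_real (x $ i)) (range (\<lambda>c x. c))"
  then show "\<psi> differentiable (at x)"
    "partial_deriv j \<psi> \<in> insert (\<lambda>x. of_real (x $ i)) (range (\<lambda>c x. c))"
    using d[THEN differentiableI] by (auto simp: partial_deriv_const e)
qed simp

lemma smooth_norm_square: "smooth (\<lambda>x::real^'n::finite. of_real ((norm x)^2))"
proof -
  have "(\<lambda>x::real^'n. complex_of_real ((norm x)^2)) = (\<lambda>x. \<Sum>i\<in>UNIV. of_real (x $ i) * of_real (x $ i))"
    by (auto simp: power2_norm_eq_inner inner_vec_def)
  then show ?thesis by (auto intro!: smooth_sum smooth_mult smooth_component)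
qed

text \<open>With \<open>e = exp (- 1)\<close>, the inner \<open>flat\<close> vanishes on the unit ball and is at least \<open>e\<close> outside
  the ball of radius \<open>sqrt 2\<close>.\<close>

definition bump :: "real ^ 'n::finite \<Rightarrow> complex"
  where "bump x = of_real (flat 0 (exp (- 1) - flat 0 ((norm x)^2 - 1)) / flat 0 (exp (- 1)))"

lemma smooth_bump: "smooth bump"
proof -
  have "smooth (\<lambda>x::real^'n::finite. complex_of_real ((norm x)^2 - 1))"
    using smooth_diff[OF smooth_norm_square smooth_const[of 1]] by simp
  from smooth_compose[of flat, OF flat_has_derivative this]
  have "smooth (\<lambda>x::real^'n::finite. complex_of_real (exp (- 1) - flat 0 ((norm x)^2 - 1)))"
    using smooth_diff[OF smooth_const[of "of_real (exp (- 1))"]] by (simp add: exp_of_real)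
  from smooth_compose[of flat, OF flat_has_derivative this]
  have "smooth (\<lambda>x::real^'n::finite. complex_of_real (flat 0 (exp (- 1) - flat 0 ((norm x)^2 - 1))))" .
  from smooth_cmult[OF this, of "1 / of_real (flat 0 (exp (- 1)))"] show ?thesis
    unfolding bump_def by simp
qed

lemma bump_eq_1: "norm x \<le> 1 \<Longrightarrow> bump x = 1"
proof -
  assume "norm x \<le> 1"
  then have "(norm x)^2 \<le> 1" by (simp add: power_le_one)
  then show ?thesis by (simp add: bump_def flat_zero)
qed

lemma bump_eq_0: assumes "norm x \<ge> 2" shows "bump x = 0"
proof -
  have "(norm x)^2 \<ge> 2^2" using assms by (intro power_mono) auto
  then have "(norm x)^2 - 1 \<ge> 1" by simp
  then have "exp (- 1) \<le> flat 0 ((norm x)^2 - 1)"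
    by (simp add: flat_zero divide_le_eq)
  then show ?thesis by (simp add: bump_def flat_zero)
qed

lemma bump_real: "bump x = of_real (Re (bump x))" "Re (bump x) \<ge> 0"
  unfolding bump_def by (auto simp: flat_zero)

lemma bump_test_fun: "bump \<in> test_fun"
  by (rule test_funI[OF smooth_bump, of 2]) (use bump_eq_0 in force)

lemma cutoff_exists:
  fixes a :: "real ^ 'n::finite"
  assumes "r > 0"
  obtains \<eta> where "\<eta> \<in> test_fun" "\<And>x. dist a x \<le> r \<Longrightarrow> \<eta> x = 1" "\<And>x. dist a x \<ge> 2 * r \<Longrightarrow> \<eta> x = 0"
proof (rule that[of "\<lambda>x. bump ((- (1/r)) *\<^sub>R a + (1/r) *\<^sub>R x)"])
  have eq: "(- (1/r)) *\<^sub>R a + (1/r) *\<^sub>R x = (1/r) *\<^sub>R (x - a)" for x by (simp add: scaleR_diff_right)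
  show "(\<lambda>x. bump ((- (1/r)) *\<^sub>R a + (1/r) *\<^sub>R x)) \<in> test_fun"
    using test_fun_affine[OF bump_test_fun, of "1/r" "(- (1/r)) *\<^sub>R a"] assms by simp
  show "bump ((- (1/r)) *\<^sub>R a + (1/r) *\<^sub>R x) = 1" if "dist a x \<le> r" for x
    unfolding eq using that assms by (intro bump_eq_1) (simp add: dist_norm norm_minus_commute)
  show "bump ((- (1/r)) *\<^sub>R a + (1/r) *\<^sub>R x) = 0" if "dist a x \<ge> 2 * r" for x
    unfolding eq using that assms by (intro bump_eq_0) (simp add: dist_norm norm_minus_commute pos_le_divide_eq)
qed

text \<open>\<open>U i n\<close> is meant to be the \<open>n\<close>-th derivative of the factor in
  coordinate \<open>i\<close>, so \<open>e\<close> records the orders reached and a partial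
  derivative only increments one entry of \<open>e\<close>.\<close>

definition tensor_fun :: "('n \<Rightarrow> nat \<Rightarrow> real \<Rightarrow> real) \<Rightarrow> ('n \<Rightarrow> nat) \<Rightarrow> real ^ 'n::finite \<Rightarrow> complex"
  where "tensor_fun U e x = (\<Prod>i\<in>UNIV. of_real (U i (e i) (x $ i)))"

lemma pderivs_tensor_fun:
  fixes U :: "'n::finite \<Rightarrow> nat \<Rightarrow> real \<Rightarrow> real"
  assumes U: "\<And>i n t. (U i n has_real_derivative U i (Suc n) t) (at t)"
  shows "smooth (tensor_fun U e)"
    and "pderivs is (tensor_fun U e) = tensor_fun U (\<lambda>i. e i + count_list is i)"
proof -
  have der: "(tensor_fun U e has_derivative (\<lambda>v. \<Sum>i\<in>UNIV. of_real (U i (Suc (e i)) (x $ i) * v $ i) *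
      (\<Prod>j\<in>UNIV - {i}. of_real (U j (e j) (x $ j))))) (at x)" for e and x :: "real^'n"
    unfolding tensor_fun_def
    by (intro has_derivative_prod has_derivative_of_real
        has_derivative_compose[OF bounded_linear.has_derivative[OF bounded_linear_vec_nth has_derivative_ident]
          U[unfolded has_field_derivative_def]])
  have pd: "partial_deriv i (tensor_fun U e) = tensor_fun U (e(i := Suc (e i)))" for i e
  proof
    fix x :: "real^'n"
    have "partial_deriv i (tensor_fun U e) x = (\<Sum>k\<in>UNIV. if k = i then
        of_real (U i (Suc (e i)) (x $ i)) * (\<Prod>j\<in>UNIV - {i}. of_real (U j (e j) (x $ j))) else 0)"
      unfolding partial_deriv_eqI[OF der] by (intro sum.cong) (auto simp: axis_def)
    also have "\<dots> = of_real (U i (Suc (e i)) (x $ i)) * (\<Prod>j\<in>UNIV - {i}. of_real (U j (e j) (x $ j)))"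
      by simp
    also have "\<dots> = tensor_fun U (e(i := Suc (e i))) x"
      unfolding tensor_fun_def by (subst prod.remove[of UNIV i]) auto
    finally show "partial_deriv i (tensor_fun U e) x = tensor_fun U (e(i := Suc (e i))) x" .
  qed
  show "smooth (tensor_fun U e)"
    by (rule smooth_coinduct[of _ "range (tensor_fun U)"])
       (use der in \<open>auto simp: differentiable_def pd\<close>)
  show "pderivs is (tensor_fun U e) = tensor_fun U (\<lambda>i. e i + count_list is i)"
  proof (induction "is")
    case (Cons i "is")
    have "(\<lambda>j. e j + count_list is j)(i := Suc (e i + count_list is i)) = (\<lambda>j. e j + count_list (i # is) j)"
      by auto
    then show ?case using Cons pd by simp
  qed simp
qed

text \<open>The monomial \<open>(x - a)^k / k!\<close> has exactly one nonvanishing derivative at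
  \<open>a\<close>, and multiplying it by a cutoff that is 1 near \<open>a\<close> does not change
  derivatives there.\<close>

lemma dual_test_fun_exists:
  fixes a :: "real ^ 'n::finite"
  assumes "r > 0"
  obtains \<omega> where "\<omega> \<in> test_fun" "fun_support \<omega> \<subseteq> ball a r"
    "\<And>k'. mi_deriv k' \<omega> a = (if k' = k then 1 else 0)"
proof -
  \<comment> \<open>The \<open>n\<close>-th derivative of \<open>t ^ k i / fact (k i)\<close>; the
    case distinction handles orders beyond \<open>k i\<close>, where truncated subtraction would
    give 1.\<close>
  define U where "U i n t = (if n \<le> k i then t ^ (k i - n) / fact (k i - n) else 0)" for i n and t :: real
  have U: "(U i n has_real_derivative U i (Suc n) t) (at t)" for i n t
  proof (cases "n < k i")
    case True
    then have e: "k i - n = Suc (k i - Suc n)" by simp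
    have "((\<lambda>t. t ^ (k i - n) / fact (k i - n)) has_real_derivative t ^ (k i - Suc n) / fact (k i - Suc n)) (at t)"
      unfolding e using DERIV_cdivide[OF DERIV_pow[of "Suc (k i - Suc n)" t], of "fact (Suc (k i - Suc n))"]
      by (simp add: fact_Suc del: of_nat_Suc)
    then show ?thesis using True unfolding U_def by (simp add: Suc_leI)
  next
    case False
    then have "U i n = (\<lambda>t. if n = k i then 1 else 0)" "U i (Suc n) t = 0" by (auto simp: U_def fun_eq_iff)
    then show ?thesis by simp
  qed
  note T = pderivs_tensor_fun[of U, OF U]
  have T0: "tensor_fun U k' 0 = (if k' = k then 1 else 0)" for k'
  proof (cases "k' = k")
    case False
    then obtain i where "k' i \<noteq> k i" by auto
    then have "complex_of_real (U i (k' i) ((0::real^'n) $ i)) = 0" by (auto simp: U_def)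
    then show ?thesis using False unfolding tensor_fun_def by (simp, blast)
  qed (simp add: tensor_fun_def U_def)
  obtain \<eta> where \<eta>: "\<eta> \<in> test_fun" "\<And>x. dist a x \<le> r/3 \<Longrightarrow> \<eta> x = 1" "\<And>x. dist a x \<ge> 2 * (r/3) \<Longrightarrow> \<eta> x = 0"
    using cutoff_exists[of "r/3" a] assms by auto
  define P where "P x = tensor_fun U (\<lambda>_. 0) (- a + 1 *\<^sub>R x)" for x
  have sP: "smooth P" unfolding P_def by (rule smooth_affine[OF T(1)])
  define \<omega> where "\<omega> x = \<eta> x * P x" for x
  have 1: "\<omega> \<in> test_fun" unfolding \<omega>_def by (rule test_fun_mult[OF \<eta>(1) sP])
  have "fun_support \<omega> \<subseteq> cball a (2 * (r/3))"
    using \<eta>(3) unfolding \<omega>_def by (intro fun_support_subset) force+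
  also have "\<dots> \<subseteq> ball a r" using assms by auto
  finally have 2: "fun_support \<omega> \<subseteq> ball a r" .
  have 3: "mi_deriv k' \<omega> a = (if k' = k then 1 else 0)" for k'
  proof -
    have "mi_deriv k' \<omega> a = mi_deriv k' P a" unfolding mi_deriv_eq_pderivs
      by (rule pderivs_local[of "ball a (r/3)"]) (use assms \<eta>(2) in \<open>auto simp: \<omega>_def\<close>)
    also have "\<dots> = tensor_fun U (count_list (mi_list k')) 0"
      unfolding mi_deriv_eq_pderivs P_def pderivs_affine[OF T(1)] T(2) by simp
    also have "count_list (mi_list k') = k'" using count_mi_list[of k'] by (simp add: count_mset fun_eq_iff)
    finally show ?thesis using T0 by simp
  qed
  show ?thesis using that 1 2 3 by blast
qed

subsection \<open>Distributions with discrete support\<close>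

lemma tempered_add:
  "tempered f \<Longrightarrow> \<phi> \<in> schwartz \<Longrightarrow> \<psi> \<in> schwartz \<Longrightarrow> f (\<lambda>x. \<phi> x + \<psi> x) = f \<phi> + f \<psi>"
  unfolding tempered_def by simp

lemma tempered_cmult: "tempered f \<Longrightarrow> \<phi> \<in> schwartz \<Longrightarrow> f (\<lambda>x. c * \<phi> x) = c * f \<phi>"
  unfolding tempered_def by simp

lemma tempered_diff:
  "tempered f \<Longrightarrow> \<phi> \<in> schwartz \<Longrightarrow> \<psi> \<in> schwartz \<Longrightarrow> f (\<lambda>x. \<phi> x - \<psi> x) = f \<phi> - f \<psi>"
  using tempered_add[of f \<phi> "\<lambda>x. -1 * \<psi> x"] tempered_cmult[of f \<psi> "-1"] schwartz_cmult[of \<psi> "-1"]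
  by simp

lemma tempered_zero: "tempered f \<Longrightarrow> f (\<lambda>x. 0) = 0"
  using tempered_cmult[OF _ test_fun_schwartz[OF test_fun_zero], of f 0] by simp

lemma tempered_sum:
  assumes "tempered f" "\<And>j. j \<in> J \<Longrightarrow> \<phi> j \<in> test_fun"
  shows "f (\<lambda>x. \<Sum>j\<in>J. \<phi> j x) = (\<Sum>j\<in>J. f (\<phi> j))"
  using assms(2)
proof (induction J rule: infinite_finite_induct)
  case (insert j J)
  then show ?case
    using tempered_add[OF assms(1), of "\<phi> j" "\<lambda>x. \<Sum>j\<in>J. \<phi> j x"]
    by (simp add: test_fun_schwartz test_fun_sum)
qed (auto simp: tempered_zero[OF assms(1)])

text \<open>Replaces the supremum \<open>schwartz_norm\<close> by any pointwise bound
  \<open>B\<close>, so that later estimates can be pointwise. Passing to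
  \<open>\<bar>C\<bar>\<close> makes the constant nonnegative.\<close>

lemma tempered_bound:
  fixes f :: "('n::finite) functional"
  assumes "tempered f"
  obtains C n m where "C \<ge> 0" "\<And>\<phi> B. \<phi> \<in> schwartz \<Longrightarrow>
    (\<And>x k. mi_size k \<le> m \<Longrightarrow> (1 + norm x) ^ n * norm (mi_deriv k \<phi> x) \<le> B) \<Longrightarrow> norm (f \<phi>) \<le> C * B"
proof -
  obtain C n m where C: "\<And>\<phi>. \<phi> \<in> schwartz \<Longrightarrow> norm (f \<phi>) \<le> C * schwartz_norm n m \<phi>"
    using assms unfolding tempered_def by metis
  have "norm (f \<phi>) \<le> \<bar>C\<bar> * B" if "\<phi> \<in> schwartz"
    "\<And>x k. mi_size k \<le> m \<Longrightarrow> (1 + norm x) ^ n * norm (mi_deriv k \<phi> x) \<le> B" for \<phi> B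
  proof -
    have "0 \<le> schwartz_norm n m \<phi>"
    proof -
      have "(1 + norm (0::real^'n)) ^ n * norm (mi_deriv (\<lambda>_. 0) \<phi> 0) \<le> schwartz_norm n m \<phi>"
        unfolding schwartz_norm_def
        by (rule cSUP_upper2[where x="(0, \<lambda>_. 0)"])
           (use that(2) in \<open>auto simp: mi_size_zero bdd_above_def intro!: exI[of _ B]\<close>)
      then show ?thesis by (rule order_trans[rotated]) simp
    qed
    then have "norm (f \<phi>) \<le> \<bar>C\<bar> * schwartz_norm n m \<phi>"
      using C[OF that(1)] by (smt (verit) mult_right_mono)
    also have "\<dots> \<le> \<bar>C\<bar> * B" by (intro mult_left_mono schwartz_norm_le that(2)) auto
    finally show ?thesis .
  qed
  then show ?thesis using that[of "\<bar>C\<bar>" m n] by auto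
qed

lemma cutoff_split:
  assumes "tempered f" "\<phi> \<in> test_fun" "smooth \<eta>"
  shows "f \<phi> = f (\<lambda>x. \<phi> x * \<eta> x) + f (\<lambda>x. \<phi> x * (1 - \<eta> x))"
    "(\<lambda>x. \<phi> x * \<eta> x) \<in> test_fun" "(\<lambda>x. \<phi> x * (1 - \<eta> x)) \<in> test_fun"
proof -
  show 1: "(\<lambda>x. \<phi> x * \<eta> x) \<in> test_fun" "(\<lambda>x. \<phi> x * (1 - \<eta> x)) \<in> test_fun"
    using assms by (intro test_fun_mult smooth_diff smooth_const; simp)+
  show "f \<phi> = f (\<lambda>x. \<phi> x * \<eta> x) + f (\<lambda>x. \<phi> x * (1 - \<eta> x))"
    using tempered_add[OF assms(1) 1[THEN test_fun_schwartz]] by (simp add: algebra_simps)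
qed

text \<open>A partition of unity peeled off ball by ball: the cutoff for \<open>x\<close> is 1 on
  \<open>ball x (r x)\<close>, so the remaining part is supported in the other balls, and the part
  removed lives in the ball of twice the radius, where \<open>f\<close> vanishes.\<close>

lemma vanish_finite_cover:
  assumes "tempered f" "finite X"
    "\<And>x. x \<in> X \<Longrightarrow> r x > 0"
    "\<And>x \<psi>. x \<in> X \<Longrightarrow> \<psi> \<in> test_fun \<Longrightarrow> fun_support \<psi> \<subseteq> cball x (2 * r x) \<Longrightarrow> f \<psi> = 0"
    "\<phi> \<in> test_fun" "fun_support \<phi> \<subseteq> (\<Union>x\<in>X. ball x (r x))"
  shows "f \<phi> = 0"
  using assms(2-)
proof (induction X arbitrary: \<phi>)
  case empty
  then have "\<phi> = (\<lambda>x. 0)" using notin_fun_support by blast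
  then show ?case using tempered_zero[OF assms(1)] by simp
next
  case (insert x X)
  obtain \<eta> where \<eta>: "\<eta> \<in> test_fun" "\<And>y. dist x y \<le> r x \<Longrightarrow> \<eta> y = 1" "\<And>y. dist x y \<ge> 2 * r x \<Longrightarrow> \<eta> y = 0"
    using cutoff_exists[of "r x" x] insert by blast
  note split = cutoff_split[OF assms(1) insert.prems(3) test_fun_smooth[OF \<eta>(1)]]
  have "fun_support (\<lambda>x. \<phi> x * \<eta> x) \<subseteq> cball x (2 * r x)"
    using \<eta>(3) by (intro fun_support_subset) force+
  then have 1: "f (\<lambda>x. \<phi> x * \<eta> x) = 0" using insert.prems(2) split(2) by blast
  have "fun_support (\<lambda>x. \<phi> x * (1 - \<eta> x)) \<subseteq> fun_support \<phi> - ball x (r x)"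
    by (rule fun_support_cutoff_complement) (simp add: \<eta>(2))
  also have "\<dots> \<subseteq> (\<Union>x\<in>X. ball x (r x))" using insert.prems(4) by auto
  finally have 2: "f (\<lambda>x. \<phi> x * (1 - \<eta> x)) = 0"
    using insert.prems(1,2) by (intro insert.IH[OF _ _ split(3)]) auto
  show ?case using 1 2 split(1) by simp
qed

lemma vanish_off_dist_support:
  assumes "tempered f" "\<phi> \<in> test_fun" "fun_support \<phi> \<inter> dist_support f = {}"
  shows "f \<phi> = 0"
proof -
  have "\<exists>r>0. \<forall>\<psi>\<in>test_fun. fun_support \<psi> \<subseteq> cball x (2 * r) \<longrightarrow> f \<psi> = 0"
    if x: "x \<in> fun_support \<phi>" for x
  proof -
    have "x \<notin> dist_support f" using x assms(3) by blast
    then obtain U where U: "open U" "x \<in> U" "\<And>\<psi>. \<psi> \<in> test_fun \<Longrightarrow> fun_support \<psi> \<subseteq> U \<Longrightarrow> f \<psi> = 0"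
      unfolding dist_support_def by blast
    then obtain e where "e > 0" "cball x e \<subseteq> U" using open_contains_cball by metis
    then show ?thesis using U(3) by (intro exI[of _ "e/2"]) auto
  qed
  then obtain r where r: "\<And>x. x \<in> fun_support \<phi> \<Longrightarrow> r x > 0"
    "\<And>x \<psi>. x \<in> fun_support \<phi> \<Longrightarrow> \<psi> \<in> test_fun \<Longrightarrow> fun_support \<psi> \<subseteq> cball x (2 * r x) \<Longrightarrow> f \<psi> = 0"
    by metis
  have "compact (fun_support \<phi>)" using assms(2) by (simp add: test_fun_def)
  moreover have "fun_support \<phi> \<subseteq> (\<Union>x\<in>fun_support \<phi>. ball x (r x))" using r(1) by force
  ultimately obtain X where X: "X \<subseteq> fun_support \<phi>" "finite X" "fun_support \<phi> \<subseteq> (\<Union>x\<in>X. ball x (r x))"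
    using compactE_image[of "fun_support \<phi>" "fun_support \<phi>" "\<lambda>x. ball x (r x)"] by auto
  show ?thesis
    using vanish_finite_cover[of f X r \<phi>] assms r X by blast
qed

text \<open>Downward induction on the order: derivatives of order \<open>Suc m\<close> are bounded,
  and every order below gains one factor \<open>norm (x - a)\<close> from the mean value inequality,
  because the derivative at \<open>a\<close> is zero. In the proof \<open>j\<close> counts the
  orders still missing to \<open>Suc m\<close>.\<close>

lemma flat_taylor_bound:
  fixes g :: "real ^ 'n::finite \<Rightarrow> complex"
  assumes g: "g \<in> test_fun" and flat: "\<And>is. length is \<le> m \<Longrightarrow> pderivs is g a = 0"
  obtains A where "A \<ge> 0"
    "\<And>is x. length is \<le> Suc m \<Longrightarrow> norm (pderivs is g x) \<le> A * norm (x - a) ^ (Suc m - length is)"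
proof -
  obtain B where B: "B \<ge> 0" "\<And>x js. length js \<le> Suc m \<Longrightarrow> norm (pderivs js g x) \<le> B"
    using test_fun_pderivs_bounded[OF g] by metis
  let ?N = "real CARD('n)"
  have N: "?N \<ge> 1" by (simp add: Suc_leI)
  have step: "\<forall>is x. length is = Suc m - j \<longrightarrow> norm (pderivs is g x) \<le> B * ?N ^ j * norm (x - a) ^ j"
    if "j \<le> Suc m" for j
    using that
  proof (induction j)
    case 0 then show ?case using B by simp
  next
    case (Suc j)
    show ?case
    proof (intro allI impI)
      fix "is" :: "'n list" and x assume l: "length is = Suc m - Suc j"
      let ?S = "cball a (norm (x - a))"
      have "norm (partial_deriv i (pderivs is g) z - 0) \<le> B * ?N ^ j * norm (x - a) ^ j" if "z \<in> ?S" for z i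
      proof -
        have "norm (pderivs (i # is) g z) \<le> B * ?N ^ j * norm (z - a) ^ j"
          using Suc l by (metis Suc_diff_Suc Suc_leD Suc_le_lessD length_Cons)
        also have "\<dots> \<le> B * ?N ^ j * norm (x - a) ^ j"
          using that B by (intro mult_left_mono power_mono) (auto simp: dist_norm norm_minus_commute)
        finally show ?thesis by simp
      qed
      from norm_diff_le_partials[OF smooth_pderivs[OF test_fun_smooth[OF g]] convex_cball[of a "norm (x - a)"] _ _ this, of a x]
      have "norm (pderivs is g x - pderivs is g a) \<le> ?N * (B * ?N ^ j * norm (x - a) ^ j) * norm (x - a)"
        by (simp add: dist_norm norm_minus_commute)
      then show "norm (pderivs is g x) \<le> B * ?N ^ Suc j * norm (x - a) ^ Suc j"
        using flat[of "is"] l by (simp add: mult_ac)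
    qed
  qed
  define A where "A = B * ?N ^ Suc m"
  show ?thesis
  proof (rule that[of A])
    show "A \<ge> 0" using B by (simp add: A_def)
    fix "is" :: "'n list" and x assume l: "length is \<le> Suc m"
    have "norm (pderivs is g x) \<le> B * ?N ^ (Suc m - length is) * norm (x - a) ^ (Suc m - length is)"
      using step[of "Suc m - length is"] l by simp
    also have "\<dots> \<le> A * norm (x - a) ^ (Suc m - length is)"
      unfolding A_def using B N by (intro mult_right_mono mult_left_mono power_increasing) auto
    finally show "norm (pderivs is g x) \<le> A * norm (x - a) ^ (Suc m - length is)" .
  qed
qed

text \<open>Cutting off at scale \<open>e\<close> costs \<open>e ^ (- j)\<close> in the \<open>j\<close>-th derivatives, which is outweighed by the
  vanishing of \<open>g\<close> to order \<open>m\<close>.\<close>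

lemma flat_at_support_point_zero:
  fixes f :: "('n::finite) functional"
  assumes f: "tempered f" and C: "C \<ge> 0" "\<And>\<phi> B. \<phi> \<in> schwartz \<Longrightarrow>
    (\<And>x k. mi_size k \<le> m \<Longrightarrow> (1 + norm x) ^ n * norm (mi_deriv k \<phi> x) \<le> B) \<Longrightarrow> norm (f \<phi>) \<le> C * B"
    and g: "g \<in> test_fun" "fun_support g \<inter> dist_support f \<subseteq> {a}"
    "\<And>k. mi_size k \<le> m \<Longrightarrow> mi_deriv k g a = 0"
  shows "f g = 0"
proof -
  have "pderivs is g a = 0" if "length is \<le> m" for "is"
    unfolding pderivs_eq_mi_deriv[OF test_fun_smooth[OF g(1)]]
    using g(3) that by (simp add: mi_size_count_list)
  then obtain A where A: "A \<ge> 0"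
    "\<And>is x. length is \<le> Suc m \<Longrightarrow> norm (pderivs is g x) \<le> A * norm (x - a) ^ (Suc m - length is)"
    using flat_taylor_bound[OF g(1)] by metis
  obtain Bb where Bb: "Bb \<ge> 0" "\<And>x js. length js \<le> m \<Longrightarrow> norm (pderivs js bump (x :: real ^ 'n)) \<le> Bb"
    using test_fun_pderivs_bounded[OF bump_test_fun] by metis
  \<comment> \<open>The first factor bounds the weight on the ball of radius \<open>2 * e\<close>
    about \<open>a\<close>, where \<open>1 + norm x\<close> is at most \<open>norm a + 3\<close> for
    \<open>e\<close> at most 1; the second comes from the product rule.\<close>
  define K where "K = (norm a + 3) ^ n * (A * 2 ^ Suc m * Bb * 2 ^ m)"
  have K: "K \<ge> 0" unfolding K_def using A Bb by simp
  have main: "norm (f g) \<le> C * K * e" if e: "0 < e" "e \<le> 1" for e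
  proof -
    define \<eta> where "\<eta> x = bump ((- (1/e)) *\<^sub>R a + (1/e) *\<^sub>R x)" for x
    have eq: "(- (1/e)) *\<^sub>R a + (1/e) *\<^sub>R x = (1/e) *\<^sub>R (x - a)" for x by (simp add: scaleR_diff_right)
    have s\<eta>: "smooth \<eta>" unfolding \<eta>_def by (rule smooth_affine[OF smooth_bump])
    have \<eta>1: "\<eta> x = 1" if "dist a x \<le> e" for x
      unfolding \<eta>_def eq using that e by (intro bump_eq_1) (simp add: dist_norm norm_minus_commute)
    have \<eta>0: "\<eta> x = 0" if "dist a x \<ge> 2 * e" for x
      unfolding \<eta>_def eq using that e by (intro bump_eq_0) (simp add: dist_norm norm_minus_commute pos_le_divide_eq)
    have \<eta>B: "norm (pderivs js \<eta> x) \<le> Bb / e ^ length js" if "length js \<le> m" for js x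
      unfolding \<eta>_def pderivs_affine[OF smooth_bump] using Bb(2)[OF that] e
      by (simp add: norm_divide norm_mult norm_power power_divide divide_right_mono)
    note split = cutoff_split[OF f g(1) s\<eta>]
    have "fun_support (\<lambda>x. g x * (1 - \<eta> x)) \<subseteq> fun_support g - ball a e"
      by (rule fun_support_cutoff_complement) (simp add: \<eta>1)
    then have "fun_support (\<lambda>x. g x * (1 - \<eta> x)) \<inter> dist_support f = {}"
      using g(2) e by force
    then have z: "f (\<lambda>x. g x * (1 - \<eta> x)) = 0" using vanish_off_dist_support[OF f split(3)] by blast
    have sup: "fun_support (\<lambda>x. g x * \<eta> x) \<subseteq> cball a (2 * e)"
      using \<eta>0 by (intro fun_support_subset) force+
    have "norm (f (\<lambda>x. g x * \<eta> x)) \<le> C * (K * e)"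
    proof (rule C(2)[OF test_fun_schwartz[OF split(2)]])
      fix x and k :: "'n multi_index" assume k: "mi_size k \<le> m"
      define js where "js = mi_list k"
      have l: "length js \<le> m" unfolding js_def length_mi_list using k .
      show "(1 + norm x) ^ n * norm (mi_deriv k (\<lambda>x. g x * \<eta> x) x) \<le> K * e"
      proof (cases "x \<in> cball a (2 * e)")
        case False
        then have "pderivs js (\<lambda>x. g x * \<eta> x) x = 0" using sup pderivs_notin_fun_support by blast
        then show ?thesis using K e unfolding mi_deriv_eq_pderivs js_def by simp
      next
        case True
        have gb: "norm (pderivs is g x) \<le> A * 2 ^ Suc m * e ^ Suc m / e ^ length is" if "length is \<le> length js" for "is"
        proof -
          have l': "length is \<le> Suc m" using that l by simp
          have "norm (pderivs is g x) \<le> A * norm (x - a) ^ (Suc m - length is)" using A(2) l' by blast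
          also have "\<dots> \<le> A * (2 * e) ^ (Suc m - length is)"
            using True A by (intro mult_left_mono power_mono) (auto simp: dist_norm norm_minus_commute)
          also have "\<dots> = A * 2 ^ (Suc m - length is) * (e ^ Suc m / e ^ length is)"
            using e l' by (simp add: power_mult_distrib power_diff)
          also have "\<dots> \<le> A * 2 ^ Suc m * (e ^ Suc m / e ^ length is)"
            using e A by (intro mult_right_mono mult_left_mono power_increasing) auto
          finally show ?thesis by simp
        qed
        have "norm (pderivs js (\<lambda>x. g x * \<eta> x) x) \<le> (A * 2 ^ Suc m * e ^ Suc m) * Bb * (2 / e) ^ length js"
          by (rule norm_pderivs_mult_le[OF e(1) test_fun_smooth[OF g(1)] s\<eta>])
             (use gb \<eta>B l in auto)
        \<comment> \<open>The vanishing of \<open>g\<close> supplies \<open>m + 1\<close> powers of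
          \<open>e\<close> and the derivatives consume at most \<open>m\<close> of them, so one
          factor \<open>e\<close> survives.\<close>
        also have "\<dots> = A * 2 ^ Suc m * Bb * (2 ^ length js * (e * e ^ (m - length js)))"
          using e l by (simp add: power_divide power_diff)
        also have "\<dots> \<le> A * 2 ^ Suc m * Bb * (2 ^ m * (e * 1))"
          using e l A Bb by (intro mult_left_mono mult_mono power_increasing power_le_one) auto
        finally have 1: "norm (pderivs js (\<lambda>x. g x * \<eta> x) x) \<le> A * 2 ^ Suc m * Bb * 2 ^ m * e" by simp
        have "norm x \<le> norm a + 2"
          using True norm_triangle_sub[of x a] e by (simp add: dist_norm norm_minus_commute)
        then have 2: "(1 + norm x) ^ n \<le> (norm a + 3) ^ n" by (intro power_mono) auto
        show ?thesis using mult_mono[OF 2 1] A Bb e unfolding K_def mi_deriv_eq_pderivs js_def by (simp add: mult_ac)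
      qed
    qed
    then show ?thesis using split(1) z by (simp add: mult_ac)
  qed
  have "norm (f g) \<le> C * K / N" if "N \<ge> 1" for N
    using main[of "1 / N"] that by simp
  then show ?thesis by (rule zero_if_norm_le_inverse)
qed

section \<open>Structure theorem for distributions with discrete support\<close>

lemma isolated_radius:
  fixes x :: "'a::metric_space"
  assumes "discrete_set A"
  obtains r where "r > 0" "A \<inter> ball x r \<subseteq> {x}"
proof -
  have "\<not> x islimpt A" using assms by (simp add: discrete_set_def)
  then obtain r where "r > 0" "\<forall>y\<in>A. y \<noteq> x \<longrightarrow> dist y x \<ge> r"
    unfolding islimpt_approachable by (meson not_le)
  then show ?thesis using that[of r] by (force simp: dist_commute)
qed

lemma finite_discrete_Int_compact: "discrete_set A \<Longrightarrow> compact K \<Longrightarrow> finite (K \<inter> A)"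
  using finite_not_islimpt_in_compact by (metis discrete_set_def)

text \<open>Near \<open>a\<close> the value \<open>f \<phi>\<close> depends only on the derivatives
  of \<open>\<phi>\<close> at \<open>a\<close> up to order \<open>m\<close>: subtracting the
  combination of dual functions with these derivatives leaves a function flat at \<open>a\<close>,
  on which \<open>f\<close> vanishes. Here \<open>m\<close> comes from the global continuity bound,
  so it is the same at all support points.\<close>

lemma point_expansion_exists:
  fixes f :: "('n::finite) functional"
  assumes f: "tempered f" and disc: "discrete_set (dist_support f)"
  shows "\<exists>m p. point_expansion f m p"
proof -
  let ?\<Lambda> = "dist_support f"
  obtain C n m where C: "C \<ge> 0" "\<And>\<phi> B. \<phi> \<in> schwartz \<Longrightarrow>
    (\<And>x k. mi_size k \<le> m \<Longrightarrow> (1 + norm x) ^ n * norm (mi_deriv k \<phi> x) \<le> B) \<Longrightarrow> norm (f \<phi>) \<le> C * B"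
    using tempered_bound[OF f] by metis
  have "\<forall>a. \<exists>r>0. ?\<Lambda> \<inter> ball a r \<subseteq> {a}" using isolated_radius[OF disc] by metis
  then obtain R where R: "\<And>a. R a > 0" "\<And>a. ?\<Lambda> \<inter> ball a (R a) \<subseteq> {a}" by metis
  have "\<forall>a k. \<exists>\<omega>. \<omega> \<in> test_fun \<and> fun_support \<omega> \<subseteq> ball a (R a) \<and>
      (\<forall>k'. mi_deriv k' \<omega> a = (if k' = k then 1 else 0))"
    using dual_test_fun_exists[OF R(1)] by metis
  then obtain \<omega> where \<omega>: "\<And>a k. \<omega> a k \<in> test_fun" "\<And>a k. fun_support (\<omega> a k) \<subseteq> ball a (R a)"
    "\<And>a k k'. mi_deriv k' (\<omega> a k) a = (if k' = k then 1 else 0)"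
    by metis
  define M where "M = {k :: 'n multi_index. mi_size k \<le> m}"
  have finM: "finite M" unfolding M_def by (rule finite_mi_size_le)
  define T where "T a \<phi> = (\<Sum>k\<in>M. mi_deriv k \<phi> a * f (\<omega> a k))" for a \<phi>
  have local: "f \<phi> = T a \<phi>" if \<phi>: "\<phi> \<in> test_fun" "fun_support \<phi> \<subseteq> ball a (R a)" for \<phi> a
  proof -
    define h where "h x = (\<Sum>k\<in>M. mi_deriv k \<phi> a * \<omega> a k x)" for x
    have t: "(\<lambda>x. mi_deriv k \<phi> a * \<omega> a k x) \<in> test_fun" for k using \<omega>(1) test_fun_cmult by blast
    have h: "h \<in> test_fun" unfolding h_def using t by (rule test_fun_sum)
    have fh: "f h = T a \<phi>" unfolding h_def T_def
      using tempered_sum[OF f, of M "\<lambda>k x. mi_deriv k \<phi> a * \<omega> a k x"] t by (simp add: tempered_cmult[OF f] \<omega>(1) test_fun_schwartz)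
    have "f (\<lambda>x. \<phi> x - h x) = 0"
    proof (rule flat_at_support_point_zero[OF f C test_fun_diff[OF \<phi>(1) h]])
      have "fun_support (\<lambda>x. \<phi> x - h x) \<subseteq> fun_support \<phi> \<union> (\<Union>k\<in>M. fun_support (\<omega> a k))"
      proof (rule fun_support_subset)
        show "closed (fun_support \<phi> \<union> (\<Union>k\<in>M. fun_support (\<omega> a k)))"
          using finM closed_fun_support by (intro closed_Un closed_UN) auto
        show "x \<in> fun_support \<phi> \<union> (\<Union>k\<in>M. fun_support (\<omega> a k))" if "\<phi> x - h x \<noteq> 0" for x
        proof (rule ccontr)
          assume "x \<notin> fun_support \<phi> \<union> (\<Union>k\<in>M. fun_support (\<omega> a k))"
          then have "\<phi> x = 0" "\<And>k. k \<in> M \<Longrightarrow> \<omega> a k x = 0" using notin_fun_support by auto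
          then show False using that by (simp add: h_def)
        qed
      qed
      also have "\<dots> \<subseteq> ball a (R a)" using \<phi>(2) \<omega>(2) by blast
      finally show "fun_support (\<lambda>x. \<phi> x - h x) \<inter> ?\<Lambda> \<subseteq> {a}" using R(2) by blast
      fix k :: "'n multi_index" assume k: "mi_size k \<le> m"
      have "mi_deriv k h a = (\<Sum>j\<in>M. mi_deriv j \<phi> a * mi_deriv k (\<omega> a j) a)"
        unfolding h_def mi_deriv_eq_pderivs[of k]
        using t by (simp add: pderivs_sum test_fun_smooth pderivs_cmult \<omega>(1))
      also have "\<dots> = (\<Sum>j\<in>M. if j = k then mi_deriv j \<phi> a else 0)"
        by (intro sum.cong) (auto simp: \<omega>(3))
      also have "\<dots> = mi_deriv k \<phi> a" using finM k by (simp add: M_def)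
      finally show "mi_deriv k (\<lambda>x. \<phi> x - h x) a = 0"
        unfolding mi_deriv_eq_pderivs using \<phi> h by (simp add: pderivs_diff test_fun_smooth)
    qed
    then show ?thesis
      using tempered_diff[OF f \<phi>(1)[THEN test_fun_schwartz] h[THEN test_fun_schwartz]] fh by simp
  qed
  \<comment> \<open>Support points that meet the support of \<open>\<phi>\<close> are split off one
    at a time with cutoffs; discreteness makes their number finite.\<close>
  have global: "f \<phi> = (\<Sum>a\<in>S. T a \<phi>)"
    if "finite S" "S \<subseteq> ?\<Lambda>" "\<phi> \<in> test_fun" "fun_support \<phi> \<inter> ?\<Lambda> \<subseteq> S" for S \<phi>
    using that
  proof (induction S arbitrary: \<phi>)
    case empty
    then show ?case using vanish_off_dist_support[OF f] by simp
  next
    case (insert a S)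
    obtain \<eta> where \<eta>: "\<eta> \<in> test_fun" "\<And>y. dist a y \<le> R a / 3 \<Longrightarrow> \<eta> y = 1" "\<And>y. dist a y \<ge> 2 * (R a / 3) \<Longrightarrow> \<eta> y = 0"
      using cutoff_exists[of "R a / 3" a] R(1) by (metis zero_less_divide_iff zero_less_numeral)
    have R3: "R a / 3 > 0" "2 * (R a / 3) < R a" using R(1)[of a] by auto
    note split = cutoff_split[OF f insert.prems(2) test_fun_smooth[OF \<eta>(1)]]
    have "fun_support (\<lambda>x. \<phi> x * \<eta> x) \<subseteq> cball a (2 * (R a / 3))"
      using \<eta>(3) by (intro fun_support_subset) force+
    then have "fun_support (\<lambda>x. \<phi> x * \<eta> x) \<subseteq> ball a (R a)" using R3 by fastforce
    then have "f (\<lambda>x. \<phi> x * \<eta> x) = T a (\<lambda>x. \<phi> x * \<eta> x)" using local split(2) by blast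
    also have "\<dots> = T a \<phi>"
    proof -
      have "mi_deriv k (\<lambda>x. \<phi> x * \<eta> x) a = mi_deriv k \<phi> a" for k
        unfolding mi_deriv_eq_pderivs
        by (rule pderivs_local[of "ball a (R a / 3)"]) (use R3 \<eta>(2) in auto)
      then show ?thesis by (simp add: T_def)
    qed
    finally have 1: "f (\<lambda>x. \<phi> x * \<eta> x) = T a \<phi>" .
    have "fun_support (\<lambda>x. \<phi> x * (1 - \<eta> x)) \<subseteq> fun_support \<phi> - ball a (R a / 3)"
      by (rule fun_support_cutoff_complement) (simp add: \<eta>(2))
    then have "fun_support (\<lambda>x. \<phi> x * (1 - \<eta> x)) \<inter> ?\<Lambda> \<subseteq> S"
      using insert.prems(3) R3 by force
    then have "f (\<lambda>x. \<phi> x * (1 - \<eta> x)) = (\<Sum>b\<in>S. T b (\<lambda>x. \<phi> x * (1 - \<eta> x)))"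
      using insert.IH[OF _ split(3)] insert.prems by blast
    also have "\<dots> = (\<Sum>b\<in>S. T b \<phi>)"
    proof (rule sum.cong[OF refl])
      fix b assume b: "b \<in> S"
      \<comment> \<open>No other support point lies within \<open>R a\<close> of \<open>a\<close>,
        so the cutoff vanishes in a neighbourhood of \<open>b\<close> and the derivatives of
        \<open>\<phi>\<close> there are unchanged.\<close>
      then have "b \<in> - cball a (2 * (R a / 3))"
        using insert R(2)[of a] R3 by (force simp: dist_commute)
      then have "mi_deriv k (\<lambda>x. \<phi> x * (1 - \<eta> x)) b = mi_deriv k \<phi> b" for k
        unfolding mi_deriv_eq_pderivs
        by (intro pderivs_local[of "- cball a (2 * (R a / 3))"]) (use \<eta>(3) in auto)
      then show "T b (\<lambda>x. \<phi> x * (1 - \<eta> x)) = T b \<phi>" by (simp add: T_def)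
    qed
    finally show ?case using 1 split(1) insert by simp
  qed
  \<comment> \<open>The sign compensates the one in \<open>dist_deriv\<close>.\<close>
  define p where "p a k = (-1) ^ mi_size k * f (\<omega> a k)" for a and k :: "'n multi_index"
  have Tp: "(\<Sum>k | mi_size k \<le> m. p a k * dist_deriv k (dirac a) \<phi>) = T a \<phi>" for a \<phi>
    unfolding T_def M_def p_def dist_deriv_def dirac_def
    by (intro sum.cong) (auto simp: mult_ac simp flip: power_mult_distrib)
  have "point_expansion f m p"
    unfolding point_expansion_def Tp
  proof
    fix \<phi> :: "real^'n \<Rightarrow> complex" assume \<phi>: "\<phi> \<in> test_fun"
    define S where "S = fun_support \<phi> \<inter> ?\<Lambda>"
    have fin: "finite S" unfolding S_def
      using finite_discrete_Int_compact[OF disc] \<phi> by (simp add: test_fun_def)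
    have "((\<lambda>a. T a \<phi>) has_sum f \<phi>) S"
      using global[OF fin, of \<phi>] \<phi> has_sum_finite[OF fin, of "\<lambda>a. T a \<phi>"] by (simp add: S_def)
    moreover have "T a \<phi> = 0" if "a \<in> ?\<Lambda> - S" for a
      using that unfolding T_def S_def mi_deriv_eq_pderivs by (auto simp: pderivs_notin_fun_support)
    ultimately show "((\<lambda>a. T a \<phi>) has_sum f \<phi>) ?\<Lambda>"
      using has_sum_cong_neutral[of ?\<Lambda> S "\<lambda>a. T a \<phi>" "\<lambda>a. T a \<phi>"] by (auto simp: S_def)
  qed
  then show ?thesis by blast
qed

lemma point_expansion_dist_coeff:
  assumes "tempered f" "discrete_set (dist_support f)"
  shows "point_expansion f (dist_ord f) (dist_coeff f)"
proof -
  have "\<exists>p. point_expansion f (dist_ord f) p"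
    unfolding dist_ord_def by (rule LeastI_ex) (rule point_expansion_exists[OF assms])
  then show ?thesis unfolding dist_coeff_def by (rule someI_ex)
qed

lemma dist_eq_local_expansion:
  assumes "tempered f" "discrete_set (dist_support f)"
    "\<phi> \<in> test_fun" "a \<in> dist_support f" "fun_support \<phi> \<inter> dist_support f \<subseteq> {a}"
  shows "f \<phi> = (\<Sum>k | mi_size k \<le> dist_ord f. dist_coeff f a k * (-1) ^ mi_size k * mi_deriv k \<phi> a)"
proof -
  define T where "T l = (\<Sum>k | mi_size k \<le> dist_ord f. dist_coeff f l k * dist_deriv k (dirac l) \<phi>)" for l
  have "(T has_sum f \<phi>) (dist_support f)"
    using point_expansion_dist_coeff[OF assms(1,2)] assms(3) unfolding point_expansion_def T_def by blast
  moreover have "T l = 0" if "l \<in> dist_support f - {a}" for l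
  proof -
    have "l \<notin> fun_support \<phi>" using that assms(5) by blast
    then show ?thesis unfolding T_def dist_deriv_def dirac_def mi_deriv_eq_pderivs
      by (simp add: pderivs_notin_fun_support)
  qed
  ultimately have "(T has_sum f \<phi>) {a}"
    using has_sum_cong_neutral[of "dist_support f" "{a}" T T] assms(4) by auto
  then have "f \<phi> = T a" using has_sum_finite[of "{a}" T] has_sum_unique by fastforce
  then show ?thesis unfolding T_def dist_deriv_def dirac_def by (simp add: mult.assoc)
qed

text \<open>\<open>kappa\<close> is a supremum over a nonempty finite set of multi-indices, hence
  attained; it is nonnegative, so the infimum over the support is taken over a set bounded below and
  is a genuine lower bound.\<close>

lemma dist_coeff_lower_bound:
  assumes "(INF l\<in>dist_support f. kappa f l) > 0" "a \<in> dist_support f"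
  shows "\<exists>k. mi_size k \<le> dist_ord f \<and> norm (dist_coeff f a k) \<ge> (INF l\<in>dist_support f. kappa f l)"
proof -
  have k: "kappa f l = Max ((\<lambda>k. norm (dist_coeff f l k)) ` {k. mi_size k \<le> dist_ord f})"
    "kappa f l \<in> (\<lambda>k. norm (dist_coeff f l k)) ` {k. mi_size k \<le> dist_ord f}" for l
  proof -
    have "{k :: 'a multi_index. mi_size k \<le> dist_ord f} \<noteq> {}" using mi_size_zero by (metis empty_iff le0 mem_Collect_eq)
    then have ne: "(\<lambda>k. norm (dist_coeff f l k)) ` {k. mi_size k \<le> dist_ord f} \<noteq> {}" by blast
    show "kappa f l = Max ((\<lambda>k. norm (dist_coeff f l k)) ` {k. mi_size k \<le> dist_ord f})"
      unfolding kappa_def using cSup_eq_Max[OF finite_imageI[OF finite_mi_size_le] ne] .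
    then show "kappa f l \<in> (\<lambda>k. norm (dist_coeff f l k)) ` {k. mi_size k \<le> dist_ord f}"
      using Max_in[OF finite_imageI[OF finite_mi_size_le] ne] by metis
  qed
  have "bdd_below (kappa f ` dist_support f)"
  proof (rule bdd_belowI[of _ 0])
    fix y assume "y \<in> kappa f ` dist_support f"
    then obtain l where "y = kappa f l" by blast
    then show "0 \<le> y" using k(2)[of l] by auto
  qed
  then have "(INF l\<in>dist_support f. kappa f l) \<le> kappa f a" using assms(2) by (rule cINF_lower)
  then show ?thesis using k(2)[of a] by auto
qed

text \<open>Compactly supported smooth functions are dense in the Schwartz space, so a distribution with
  empty support vanishes.\<close>

lemma dist_support_nonempty:
  fixes f :: "('n::finite) functional"
  assumes f: "tempered f" and nz: "nonzero_dist f"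
  shows "dist_support f \<noteq> {}"
proof
  assume "dist_support f = {}"
  then have z: "f \<phi> = 0" if "\<phi> \<in> test_fun" for \<phi> using vanish_off_dist_support[OF f that] by simp
  obtain \<phi> where \<phi>: "\<phi> \<in> schwartz" "f \<phi> \<noteq> 0" using nz unfolding nonzero_dist_def by blast
  obtain C n m where C: "C \<ge> 0" "\<And>\<phi> B. \<phi> \<in> schwartz \<Longrightarrow>
    (\<And>x k. mi_size k \<le> m \<Longrightarrow> (1 + norm x) ^ n * norm (mi_deriv k \<phi> x) \<le> B) \<Longrightarrow> norm (f \<phi>) \<le> C * B"
    using tempered_bound[OF f] by metis
  \<comment> \<open>One weight factor more than the continuity bound uses: outside the ball of
    radius \<open>N\<close> it becomes the factor \<open>1 / N\<close>, and inside that ball the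
    cut-off remainder vanishes.\<close>
  obtain A where A: "A \<ge> 0" "\<And>x js. length js \<le> m \<Longrightarrow> (1 + norm x) ^ Suc n * norm (pderivs js \<phi> x) \<le> A"
    using schwartz_pderivs_bounded[OF \<phi>(1)] by metis
  obtain Bb where Bb: "Bb \<ge> 0" "\<And>x js. length js \<le> m \<Longrightarrow> norm (pderivs js bump (x :: real ^ 'n)) \<le> Bb"
    using test_fun_pderivs_bounded[OF bump_test_fun] by metis
  define K where "K = A * (1 + Bb) * 2 ^ m"
  have K: "K \<ge> 0" using A Bb by (simp add: K_def)
  have main: "norm (f \<phi>) \<le> C * (K / N)" if N: "N \<ge> 1" for N
  proof -
    define \<eta> where "\<eta> x = bump (0 + (1/N) *\<^sub>R x)" for x :: "real^'n"
    define \<psi> where "\<psi> x = 1 - \<eta> x" for x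
    have s\<eta>: "smooth \<eta>" unfolding \<eta>_def by (rule smooth_affine[OF smooth_bump])
    have s\<psi>: "smooth \<psi>" unfolding \<psi>_def using s\<eta> by (intro smooth_diff smooth_const)
    have \<eta>1: "\<eta> x = 1" if "norm x \<le> N" for x
      unfolding \<eta>_def using that N by (intro bump_eq_1) simp
    have \<eta>0: "norm x \<le> 2 * N" if "\<eta> x \<noteq> 0" for x
    proof (rule ccontr)
      assume "\<not> norm x \<le> 2 * N"
      then have "\<eta> x = 0" unfolding \<eta>_def using N by (intro bump_eq_0) (simp add: pos_le_divide_eq)
      then show False using that by simp
    qed
    have \<psi>B: "norm (pderivs js \<psi> x) \<le> (1 + Bb) / 1 ^ length js" if "length js \<le> m" for js x
    proof -
      have "norm (pderivs js \<eta> x) \<le> 1 * Bb"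
        unfolding \<eta>_def pderivs_affine[OF smooth_bump] norm_mult
        using Bb(2)[OF that] N by (intro mult_mono) (auto simp: norm_power norm_divide intro!: power_le_one)
      moreover have "pderivs js \<psi> x = (if js = [] then 1 else 0) - pderivs js \<eta> x"
        unfolding \<psi>_def by (simp add: pderivs_diff[OF smooth_const s\<eta>] pderivs_const)
      ultimately show ?thesis using norm_triangle_ineq4[of "if js = [] then 1 else 0" "pderivs js \<eta> x"]
        by (auto split: if_splits)
    qed
    have s\<phi>: "smooth \<phi>" using \<phi> schwartz_smooth by blast
    have "(\<lambda>x. \<eta> x * \<phi> x) \<in> test_fun"
      using test_fun_mult[OF test_funI[OF s\<eta> \<eta>0] s\<phi>] .
    then have t: "(\<lambda>x. \<phi> x * \<eta> x) \<in> test_fun" by (simp add: mult.commute)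
    have e: "(\<lambda>x. \<phi> x * \<psi> x) = (\<lambda>x. \<phi> x - \<phi> x * \<eta> x)" by (auto simp: \<psi>_def algebra_simps)
    have sch: "(\<lambda>x. \<phi> x * \<psi> x) \<in> schwartz"
      unfolding e using schwartz_diff[OF \<phi>(1) test_fun_schwartz[OF t]] .
    have fe: "f (\<lambda>x. \<phi> x * \<psi> x) = f \<phi>"
      unfolding e using tempered_diff[OF f \<phi>(1) test_fun_schwartz[OF t]] z[OF t] by simp
    have "norm (f (\<lambda>x. \<phi> x * \<psi> x)) \<le> C * (K / N)"
    proof (rule C(2)[OF sch])
      fix x and k :: "'n multi_index" assume k: "mi_size k \<le> m"
      define js where "js = mi_list k"
      have l: "length js \<le> m" unfolding js_def length_mi_list using k .
      show "(1 + norm x) ^ n * norm (mi_deriv k (\<lambda>x. \<phi> x * \<psi> x) x) \<le> K / N"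
      proof (cases "norm x < N")
        case True
        have "pderivs js (\<lambda>x. \<phi> x * \<psi> x) x = pderivs js (\<lambda>x. 0) x"
          by (rule pderivs_local[of "ball 0 N"]) (use True \<eta>1 in \<open>auto simp: \<psi>_def\<close>)
        then show ?thesis using K N unfolding mi_deriv_eq_pderivs js_def by (simp add: pderivs_const)
      next
        case False
        have pos: "1 + norm x > 0" by (simp add: add_pos_nonneg)
        define a where "a = A / (1 + norm x) ^ Suc n"
        have a0: "a \<ge> 0" unfolding a_def using A by simp
        have "norm (pderivs js (\<lambda>x. \<phi> x * \<psi> x) x) \<le> a * (1 + Bb) * (2 / 1) ^ length js"
        proof (rule norm_pderivs_mult_le[OF _ s\<phi> s\<psi>])
          fix "is" :: "'n list" assume "length is \<le> length js"
          then have l': "length is \<le> m" using l by simp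
          show "norm (pderivs is \<phi> x) \<le> a / 1 ^ length is"
            using A(2)[OF l', of x] pos unfolding a_def by (simp add: pos_le_divide_eq mult.commute)
          show "norm (pderivs is \<psi> x) \<le> (1 + Bb) / 1 ^ length is" using \<psi>B[OF l'] .
        qed simp
        also have "\<dots> \<le> a * (1 + Bb) * 2 ^ m"
          using a0 Bb l by (intro mult_left_mono) (auto intro!: power_increasing)
        finally have "norm (pderivs js (\<lambda>x. \<phi> x * \<psi> x) x) \<le> a * (1 + Bb) * 2 ^ m" .
        then have "(1 + norm x) ^ n * norm (pderivs js (\<lambda>x. \<phi> x * \<psi> x) x) \<le> (1 + norm x) ^ n * (a * (1 + Bb) * 2 ^ m)"
          by (intro mult_left_mono) auto
        also have "\<dots> = K / (1 + norm x)"
        proof -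
          have "u ^ n * (A / u ^ Suc n * (1 + Bb) * 2 ^ m) = A * (1 + Bb) * 2 ^ m / u" if "u > 0" for u
            using that by (simp add: field_simps)
          from this[OF pos] show ?thesis unfolding a_def K_def .
        qed
        also have "\<dots> \<le> K / N" using False N K pos by (intro divide_left_mono) auto
        finally show ?thesis unfolding mi_deriv_eq_pderivs js_def .
      qed
    qed
    then show ?thesis using fe by simp
  qed
  have "f \<phi> = 0" by (rule zero_if_norm_le_inverse[of _ "C * K"]) (use main in simp)
  then show False using \<phi> by simp
qed

lemma test_fun_translate: "\<phi> \<in> test_fun \<Longrightarrow> (\<lambda>x. \<phi> (x - a)) \<in> test_fun"
  using test_fun_affine[of \<phi> 1 "- a"] by simp

lemma mi_deriv_translate: "smooth \<phi> \<Longrightarrow> mi_deriv k (\<lambda>x. \<phi> (x - a)) x = mi_deriv k \<phi> (x - a)"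
  unfolding mi_deriv_eq_pderivs using pderivs_affine[of \<phi> "mi_list k" "- a" 1] by simp

lemma fun_support_translate: "fun_support (\<lambda>x. \<phi> (x - a)) \<subseteq> {x. x - a \<in> fun_support \<phi>}"
proof (rule fun_support_subset)
  show "closed {x. x - a \<in> fun_support \<phi>}"
    using closed_vimage[OF closed_fun_support, of "\<lambda>x. x - a" \<phi>] by (simp add: vimage_def continuous_intros)
qed (use notin_fun_support in blast)

subsection \<open>Characters and integrals\<close>

definition echar :: "real \<Rightarrow> complex" where "echar t = cis (2 * pi * t)"

lemma echar_add: "echar (s + t) = echar s * echar t"
  by (simp add: echar_def cis_mult distrib_left)

lemma norm_echar [simp]: "norm (echar t) = 1" by (simp add: echar_def)

lemma echar_0 [simp]: "echar 0 = 1" by (simp add: echar_def)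

lemma cnj_echar: "cnj (echar t) = echar (- t)" by (simp add: echar_def cis_cnj)

lemma continuous_on_echar [continuous_intros]:
  "continuous_on S g \<Longrightarrow> continuous_on S (\<lambda>x. echar (g x))"
  unfolding echar_def cis_conv_exp by (intro continuous_intros)

lemma echar_second_order:
  "norm (echar (s + t) - echar s - 2 * of_real pi * \<i> * of_real t * echar s) \<le> (2 * pi * t)\<^sup>2"
proof -
  define z where "z = \<i> * of_real (2 * pi * t)"
  have z: "echar t = exp z" "norm z = \<bar>2 * pi * t\<bar>" "Re z = 0"
    unfolding echar_def cis_conv_exp z_def by (simp_all add: norm_mult abs_mult)
  have "norm (exp z - 1 - z) \<le> norm z ^ 2"
    using Taylor_exp[of z 1] z by (simp add: algebra_simps numeral_2_eq_2)
  moreover have "echar (s + t) - echar s - 2 * of_real pi * \<i> * of_real t * echar s = echar s * (exp z - 1 - z)"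
    unfolding echar_add z(1) by (simp add: z_def algebra_simps)
  ultimately show ?thesis using z by (simp add: norm_mult)
qed

lemma inner_square_le: "(c * (v \<bullet> y))\<^sup>2 \<le> (c * norm y)\<^sup>2 * (norm v)\<^sup>2"
proof -
  have "(v \<bullet> y)\<^sup>2 \<le> (norm v * norm y)\<^sup>2"
    using Cauchy_Schwarz_ineq2[of v y] by (metis abs_ge_zero power2_abs power_mono)
  then have "c\<^sup>2 * (v \<bullet> y)\<^sup>2 \<le> c\<^sup>2 * (norm v * norm y)\<^sup>2" by (rule mult_left_mono) simp
  then show ?thesis by (simp add: power_mult_distrib mult_ac)
qed

lemma fourier_eq: "fourier \<phi> y = (\<integral>x. \<phi> x * echar (- (x \<bullet> y)) \<partial>lborel)"
proof -
  have "exp (- (2 * of_real pi * \<i> * of_real t)) = echar (- t)" for t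
    by (simp add: echar_def cis_conv_exp mult_ac)
  then show ?thesis unfolding fourier_def by simp
qed

section \<open>Integration and differentiation under the integral\<close>

lemma integrable_continuous_bounded_support:
  fixes h :: "'a::euclidean_space \<Rightarrow> 'b::{banach, second_countable_topology}"
  assumes "continuous_on UNIV h" "\<And>x. norm x > r \<Longrightarrow> h x = 0"
  shows "integrable lborel h"
proof -
  have "integrable lborel (\<lambda>x. indicator (cball 0 r) x *\<^sub>R h x)"
    by (rule borel_integrable_compact) (use assms in \<open>auto intro: continuous_on_subset\<close>)
  also have "(\<lambda>x. indicator (cball 0 r) x *\<^sub>R h x) = h"
    using assms(2) by (auto simp: indicator_def fun_eq_iff)
  finally show ?thesis .
qed

lemma test_fun_mult_integrable:
  assumes "\<phi> \<in> test_fun" "continuous_on UNIV g" shows "integrable lborel (\<lambda>x. \<phi> x * g x)"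
proof -
  obtain r where r: "\<And>x. norm x > r \<Longrightarrow> \<phi> x = 0" using test_fun_radius[OF assms(1)] by metis
  show ?thesis
    by (rule integrable_continuous_bounded_support[of _ r])
       (use continuous_on_mult[OF smooth_continuous_on[OF test_fun_smooth[OF assms(1)]] assms(2)] r in auto)
qed

lemma integral_lborel_affine:
  fixes g :: "'a::euclidean_space \<Rightarrow> 'b::{banach, second_countable_topology}"
  assumes "g \<in> borel_measurable borel" "c \<noteq> 0"
  shows "(\<integral>x. g x \<partial>lborel) = \<bar>c\<bar> ^ DIM('a) *\<^sub>R (\<integral>x. g (t + c *\<^sub>R x) \<partial>lborel)"
proof -
  have m: "(\<lambda>x::'a. t + c *\<^sub>R x) \<in> lborel \<rightarrow>\<^sub>M borel" by simp
  have "(\<integral>x. g x \<partial>lborel) =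
      (\<integral>x. g x \<partial>(density (distr lborel borel (\<lambda>x. t + c *\<^sub>R x)) (\<lambda>_. ennreal (\<bar>c\<bar> ^ DIM('a)))))"
    using lborel_affine[OF assms(2), of t] by simp
  also have "\<dots> = (\<integral>x. \<bar>c\<bar> ^ DIM('a) *\<^sub>R g x \<partial>(distr lborel borel (\<lambda>x. t + c *\<^sub>R x)))"
    using assms by (intro integral_density) auto
  also have "\<dots> = (\<integral>x. \<bar>c\<bar> ^ DIM('a) *\<^sub>R g (t + c *\<^sub>R x) \<partial>lborel)"
    using assms by (intro integral_distr) auto
  finally show ?thesis by simp
qed

lemma norm_integral_le:
  fixes f :: "'a \<Rightarrow> 'b::{banach, second_countable_topology}"
  assumes "integrable M f" "integrable M B" "\<And>x. norm (f x) \<le> B x"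
  shows "norm (\<integral>x. f x \<partial>M) \<le> (\<integral>x. B x \<partial>M)"
  by (rule order_trans[OF integral_norm_bound integral_mono]) (use assms in auto)

lemma has_derivative_of_quadratic_remainder:
  fixes f :: "'a::real_normed_vector \<Rightarrow> 'b::real_normed_vector"
  assumes "bounded_linear D" "\<And>v. norm (f (x + v) - f x - D v) \<le> K * (norm v)\<^sup>2"
  shows "(f has_derivative D) (at x)"
  unfolding has_derivative_at_alt
proof (intro conjI allI impI)
  fix e :: real assume e: "e > 0"
  show "\<exists>d>0. \<forall>y. norm (y - x) < d \<longrightarrow> norm (f y - f x - D (y - x)) \<le> e * norm (y - x)"
  proof (intro exI[of _ "e / (\<bar>K\<bar> + 1)"] conjI allI impI)
    show "e / (\<bar>K\<bar> + 1) > 0" using e by simp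
    fix y assume "norm (y - x) < e / (\<bar>K\<bar> + 1)"
    then have "(\<bar>K\<bar> + 1) * norm (y - x) \<le> e" by (simp add: pos_less_divide_eq mult.commute)
    then have "(\<bar>K\<bar> + 1) * norm (y - x) * norm (y - x) \<le> e * norm (y - x)" by (rule mult_right_mono) simp
    moreover have "norm (f y - f x - D (y - x)) \<le> K * (norm (y - x))\<^sup>2" using assms(2)[of "y - x"] by simp
    moreover have "K * (norm (y - x))\<^sup>2 \<le> (\<bar>K\<bar> + 1) * (norm (y - x))\<^sup>2" by (intro mult_right_mono) auto
    ultimately show "norm (f y - f x - D (y - x)) \<le> e * norm (y - x)" by (simp add: power2_eq_square mult.assoc)
  qed
qed (rule assms(1))

text \<open>A quadratic remainder bound with integrable factor \<open>B\<close> survives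
  integration, so the derivative of the integral is read off from
  \<open>has_derivative_of_quadratic_remainder\<close>.\<close>

lemma has_derivative_integral:
  fixes g :: "real ^ 'n::finite \<Rightarrow> 'b \<Rightarrow> complex"
  assumes g: "\<And>x. integrable M (g x)" and D: "\<And>i. integrable M (D i)" and B: "integrable M B"
    and bd: "\<And>v t. norm (g (x + v) t - g x t - (\<Sum>i\<in>UNIV. v $ i *\<^sub>R D i t)) \<le> B t * (norm v)\<^sup>2"
  shows "((\<lambda>x. \<integral>t. g x t \<partial>M) has_derivative (\<lambda>v. \<Sum>i\<in>UNIV. v $ i *\<^sub>R (\<integral>t. D i t \<partial>M))) (at x)"
proof (rule has_derivative_of_quadratic_remainder)
  show "bounded_linear (\<lambda>v::real^'n. \<Sum>i\<in>UNIV. v $ i *\<^sub>R (\<integral>t. D i t \<partial>M))"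
    by (intro bounded_linear_sum bounded_linear_scaleR_const bounded_linear_vec_nth)
  fix v
  have int: "integrable M (\<lambda>t. g (x + v) t - g x t - (\<Sum>i\<in>UNIV. v $ i *\<^sub>R D i t))"
    using g D by (intro Bochner_Integration.integrable_diff Bochner_Integration.integrable_sum integrable_scaleR_right) auto
  have "(\<integral>t. g (x + v) t \<partial>M) - (\<integral>t. g x t \<partial>M) - (\<Sum>i\<in>UNIV. v $ i *\<^sub>R (\<integral>t. D i t \<partial>M))
      = (\<integral>t. g (x + v) t - g x t - (\<Sum>i\<in>UNIV. v $ i *\<^sub>R D i t) \<partial>M)"
    using g D by (simp add: Bochner_Integration.integral_diff Bochner_Integration.integral_sum)
  also have "norm \<dots> \<le> (\<integral>t. B t * (norm v)\<^sup>2 \<partial>M)"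
    by (rule norm_integral_le[OF int]) (use B bd in auto)
  finally show "norm ((\<integral>t. g (x + v) t \<partial>M) - (\<integral>t. g x t \<partial>M) - (\<Sum>i\<in>UNIV. v $ i *\<^sub>R (\<integral>t. D i t \<partial>M)))
      \<le> (\<integral>t. B t \<partial>M) * (norm v)\<^sup>2" by simp
qed

section \<open>Fourier transforms of test functions\<close>

definition inv_fourier :: "(real ^ 'n::finite \<Rightarrow> complex) \<Rightarrow> real ^ 'n \<Rightarrow> complex"
  where "inv_fourier \<phi> y = (\<integral>x. \<phi> x * echar (x \<bullet> y) \<partial>lborel)"

lemma inv_fourier_eq: "inv_fourier \<phi> y = fourier \<phi> (- y)"
  by (simp add: inv_fourier_def fourier_eq)

lemma sum_axis_scaleR: "(\<Sum>j\<in>UNIV. axis (i::'n::finite) (1::real) $ j *\<^sub>R c j) = (c i :: complex)"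
proof -
  have "(\<Sum>j\<in>UNIV. axis i (1::real) $ j *\<^sub>R c j) = (\<Sum>j\<in>UNIV. if j = i then c j else 0)"
    by (intro sum.cong) (auto simp: axis_def)
  then show ?thesis by simp
qed

text \<open>Differentiating under the integral multiplies \<open>\<phi>\<close> by
  \<open>2 pi i\<close> times a coordinate, which gives again a test function; so the image of
  \<open>test_fun\<close> is a family for \<open>smooth_coinduct\<close>.\<close>

lemma smooth_inv_fourier:
  fixes \<phi> :: "real ^ 'n::finite \<Rightarrow> complex"
  assumes "\<phi> \<in> test_fun" shows "smooth (inv_fourier \<phi>)"
proof (rule smooth_coinduct[of _ "inv_fourier ` test_fun"])
  show "inv_fourier \<phi> \<in> inv_fourier ` test_fun" using assms by blast
  have main: "(inv_fourier \<phi> has_derivative (\<lambda>v. \<Sum>i\<in>UNIV. v $ i *\<^sub>R inv_fourier (D i) x)) (at x) \<and> D i \<in> test_fun"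
    if \<phi>: "\<phi> \<in> test_fun" and D: "\<And>i. D i = (\<lambda>u. \<phi> u * (2 * of_real pi * \<i> * of_real (u $ i)))"
    for \<phi> :: "real ^ 'n \<Rightarrow> complex" and D x i
  proof
    have Dt: "D i \<in> test_fun" for i unfolding D
      by (intro test_fun_mult[OF \<phi>] smooth_cmult smooth_component)
    show "D i \<in> test_fun" by (rule Dt)
    have cont: "continuous_on UNIV (\<lambda>u::real^'n. echar (u \<bullet> x))" for x by (intro continuous_intros)
    have iB: "integrable lborel (\<lambda>u. norm (\<phi> u * of_real ((2 * pi * norm u)\<^sup>2)))"
      by (intro integrable_norm test_fun_mult_integrable[OF \<phi>] continuous_intros)
    show "(inv_fourier \<phi> has_derivative (\<lambda>v. \<Sum>i\<in>UNIV. v $ i *\<^sub>R inv_fourier (D i) x)) (at x)"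
      unfolding inv_fourier_def
    proof (rule has_derivative_integral[OF _ _ iB])
      fix v u :: "real ^ 'n"
      have "(\<Sum>i\<in>UNIV. v $ i *\<^sub>R (D i u * echar (u \<bullet> x))) =
          \<phi> u * (2 * of_real pi * \<i> * of_real (\<Sum>i\<in>UNIV. u $ i * v $ i) * echar (u \<bullet> x))"
        unfolding D of_real_sum sum_distrib_left sum_distrib_right
        by (intro sum.cong) (auto simp: scaleR_conv_of_real mult_ac)
      also have "(\<Sum>i\<in>UNIV. u $ i * v $ i) = u \<bullet> v" by (simp add: inner_vec_def)
      finally have "\<phi> u * echar (u \<bullet> (x + v)) - \<phi> u * echar (u \<bullet> x) - (\<Sum>i\<in>UNIV. v $ i *\<^sub>R (D i u * echar (u \<bullet> x)))
          = \<phi> u * (echar (u \<bullet> x + u \<bullet> v) - echar (u \<bullet> x) - 2 * of_real pi * \<i> * of_real (u \<bullet> v) * echar (u \<bullet> x))"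
        by (simp add: inner_add_right right_diff_distrib)
      also have "norm \<dots> \<le> norm (\<phi> u) * (2 * pi * (u \<bullet> v))\<^sup>2"
        unfolding norm_mult by (intro mult_left_mono echar_second_order) auto
      also have "\<dots> \<le> norm (\<phi> u) * ((2 * pi * norm u)\<^sup>2 * (norm v)\<^sup>2)"
        by (rule mult_left_mono) (use inner_square_le[of "2 * pi" v u] in \<open>simp_all add: inner_commute\<close>)
      also have "\<dots> = norm (\<phi> u * of_real ((2 * pi * norm u)\<^sup>2)) * (norm v)\<^sup>2"
        by (simp add: norm_mult norm_power)
      finally show "norm (\<phi> u * echar (u \<bullet> (x + v)) - \<phi> u * echar (u \<bullet> x) - (\<Sum>i\<in>UNIV. v $ i *\<^sub>R (D i u * echar (u \<bullet> x))))
        \<le> norm (\<phi> u * of_real ((2 * pi * norm u)\<^sup>2)) * (norm v)\<^sup>2" .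
    qed (use test_fun_mult_integrable[OF \<phi> cont] test_fun_mult_integrable[OF Dt cont] in auto)
  qed
  fix \<psi> :: "real ^ 'n \<Rightarrow> complex" and x i
  assume "\<psi> \<in> inv_fourier ` test_fun"
  then obtain \<rho> where \<rho>: "\<rho> \<in> test_fun" "\<psi> = inv_fourier \<rho>" by blast
  define D where "D i u = \<rho> u * (2 * of_real pi * \<i> * of_real (u $ i))" for i and u :: "real^'n"
  have d: "(\<psi> has_derivative (\<lambda>v. \<Sum>i\<in>UNIV. v $ i *\<^sub>R inv_fourier (D i) x)) (at x) \<and> D i \<in> test_fun" for x i
    using main[OF \<rho>(1), of D x i] unfolding \<rho>(2) D_def by blast
  then show "\<psi> differentiable (at x)" using differentiable_def by blast
  have "partial_deriv i \<psi> = inv_fourier (D i)"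
  proof
    fix x
    show "partial_deriv i \<psi> x = inv_fourier (D i) x"
      using partial_deriv_eqI[OF conjunct1[OF d[of x i]], of i] unfolding sum_axis_scaleR .
  qed
  then show "partial_deriv i \<psi> \<in> inv_fourier ` test_fun" using d by blast
qed

text \<open>All derivatives fall on the test function, so \<open>K\<close> enters only through its
  integrability. The dilation \<open>s\<close> serves two purposes: \<open>s = 1\<close> for the
  autocorrelation of a bump, \<open>s = - (1/N)\<close> for the approximate identity.\<close>

lemma convolution_smooth:
  fixes \<phi> :: "real ^ 'n::finite \<Rightarrow> complex" and K :: "real ^ 'n \<Rightarrow> complex"
  assumes \<phi>: "\<phi> \<in> test_fun" and K: "integrable lborel K"
  shows "smooth (\<lambda>x. \<integral>w. \<phi> (x + s *\<^sub>R w) * K w \<partial>lborel)"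
    and "pderivs is (\<lambda>x. \<integral>w. \<phi> (x + s *\<^sub>R w) * K w \<partial>lborel) =
      (\<lambda>x. \<integral>w. pderivs is \<phi> (x + s *\<^sub>R w) * K w \<partial>lborel)"
    and "integrable lborel (\<lambda>w. \<phi> (x + s *\<^sub>R w) * K w)"
proof -
  let ?C = "\<lambda>\<phi> x. \<integral>w. \<phi> (x + s *\<^sub>R w) * K w \<partial>lborel"
  have int: "integrable lborel (\<lambda>w. \<phi> (x + s *\<^sub>R w) * K w)" if \<phi>: "\<phi> \<in> test_fun" for \<phi> x
  proof -
    obtain B where B: "B \<ge> 0" "\<And>x. norm (\<phi> x) \<le> B" using test_fun_bounded[OF \<phi>] by metis
    have m: "(\<lambda>w. \<phi> (x + s *\<^sub>R w)) \<in> borel_measurable borel"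
      by (intro borel_measurable_continuous_onI continuous_on_compose2[OF smooth_continuous_on[OF test_fun_smooth[OF \<phi>], of UNIV]] continuous_intros) auto
    show ?thesis
    proof (rule Bochner_Integration.integrable_bound[of _ "\<lambda>w. B * norm (K w)"])
      show "AE w in lborel. norm (\<phi> (x + s *\<^sub>R w) * K w) \<le> norm (B * norm (K w))"
        using B by (auto simp: norm_mult intro!: mult_right_mono)
    qed (use K m borel_measurable_integrable[OF K] in auto)
  qed
  then show "integrable lborel (\<lambda>w. \<phi> (x + s *\<^sub>R w) * K w)" using \<phi> by blast
  have der: "(?C \<phi> has_derivative (\<lambda>v. \<Sum>i\<in>UNIV. v $ i *\<^sub>R ?C (partial_deriv i \<phi>) x)) (at x)"
    if \<phi>: "\<phi> \<in> test_fun" for \<phi> x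
  proof -
    obtain C where C: "C \<ge> 0"
      "\<And>x v. norm (\<phi> (x + v) - \<phi> x - (\<Sum>i\<in>UNIV. v $ i *\<^sub>R partial_deriv i \<phi> x)) \<le> C * (norm v)^2"
      using test_fun_second_order[OF \<phi>] by metis
    show ?thesis
    proof (rule has_derivative_integral[where B="\<lambda>w. C * norm (K w)"])
      fix v w :: "real^'n"
      have "\<phi> (x + v + s *\<^sub>R w) * K w - \<phi> (x + s *\<^sub>R w) * K w - (\<Sum>i\<in>UNIV. v $ i *\<^sub>R (partial_deriv i \<phi> (x + s *\<^sub>R w) * K w))
        = (\<phi> ((x + s *\<^sub>R w) + v) - \<phi> (x + s *\<^sub>R w) - (\<Sum>i\<in>UNIV. v $ i *\<^sub>R partial_deriv i \<phi> (x + s *\<^sub>R w))) * K w"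
        by (simp add: left_diff_distrib sum_distrib_right add_ac)
      also have "norm \<dots> \<le> C * (norm v)^2 * norm (K w)"
        unfolding norm_mult by (intro mult_right_mono C(2)) auto
      finally show "norm (\<phi> (x + v + s *\<^sub>R w) * K w - \<phi> (x + s *\<^sub>R w) * K w - (\<Sum>i\<in>UNIV. v $ i *\<^sub>R (partial_deriv i \<phi> (x + s *\<^sub>R w) * K w)))
        \<le> C * norm (K w) * (norm v)\<^sup>2" by (simp add: mult_ac)
    qed (use int \<phi> partial_deriv_test_fun K in auto)
  qed
  have pd: "partial_deriv i (?C \<phi>) = ?C (partial_deriv i \<phi>)" if "\<phi> \<in> test_fun" for \<phi> i
  proof
    show "partial_deriv i (?C \<phi>) x = ?C (partial_deriv i \<phi>) x" for x
      using partial_deriv_eqI[OF der[OF that, of x], of i] unfolding sum_axis_scaleR .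
  qed
  show "smooth (?C \<phi>)"
    by (rule smooth_coinduct[of _ "?C ` test_fun"])
       (use \<phi> der pd in \<open>auto simp: differentiable_def intro!: imageI partial_deriv_test_fun\<close>)
  show "pderivs is (?C \<phi>) = ?C (pderivs is \<phi>)"
    by (induction "is") (use pd pderivs_test_fun[OF \<phi>] in auto)
qed

text \<open>By translation invariance \<open>g (x + v) - g x\<close> has integral zero. For
  \<open>v\<close> of length \<open>h\<close> it differs from \<open>h\<close> times the derivative
  by at most \<open>C * h^2\<close>, and only on a fixed ball, so \<open>h * norm I\<close> is at
  most \<open>C * V * h^2\<close> for all \<open>h\<close> between 0 and 1.\<close>

lemma integral_partial_deriv_zero:
  fixes g :: "real ^ 'n::finite \<Rightarrow> complex"
  assumes g: "g \<in> test_fun"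
  shows "(\<integral>x. partial_deriv i g x \<partial>lborel) = 0"
proof -
  obtain C where C: "C \<ge> 0"
    "\<And>x v. norm (g (x + v) - g x - (\<Sum>i\<in>UNIV. v $ i *\<^sub>R partial_deriv i g x)) \<le> C * (norm v)^2"
    using test_fun_second_order[OF g] by metis
  obtain r where r: "r > 0" "fun_support g \<subseteq> cball 0 r" using test_fun_radius[OF g] by metis
  have cont: "continuous_on UNIV h" if "h \<in> test_fun" for h :: "real ^ 'n \<Rightarrow> complex"
    using that smooth_continuous_on test_fun_smooth by blast
  have int: "integrable lborel h" if "h \<in> test_fun" for h :: "real ^ 'n \<Rightarrow> complex"
    using test_fun_mult_integrable[OF that continuous_on_const[of _ 1]] by simp
  define V where "V = measure lborel (cball (0::real^'n) (r + 1))"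
  define I where "I = (\<integral>x. partial_deriv i g x \<partial>lborel)"
  have bd: "norm I \<le> C * V * h" if h: "0 < h" "h \<le> 1" for h
  proof -
    define v where "v = h *\<^sub>R axis i (1::real)"
    have nv: "norm v = h" using h by (simp add: v_def norm_axis_1)
    define d where "d x = g (x + v) - g x - of_real h * partial_deriv i g x" for x
    have sv: "(\<Sum>j\<in>UNIV. v $ j *\<^sub>R partial_deriv j g x) = of_real h * partial_deriv i g x" for x
    proof -
      have "(\<Sum>j\<in>UNIV. v $ j *\<^sub>R partial_deriv j g x) = h *\<^sub>R (\<Sum>j\<in>UNIV. axis i (1::real) $ j *\<^sub>R partial_deriv j g x)"
        unfolding v_def scaleR_sum_right by simp
      then show ?thesis unfolding sum_axis_scaleR by (simp add: scaleR_conv_of_real)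
    qed
    have db: "norm (d x) \<le> C * h^2 * indicator (cball 0 (r + 1)) x" for x
    proof (cases "x \<in> cball 0 (r + 1)")
      case True
      then show ?thesis using C(2)[of x v] unfolding sv d_def nv by simp
    next
      case False
      then have "norm (x + v) > r" "norm x > r" using nv h norm_diff_ineq[of x v] by auto
      then have "x + v \<notin> fun_support g" "x \<notin> fun_support g" using r by auto
      then have "d x = 0" unfolding d_def
        using notin_fun_support[of _ g] pderivs_notin_fun_support[of _ g "[i]"] by simp
      then show ?thesis using C by simp
    qed
    have tr: "(\<integral>x. g (x + v) \<partial>lborel) = (\<integral>x. g x \<partial>lborel)"
      using integral_lborel_affine[of g 1 v] borel_measurable_continuous_onI[OF cont[OF g]] by (simp add: add.commute)
    have gt: "(\<lambda>x. g (x + v)) \<in> test_fun" using test_fun_translate[OF g, of "- v"] by simp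
    have pt: "(\<lambda>x. of_real h * partial_deriv i g x) \<in> test_fun"
      using test_fun_cmult[OF partial_deriv_test_fun[OF g]] .
    have "(\<integral>x. d x \<partial>lborel) = - (of_real h * I)"
      unfolding d_def I_def using int[OF gt] int[OF g] int[OF pt] tr
      by (simp add: Bochner_Integration.integral_diff)
    moreover have "norm (\<integral>x. d x \<partial>lborel) \<le> (\<integral>x. C * h^2 * indicator (cball (0::real^'n) (r + 1)) x \<partial>lborel)"
    proof (rule norm_integral_le)
      show "integrable lborel d" unfolding d_def using int[OF gt] int[OF g] int[OF pt]
        by (intro Bochner_Integration.integrable_diff)
      show "integrable lborel (\<lambda>x::real^'n. C * h\<^sup>2 * indicator (cball 0 (r + 1)) x)"
        using emeasure_bounded_finite[OF bounded_cball] by (intro integrable_mult_right integrable_real_indicator) auto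
    qed (use db in auto)
    ultimately have "h * norm I \<le> h * (C * V * h)"
      using h by (simp add: norm_mult V_def power2_eq_square mult_ac)
    then show ?thesis using h by simp
  qed
  have "norm I \<le> C * V / N" if "N \<ge> 1" for N
    using bd[of "1 / N"] that by simp
  then have "I = 0" by (rule zero_if_norm_le_inverse)
  then show ?thesis by (simp add: I_def)
qed

lemma smooth_character:
  fixes y :: "real ^ 'n::finite"
  shows "smooth (\<lambda>x. echar (x \<bullet> y))"
    and "partial_deriv i (\<lambda>x. echar (x \<bullet> y)) = (\<lambda>x. 2 * of_real pi * \<i> * of_real (y $ i) * echar (x \<bullet> y))"
proof -
  let ?e = "\<lambda>x::real^'n. echar (x \<bullet> y)"
  have der: "(?e has_derivative (\<lambda>v. 2 * of_real pi * \<i> * of_real (v \<bullet> y) * echar (x \<bullet> y))) (at x)" for x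
  proof (rule has_derivative_of_quadratic_remainder)
    show "bounded_linear (\<lambda>v::real^'n. 2 * of_real pi * \<i> * of_real (v \<bullet> y) * echar (x \<bullet> y))"
      by (intro bounded_linear_mult_const bounded_linear_const_mult bounded_linear_compose[OF bounded_linear_of_real] bounded_linear_inner_left)
    fix v
    have "norm (?e (x + v) - ?e x - 2 * of_real pi * \<i> * of_real (v \<bullet> y) * echar (x \<bullet> y)) \<le> (2 * pi * (v \<bullet> y))\<^sup>2"
      using echar_second_order[of "x \<bullet> y" "v \<bullet> y"] by (simp add: inner_left_distrib)
    also have "\<dots> \<le> (2 * pi * norm y)\<^sup>2 * (norm v)\<^sup>2" by (rule inner_square_le)
    finally show "norm (?e (x + v) - ?e x - 2 * of_real pi * \<i> * of_real (v \<bullet> y) * echar (x \<bullet> y))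
        \<le> (2 * pi * norm y)\<^sup>2 * (norm v)\<^sup>2" .
  qed
  show pd: "partial_deriv i ?e = (\<lambda>x. 2 * of_real pi * \<i> * of_real (y $ i) * echar (x \<bullet> y))" for i
    by (rule ext, subst partial_deriv_eqI[OF der]) (simp add: inner_axis')
  show "smooth ?e"
  proof (rule smooth_coinduct[of _ "range (\<lambda>c x. c * ?e x)"])
    show "?e \<in> range (\<lambda>c x. c * ?e x)" by (rule range_eqI[of _ _ 1]) simp
    fix \<psi> x i assume "\<psi> \<in> range (\<lambda>c x. c * ?e x)"
    then obtain c where c: "\<psi> = (\<lambda>x. c * ?e x)" by blast
    have d: "?e differentiable (at x)" for x using der differentiable_def by blast
    show "\<psi> differentiable (at x)" unfolding c using d by (intro differentiable_mult) auto
    have "partial_deriv i \<psi> = (\<lambda>x. (c * (2 * of_real pi * \<i> * of_real (y $ i))) * ?e x)"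
      unfolding c using partial_deriv_mult[of "\<lambda>x. c" ?e i] d by (simp add: partial_deriv_const pd mult_ac)
    then show "partial_deriv i \<psi> \<in> range (\<lambda>c x. c * ?e x)" by blast
  qed
qed

text \<open>Integration by parts: the derivative of \<open>\<phi>\<close> times the character
  integrates to zero.\<close>

lemma fourier_partial_deriv:
  fixes \<phi> :: "real ^ 'n::finite \<Rightarrow> complex"
  assumes "\<phi> \<in> test_fun"
  shows "fourier (partial_deriv i \<phi>) y = 2 * of_real pi * \<i> * of_real (y $ i) * fourier \<phi> y"
proof -
  let ?e = "\<lambda>x::real^'n. echar (x \<bullet> (- y))"
  note s = smooth_character[where y = "- y"]
  have cont: "continuous_on UNIV ?e" by (intro continuous_intros)
  have "(\<integral>x. partial_deriv i (\<lambda>x. \<phi> x * ?e x) x \<partial>lborel) = 0"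
    by (rule integral_partial_deriv_zero[OF test_fun_mult[OF assms s(1)]])
  moreover have "partial_deriv i (\<lambda>x. \<phi> x * ?e x) =
      (\<lambda>x. partial_deriv i \<phi> x * ?e x - (2 * of_real pi * \<i> * of_real (y $ i)) * (\<phi> x * ?e x))"
    unfolding partial_deriv_mult[OF smooth_differentiable[OF test_fun_smooth[OF assms]] smooth_differentiable[OF s(1)]] s(2)
    by (simp add: algebra_simps)
  moreover have "(\<integral>x. partial_deriv i \<phi> x * ?e x - (2 * of_real pi * \<i> * of_real (y $ i)) * (\<phi> x * ?e x) \<partial>lborel)
    = fourier (partial_deriv i \<phi>) y - 2 * of_real pi * \<i> * of_real (y $ i) * fourier \<phi> y"
    using test_fun_mult_integrable[OF assms cont] test_fun_mult_integrable[OF partial_deriv_test_fun[OF assms] cont]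
    unfolding fourier_eq by (subst Bochner_Integration.integral_diff) auto
  ultimately show ?thesis by simp
qed

text \<open>A further factor \<open>norm y\<close> is bounded by the sum of the
  \<open>\<bar>y $ i\<bar>\<close>, and these turn \<open>fourier \<phi>\<close> into transforms of
  partial derivatives; hence the induction on \<open>N\<close> over all test functions. The factor
  \<open>2 * pi\<close> is discarded as at least 1.\<close>

lemma fourier_decay:
  fixes \<phi> :: "real ^ 'n::finite \<Rightarrow> complex"
  assumes "\<phi> \<in> test_fun"
  obtains C where "C \<ge> 0" "\<And>y. (1 + norm y) ^ N * norm (fourier \<phi> y) \<le> C"
proof -
  have "\<exists>C\<ge>0. \<forall>y. (1 + norm y) ^ N * norm (fourier \<phi> y) \<le> C"
    using assms
  proof (induction N arbitrary: \<phi>)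
    case 0
    have "norm (fourier \<phi> y) \<le> (\<integral>x. norm (\<phi> x) \<partial>lborel)" for y
      unfolding fourier_eq using integral_norm_bound[of lborel "\<lambda>x. \<phi> x * echar (- (x \<bullet> y))"] by (simp add: norm_mult)
    moreover have "(\<integral>x. norm (\<phi> x) \<partial>lborel) \<ge> 0" by simp
    ultimately show ?case by (intro exI[of _ "\<integral>x. norm (\<phi> x) \<partial>lborel"]) simp
  next
    case (Suc N)
    obtain C where C: "C \<ge> 0" "\<And>y. (1 + norm y) ^ N * norm (fourier \<phi> y) \<le> C"
      using Suc.IH[OF Suc.prems] by blast
    have "\<forall>i. \<exists>C\<ge>0. \<forall>y. (1 + norm y) ^ N * norm (fourier (partial_deriv i \<phi>) y) \<le> C"
      using Suc.IH[OF partial_deriv_test_fun[OF Suc.prems]] by blast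
    then obtain D where D: "\<And>i. D i \<ge> 0" "\<And>i y. (1 + norm y) ^ N * norm (fourier (partial_deriv i \<phi>) y) \<le> D i" by metis
    have "(1 + norm y) ^ Suc N * norm (fourier \<phi> y) \<le> C + (\<Sum>i\<in>UNIV. D i)" for y
    proof -
      have "norm y * norm (fourier \<phi> y) \<le> (\<Sum>i\<in>UNIV. \<bar>y $ i\<bar>) * norm (fourier \<phi> y)"
        by (intro mult_right_mono norm_le_l1_cart) auto
      also have "\<dots> \<le> (\<Sum>i\<in>UNIV. norm (fourier (partial_deriv i \<phi>) y))"
        unfolding sum_distrib_right
      proof (rule sum_mono)
        fix i
        have "1 * (\<bar>y $ i\<bar> * norm (fourier \<phi> y)) \<le> (2 * pi) * (\<bar>y $ i\<bar> * norm (fourier \<phi> y))"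
          using pi_gt3 by (intro mult_right_mono) auto
        then show "\<bar>y $ i\<bar> * norm (fourier \<phi> y) \<le> norm (fourier (partial_deriv i \<phi>) y)"
          unfolding fourier_partial_deriv[OF Suc.prems] by (simp add: norm_mult mult.assoc)
      qed
      finally have 1: "norm y * norm (fourier \<phi> y) \<le> (\<Sum>i\<in>UNIV. norm (fourier (partial_deriv i \<phi>) y))" .
      have "(1 + norm y) ^ Suc N * norm (fourier \<phi> y) =
          (1 + norm y) ^ N * norm (fourier \<phi> y) + (1 + norm y) ^ N * (norm y * norm (fourier \<phi> y))"
        by (simp add: algebra_simps)
      also have "\<dots> \<le> C + (1 + norm y) ^ N * (\<Sum>i\<in>UNIV. norm (fourier (partial_deriv i \<phi>) y))"
        using C(2) 1 by (intro add_mono mult_left_mono) auto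
      also have "\<dots> \<le> C + (\<Sum>i\<in>UNIV. D i)"
        unfolding sum_distrib_left using D(2) by (intro add_left_mono sum_mono) auto
      finally show ?thesis .
    qed
    moreover have "C + (\<Sum>i\<in>UNIV. D i) \<ge> 0" using C D by (intro add_nonneg_nonneg sum_nonneg) auto
    ultimately show ?case by blast
  qed
  then show ?thesis using that by blast
qed

text \<open>On the shell between the radii \<open>k\<close> and \<open>k + 1\<close> the function is
  at most \<open>(k + 1) ^ -(d + 2)\<close>, while the ball containing the shell has volume of order
  \<open>(k + 1) ^ d\<close>. The exponent \<open>d + 2\<close> thus leaves the summable
  \<open>(k + 1) ^ -2\<close>.\<close>

lemma integrable_inverse_norm_power:
  "integrable lborel (\<lambda>x::'a::euclidean_space. 1 / (1 + norm x) ^ (DIM('a) + 2))"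
proof (rule integrableI_nonneg)
  let ?d = "DIM('a)"
  let ?g = "\<lambda>x::'a. 1 / (1 + norm x) ^ (?d + 2)"
  let ?B = "\<lambda>k. cball (0::'a) (real (Suc k))"
  let ?h = "\<lambda>k x. ennreal (1 / real (Suc k) ^ (?d + 2)) * indicator (?B k) x"
  show "?g \<in> borel_measurable lborel" by measurable
  show "AE x in lborel. 0 \<le> ?g x" by auto
  have "(\<integral>\<^sup>+x. ennreal (?g x) \<partial>lborel) \<le> (\<integral>\<^sup>+x. (\<Sum>k. ?h k x) \<partial>lborel)"
  proof (rule nn_integral_mono)
    fix x :: 'a
    define k where "k = nat \<lfloor>norm x\<rfloor>"
    have k: "real k \<le> norm x" "norm x < real (Suc k)" unfolding k_def using norm_ge_zero[of x] by (linarith, linarith)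
    have "ennreal (?g x) \<le> ?h k x"
    proof -
      have "real (Suc k) ^ (?d + 2) \<le> (1 + norm x) ^ (?d + 2)" using k by (intro power_mono) auto
      then have "?g x \<le> 1 / real (Suc k) ^ (?d + 2)"
        by (intro divide_left_mono mult_pos_pos zero_less_power) (auto intro: add_pos_nonneg)
      then show ?thesis using k by (simp add: ennreal_leI del: power_Suc add_2_eq_Suc')
    qed
    also have "\<dots> \<le> (\<Sum>k. ?h k x)"
    proof -
      have sg: "sum c {k} = c k" for c :: "nat \<Rightarrow> ennreal" by simp
      have "sum (\<lambda>k. ?h k x) {k} \<le> (\<Sum>k. ?h k x)" by (rule sum_le_suminf) auto
      then show ?thesis unfolding sg .
    qed
    finally show "ennreal (?g x) \<le> (\<Sum>k. ?h k x)" .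
  qed
  also have "\<dots> = (\<Sum>k. \<integral>\<^sup>+x. ?h k x \<partial>lborel)"
  proof (rule nn_integral_suminf)
    fix k
    have [measurable]: "?B k \<in> sets borel" by simp
    show "?h k \<in> borel_measurable lborel" by measurable
  qed
  also have "\<dots> = (\<Sum>k. ennreal (unit_ball_vol (real ?d) * (1 / real (Suc k) ^ 2)))"
  proof (rule suminf_cong)
    fix k
    have "(\<integral>\<^sup>+x. ?h k x \<partial>lborel) = ennreal (1 / real (Suc k) ^ (?d + 2)) * emeasure lborel (?B k)"
      by (rule nn_integral_cmult_indicator) simp
    also have "\<dots> = ennreal (1 / real (Suc k) ^ (?d + 2)) * ennreal (unit_ball_vol (real ?d) * real (Suc k) ^ ?d)"
      by (subst emeasure_cball) auto
    also have "\<dots> = ennreal (unit_ball_vol (real ?d) * (1 / real (Suc k) ^ 2))"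
      by (simp add: power_add power2_eq_square flip: ennreal_mult)
    finally show "(\<integral>\<^sup>+x. ?h k x \<partial>lborel) = \<dots>" .
  qed
  also have "\<dots> < \<infinity>"
  proof -
    have "summable (\<lambda>k. 1 / real (Suc k) ^ 2)"
      using summable_Suc_iff[of "\<lambda>k. 1 / real k ^ 2"] inverse_power_summable[of 2]
      by (simp add: inverse_eq_divide)
    then have "summable (\<lambda>k. unit_ball_vol (real ?d) * (1 / real (Suc k) ^ 2))" by (rule summable_mult)
    then have "(\<Sum>k. ennreal (unit_ball_vol (real ?d) * (1 / real (Suc k) ^ 2))) =
        ennreal (\<Sum>k. unit_ball_vol (real ?d) * (1 / real (Suc k) ^ 2))"
      by (intro suminf_ennreal2 mult_nonneg_nonneg unit_ball_vol_nonneg) (auto simp del: power_Suc)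
    then show ?thesis by (simp only: ennreal_less_top infinity_ennreal_def)
  qed
  finally show "(\<integral>\<^sup>+x. ennreal (?g x) \<partial>lborel) < \<infinity>" .
qed

lemma integrable_fourier_weight:
  fixes \<phi> :: "real ^ 'n::finite \<Rightarrow> complex"
  assumes "\<phi> \<in> test_fun"
  shows "integrable lborel (\<lambda>y. of_real ((1 + norm y) ^ j) * fourier \<phi> y)"
proof -
  have s: "smooth (\<lambda>y. fourier \<phi> y)"
    using smooth_affine[OF smooth_inv_fourier[OF assms], of 0 "-1"] by (simp add: inv_fourier_eq)
  let ?d = "DIM(real^'n) + 2"
  obtain C where C: "C \<ge> 0" "\<And>y. (1 + norm y) ^ (j + ?d) * norm (fourier \<phi> y) \<le> C"
    using fourier_decay[OF assms] by metis
  show ?thesis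
  proof (rule Bochner_Integration.integrable_bound[of _ "\<lambda>y. C * (1 / (1 + norm y) ^ ?d)"])
    show "integrable lborel (\<lambda>y::real^'n. C * (1 / (1 + norm y) ^ ?d))"
      using integrable_inverse_norm_power by (rule integrable_mult_right)
    show "(\<lambda>y. of_real ((1 + norm y) ^ j) * fourier \<phi> y) \<in> borel_measurable lborel"
      using borel_measurable_continuous_onI[OF smooth_continuous_on[OF s]] by measurable
    show "AE y in lborel. norm (of_real ((1 + norm y) ^ j) * fourier \<phi> y) \<le> norm (C * (1 / (1 + norm y) ^ ?d))"
    proof (rule AE_I2)
      fix y :: "real^'n"
      have p: "(1 + norm y) ^ ?d > 0" by (intro zero_less_power add_pos_nonneg) auto
      have "(1 + norm y) ^ j * norm (fourier \<phi> y) * (1 + norm y) ^ ?d \<le> C"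
        using C(2)[of y] by (simp only: power_add mult_ac)
      then have "(1 + norm y) ^ j * norm (fourier \<phi> y) \<le> C / (1 + norm y) ^ ?d"
        using p by (simp only: pos_le_divide_eq)
      moreover have "norm (of_real ((1 + norm y) ^ j) * fourier \<phi> y) = (1 + norm y) ^ j * norm (fourier \<phi> y)"
        by (simp add: norm_mult norm_power abs_of_nonneg del: of_real_power of_real_add)
      moreover have "norm (C * (1 / (1 + norm y) ^ ?d)) = C / (1 + norm y) ^ ?d" using C p by (simp only: real_norm_def abs_of_nonneg times_divide_eq_right mult_1_right divide_nonneg_pos)
      ultimately show "norm (of_real ((1 + norm y) ^ j) * fourier \<phi> y) \<le> norm (C * (1 / (1 + norm y) ^ ?d))"
        by (simp only:)
    qed
  qed
qed

lemma fubini_continuous: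
  fixes H :: "'a::euclidean_space \<Rightarrow> 'b::euclidean_space \<Rightarrow> complex"
  assumes "continuous_on UNIV (\<lambda>p. H (fst p) (snd p))"
    and "\<And>x w. H x w \<noteq> 0 \<Longrightarrow> norm x \<le> r \<and> norm w \<le> s"
  shows "(\<integral>x. (\<integral>w. H x w \<partial>lborel) \<partial>lborel) = (\<integral>w. (\<integral>x. H x w \<partial>lborel) \<partial>lborel)"
proof -
  have "integrable lborel (\<lambda>p. H (fst p) (snd p))"
  proof (rule integrable_continuous_bounded_support[OF assms(1), of "r + s"])
    fix p :: "'a \<times> 'b" assume "norm p > r + s"
    then have "norm (fst p) + norm (snd p) > r + s" using norm_triangle_le[of "(fst p, 0)" "(0, snd p)"]
      by (smt (verit) norm_Pair_le prod.collapse)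
    then show "H (fst p) (snd p) = 0" using assms(2)[of "fst p" "snd p"] by force
  qed
  then have "integrable (lborel \<Otimes>\<^sub>M lborel) (case_prod H)"
    by (simp add: lborel_prod case_prod_unfold)
  then show ?thesis using lborel_pair.Fubini_integral[of H] by simp
qed

lemma integral_pos_of_continuous:
  fixes g :: "'a::euclidean_space \<Rightarrow> real"
  assumes "integrable lborel g" "continuous_on UNIV g" "\<And>x. g x \<ge> 0" "g 0 > 0"
  shows "(\<integral>x. g x \<partial>lborel) > 0"
proof -
  have "isCont g 0" using assms(2) by (simp add: continuous_on_eq_continuous_at)
  then obtain d where d: "d > 0" "\<And>x. dist x 0 < d \<Longrightarrow> dist (g x) (g 0) < g 0 / 2"
    using assms(4) unfolding continuous_at_eps_delta by (metis half_gt_zero)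
  have "(\<integral>x. g 0 / 2 * indicator (ball (0::'a) d) x \<partial>lborel) \<le> (\<integral>x. g x \<partial>lborel)"
  proof (rule integral_mono)
    show "integrable lborel (\<lambda>x::'a. g 0 / 2 * indicator (ball 0 d) x)"
      using emeasure_bounded_finite[OF bounded_ball] by (intro integrable_mult_right integrable_real_indicator) auto
    fix x :: 'a
    show "g 0 / 2 * indicator (ball 0 d) x \<le> g x"
    proof (cases "x \<in> ball 0 d")
      case True
      then have "dist (g x) (g 0) < g 0 / 2" using d(2)[of x] by (simp add: dist_commute)
      then have "g x \<ge> g 0 / 2" unfolding dist_real_def by linarith
      then show ?thesis using True by simp
    qed (use assms(3) in simp)
  qed (rule assms(1))
  moreover have "(\<integral>x. g 0 / 2 * indicator (ball (0::'a) d) x \<partial>lborel) = g 0 / 2 * measure lborel (ball (0::'a) d)"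
    by simp
  moreover have "measure lborel (ball (0::'a) d) > 0" using content_ball_pos[OF d(1), of 0] by simp
  ultimately show ?thesis using assms(4) by (smt (verit) mult_pos_pos half_gt_zero)
qed

lemma smooth_fourier: "\<phi> \<in> test_fun \<Longrightarrow> smooth (fourier \<phi>)"
  using smooth_affine[OF smooth_inv_fourier, of \<phi> 0 "-1"] by (simp add: inv_fourier_eq)

lemma continuous_on_smooth_compose:
  assumes "smooth \<phi>" "continuous_on S g" shows "continuous_on S (\<lambda>x. \<phi> (g x))"
  using continuous_on_compose2[OF smooth_continuous_on[OF assms(1), of UNIV] assms(2)] by simp

text \<open>The autocorrelation \<open>\<theta>\<close> of a bump has the Fourier transform \<open>|fourier bump|\<^sup>2\<close>, whose integral is
  positive. This replaces the inversion formula \<open>(\<integral>y. fourier \<theta> y) = \<theta> 0\<close>.\<close>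

lemma test_fun_fourier_integral_nonzero:
  obtains \<theta> :: "real ^ 'n::finite \<Rightarrow> complex"
  where "\<theta> \<in> test_fun" "(\<integral>y. fourier \<theta> y \<partial>lborel) \<noteq> 0"
proof -
  let ?b = "bump :: real ^ 'n \<Rightarrow> complex"
  define \<theta> where "\<theta> x = (\<integral>w. ?b (x + 1 *\<^sub>R w) * ?b w \<partial>lborel)" for x
  have ib: "integrable lborel ?b"
    using test_fun_mult_integrable[OF bump_test_fun continuous_on_const[of _ 1]] by simp
  have t: "\<theta> \<in> test_fun"
  proof (rule test_funI[of _ 4])
    show "smooth \<theta>" unfolding \<theta>_def by (rule convolution_smooth(1)[OF bump_test_fun ib])
    fix x assume nz: "\<theta> x \<noteq> 0"
    show "norm x \<le> 4"
    proof (rule ccontr)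
      assume x: "\<not> norm x \<le> 4"
      have "(\<lambda>w. ?b (x + 1 *\<^sub>R w) * ?b w) = (\<lambda>w. 0)"
      proof
        fix w
        show "?b (x + 1 *\<^sub>R w) * ?b w = 0"
      proof (cases "norm w \<ge> 2")
        case False
        then have "norm (x + w) \<ge> 2" using x norm_diff_ineq[of x w] by linarith
        then show ?thesis by (simp add: bump_eq_0)
      qed (simp add: bump_eq_0)
      qed
      then have "\<theta> x = 0" unfolding \<theta>_def by simp
      then show False using nz by simp
    qed
  qed
  define F where "F = fourier ?b"
  have sF: "continuous_on UNIV F" unfolding F_def
    using smooth_continuous_on smooth_fourier bump_test_fun by blast
  have cont: "continuous_on S ?b" for S using smooth_continuous_on[OF smooth_bump] .
  have ft: "fourier \<theta> y = of_real ((norm (F y))\<^sup>2)" for y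
  proof -
    define H where "H x w = ?b (x + w) * ?b w * echar (- (x \<bullet> y))" for x w
    have "fourier \<theta> y = (\<integral>x. (\<integral>w. H x w \<partial>lborel) \<partial>lborel)"
      unfolding fourier_eq \<theta>_def H_def by simp
    also have "\<dots> = (\<integral>w. (\<integral>x. H x w \<partial>lborel) \<partial>lborel)"
    proof (rule fubini_continuous[of _ 4 2])
      show "continuous_on UNIV (\<lambda>p. H (fst p) (snd p))"
        unfolding H_def by (intro continuous_intros continuous_on_smooth_compose[OF smooth_bump])
      fix x w assume "H x w \<noteq> 0"
      then have "norm (x + w) < 2" "norm w < 2" using bump_eq_0 unfolding H_def by (force simp: not_le[symmetric])+
      then show "norm x \<le> 4 \<and> norm w \<le> 2" using norm_diff_ineq[of x w] by linarith
    qed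
    also have "\<dots> = (\<integral>w. ?b w * echar (w \<bullet> y) * F y \<partial>lborel)"
    proof (rule Bochner_Integration.integral_cong[OF refl])
      fix w
      define g where "g x = ?b (x + w) * echar (- (x \<bullet> y))" for x
      have m: "g \<in> borel_measurable borel" unfolding g_def
        by (intro borel_measurable_continuous_onI continuous_intros continuous_on_smooth_compose[OF smooth_bump])
      have "(\<integral>x. H x w \<partial>lborel) = (\<integral>x. ?b w * g x \<partial>lborel)"
        unfolding H_def g_def by (simp add: mult_ac)
      also have "\<dots> = ?b w * (\<integral>x. g (- w + 1 *\<^sub>R x) \<partial>lborel)"
        using integral_lborel_affine[OF m, of 1 "- w"] by simp
      also have "(\<integral>x. g (- w + 1 *\<^sub>R x) \<partial>lborel) = (\<integral>x. echar (w \<bullet> y) * (?b x * echar (- (x \<bullet> y))) \<partial>lborel)"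
        unfolding g_def by (intro Bochner_Integration.integral_cong)
           (auto simp: inner_diff_left inner_left_distrib echar_add[symmetric] mult_ac)
      also have "\<dots> = echar (w \<bullet> y) * F y" unfolding F_def fourier_eq by simp
      finally show "(\<integral>x. H x w \<partial>lborel) = ?b w * echar (w \<bullet> y) * F y" by simp
    qed
    \<comment> \<open>Since \<open>bump\<close> is real, conjugation only reverses the character,
      and the integral becomes the conjugate of \<open>F y\<close>.\<close>
    also have "\<dots> = (\<integral>w. cnj (?b w * echar (- (w \<bullet> y))) \<partial>lborel) * F y"
    proof -
      have "cnj (?b w) = ?b w" for w by (metis bump_real(1) complex_cnj_complex_of_real)
      then show ?thesis by (simp add: cnj_echar)
    qed
    also have "\<dots> = cnj (F y) * F y" unfolding F_def fourier_eq by (simp only: Bochner_Integration.integral_cnj)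
    also have "\<dots> = of_real ((norm (F y))\<^sup>2)" by (metis complex_norm_square mult.commute of_real_power)
    finally show ?thesis .
  qed
  have "Re (F 0) = (\<integral>w. Re (?b w) \<partial>lborel)" unfolding F_def fourier_eq using ib by simp
  also have "\<dots> > 0"
    by (rule integral_pos_of_continuous)
       (use ib cont bump_real(2) bump_eq_1[of "0 :: real ^ 'n"] in \<open>auto intro!: continuous_intros\<close>)
  finally have F0: "F 0 \<noteq> 0" by auto
  have ii: "integrable lborel (fourier \<theta>)" using integrable_fourier_weight[OF t, of 0] by simp
  have "integrable lborel (\<lambda>y. Re (fourier \<theta> y))" using ii by simp
  then have i2: "integrable lborel (\<lambda>y. (norm (F y))\<^sup>2)" unfolding ft by simp
  have "(\<integral>y. (norm (F y))\<^sup>2 \<partial>lborel) > 0"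
    by (rule integral_pos_of_continuous[OF i2]) (use sF F0 in \<open>auto intro!: continuous_intros\<close>)
  moreover have "Re (\<integral>y. fourier \<theta> y \<partial>lborel) = (\<integral>y. Re (fourier \<theta> y) \<partial>lborel)"
    using ii by simp
  ultimately have "(\<integral>y. fourier \<theta> y \<partial>lborel) \<noteq> 0" unfolding ft by auto
  then show ?thesis using that t by blast
qed

text \<open>The transform of a product is a convolution: Fubini applies because the supports of
  \<open>\<phi>\<close> and of the dilated \<open>\<theta>\<close> are bounded, and the two
  substitutions contribute powers of \<open>N\<close> that cancel. As \<open>N\<close> grows, the
  right side approaches \<open>\<phi> y\<close> times the integral of
  \<open>fourier \<theta>\<close>.\<close>

lemma fourier_dilated_product:
  fixes \<phi> \<theta> :: "real ^ 'n::finite \<Rightarrow> complex"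
  assumes \<phi>: "\<phi> \<in> test_fun" and \<theta>: "\<theta> \<in> test_fun" and N: "N > 0"
  shows "fourier (\<lambda>x. inv_fourier \<phi> x * \<theta> ((1/N) *\<^sub>R x)) y = (\<integral>w. \<phi> (y + (- (1/N)) *\<^sub>R w) * fourier \<theta> w \<partial>lborel)"
proof -
  let ?d = "CARD('n)"
  note s\<phi> = test_fun_smooth[OF \<phi>] and s\<theta> = test_fun_smooth[OF \<theta>]
  obtain r where r: "r > 0" "\<And>x. norm x > r \<Longrightarrow> \<phi> x = 0" using test_fun_radius[OF \<phi>] by metis
  obtain r' where r': "r' > 0" "\<And>x. norm x > r' \<Longrightarrow> \<theta> x = 0" using test_fun_radius[OF \<theta>] by metis
  define H where "H x u = \<phi> u * \<theta> ((1/N) *\<^sub>R x) * echar (x \<bullet> (u - y))" for x u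
  have "fourier (\<lambda>x. inv_fourier \<phi> x * \<theta> ((1/N) *\<^sub>R x)) y = (\<integral>x. (\<integral>u. H x u \<partial>lborel) \<partial>lborel)"
    unfolding fourier_eq
  proof (rule Bochner_Integration.integral_cong[OF refl])
    fix x
    have "(\<integral>u. H x u \<partial>lborel) = (\<integral>u. (\<phi> u * echar (u \<bullet> x)) * (\<theta> ((1/N) *\<^sub>R x) * echar (- (x \<bullet> y))) \<partial>lborel)"
      unfolding H_def
    proof (intro Bochner_Integration.integral_cong[OF refl])
      fix u
      have "echar (x \<bullet> (u - y)) = echar (u \<bullet> x) * echar (- (x \<bullet> y))"
        by (simp add: echar_add[symmetric] inner_diff_right inner_commute)
      then show "\<phi> u * \<theta> ((1/N) *\<^sub>R x) * echar (x \<bullet> (u - y)) = (\<phi> u * echar (u \<bullet> x)) * (\<theta> ((1/N) *\<^sub>R x) * echar (- (x \<bullet> y)))"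
        by simp
    qed
    then show "inv_fourier \<phi> x * \<theta> ((1/N) *\<^sub>R x) * echar (- (x \<bullet> y)) = (\<integral>u. H x u \<partial>lborel)"
      unfolding inv_fourier_def by simp
  qed
  also have "\<dots> = (\<integral>u. (\<integral>x. H x u \<partial>lborel) \<partial>lborel)"
  proof (rule fubini_continuous[of _ "N * r'" r])
    show "continuous_on UNIV (\<lambda>p. H (fst p) (snd p))"
      unfolding H_def by (intro continuous_intros continuous_on_smooth_compose[OF s\<phi>] continuous_on_smooth_compose[OF s\<theta>])
    fix x u assume nz: "H x u \<noteq> 0"
    have "\<not> norm ((1/N) *\<^sub>R x) > r'" using nz r'(2) unfolding H_def by force
    moreover have "\<not> norm u > r" using nz r(2) unfolding H_def by force
    ultimately show "norm x \<le> N * r' \<and> norm u \<le> r" using N by (simp add: field_simps)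
  qed
  also have "\<dots> = (\<integral>u. \<phi> u * (N ^ ?d *\<^sub>R fourier \<theta> (N *\<^sub>R (y - u))) \<partial>lborel)"
  proof (rule Bochner_Integration.integral_cong[OF refl])
    fix u
    define g where "g x = \<theta> ((1/N) *\<^sub>R x) * echar (x \<bullet> (u - y))" for x
    have m: "g \<in> borel_measurable borel" unfolding g_def
      by (intro borel_measurable_continuous_onI continuous_intros continuous_on_smooth_compose[OF s\<theta>])
    have "(\<integral>x. H x u \<partial>lborel) = (\<integral>x. \<phi> u * g x \<partial>lborel)" unfolding H_def g_def by (simp add: mult_ac)
    also have "\<dots> = \<phi> u * (N ^ ?d *\<^sub>R (\<integral>x. g (0 + N *\<^sub>R x) \<partial>lborel))"
      using integral_lborel_affine[OF m, of N 0] N by simp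
    also have "(\<integral>x. g (0 + N *\<^sub>R x) \<partial>lborel) = fourier \<theta> (N *\<^sub>R (y - u))"
      unfolding fourier_eq g_def using N
      by (intro Bochner_Integration.integral_cong) (auto simp: inner_diff_right algebra_simps)
    finally show "(\<integral>x. H x u \<partial>lborel) = \<phi> u * (N ^ ?d *\<^sub>R fourier \<theta> (N *\<^sub>R (y - u)))" .
  qed
  also have "\<dots> = \<bar>- (1/N)\<bar> ^ ?d *\<^sub>R (\<integral>w. \<phi> (y + (- (1/N)) *\<^sub>R w) *
      (N ^ ?d *\<^sub>R fourier \<theta> (N *\<^sub>R (y - (y + (- (1/N)) *\<^sub>R w)))) \<partial>lborel)"
    using integral_lborel_affine[of "\<lambda>u. \<phi> u * (N ^ ?d *\<^sub>R fourier \<theta> (N *\<^sub>R (y - u)))" "- (1/N)" y] N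
    by (simp add: borel_measurable_continuous_onI continuous_intros continuous_on_smooth_compose[OF s\<phi>]
        continuous_on_smooth_compose[OF smooth_fourier[OF \<theta>]])
  also have "\<dots> = (\<integral>w. \<phi> (y + (- (1/N)) *\<^sub>R w) * fourier \<theta> w \<partial>lborel)"
    using N by (simp add: power_divide)
  finally show ?thesis .
qed

text \<open>An approximate identity whose mass is the integral of \<open>K\<close>. The Lipschitz
  bound gives the rate \<open>norm w / N\<close>; the weight in \<open>y\<close> is moved to
  \<open>w\<close>, because both values of \<open>h\<close> vanish once
  \<open>norm y > r + norm w\<close>. This is where the weighted integrability of \<open>K\<close>
  enters.\<close>

lemma convolution_approximation:
  fixes h K :: "real ^ 'n::finite \<Rightarrow> complex"
  assumes h: "h \<in> test_fun" and K: "\<And>j. integrable lborel (\<lambda>w. of_real ((1 + norm w) ^ j) * K w)"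
  obtains M where "M \<ge> 0" "\<And>N y. N \<ge> 1 \<Longrightarrow> (1 + norm y) ^ n *
    norm ((\<integral>w. h (y + (- (1/N)) *\<^sub>R w) * K w \<partial>lborel) - (\<integral>w. K w \<partial>lborel) * h y) \<le> M / N"
proof -
  obtain L where L: "L \<ge> 0" "\<And>x y. norm (h y - h x) \<le> L * norm (y - x)"
    using test_fun_lipschitz[OF h] by metis
  obtain r where r: "r > 0" "\<And>x. norm x > r \<Longrightarrow> h x = 0" using test_fun_radius[OF h] by metis
  have iK: "integrable lborel K" using K[of 0] by simp
  define I where "I = (\<integral>w. norm (of_real ((1 + norm w) ^ Suc n) * K w) \<partial>lborel)"
  define M where "M = L * (1 + r) ^ n * I"
  have I: "I \<ge> 0" unfolding I_def by simp
  show ?thesis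
  proof (rule that[of M])
    show "M \<ge> 0" unfolding M_def using I L r by simp
    fix N :: real and y :: "real^'n" assume N: "N \<ge> 1"
    have pt: "(1 + norm y) ^ n * norm (h (y + (- (1/N)) *\<^sub>R w) - h y) \<le> L / N * (1 + r) ^ n * (1 + norm w) ^ Suc n" for w
    proof (cases "norm y > r + norm w")
      case True
      have "norm ((- (1/N)) *\<^sub>R w) \<le> norm w" using N mult_left_mono[of 1 N "norm w"] by (simp add: divide_le_eq)
      then have "norm (y + (- (1/N)) *\<^sub>R w) > r" using True norm_diff_ineq[of y "(- (1/N)) *\<^sub>R w"] by linarith
      moreover have "norm y > r" using True norm_ge_zero[of w] by linarith
      ultimately have "h (y + (- (1/N)) *\<^sub>R w) = 0" "h y = 0" using r(2) by blast+
      then show ?thesis using L r N by simp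
    next
      case False
      have "norm (h (y + (- (1/N)) *\<^sub>R w) - h y) \<le> L * norm ((- (1/N)) *\<^sub>R w)"
        using L(2)[of "y + (- (1/N)) *\<^sub>R w" y] by simp
      also have "\<dots> = L / N * norm w" using N by simp
      also have "\<dots> \<le> L / N * (1 + norm w)" using L N by (intro mult_left_mono) auto
      finally have 1: "norm (h (y + (- (1/N)) *\<^sub>R w) - h y) \<le> L / N * (1 + norm w)" .
      have "1 + norm y \<le> (1 + r) * (1 + norm w)"
        using False mult_nonneg_nonneg[OF less_imp_le[OF r(1)] norm_ge_zero[of w]]
        by (simp add: ring_distribs)
      then have 2: "(1 + norm y) ^ n \<le> ((1 + r) * (1 + norm w)) ^ n" by (intro power_mono) auto
      have "(1 + norm y) ^ n * norm (h (y + (- (1/N)) *\<^sub>R w) - h y) \<le> ((1 + r) * (1 + norm w)) ^ n * (L / N * (1 + norm w))"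
        using 1 2 r by (intro mult_mono) auto
      also have "\<dots> = L / N * (1 + r) ^ n * (1 + norm w) ^ Suc n" by (simp add: power_mult_distrib)
      finally show ?thesis .
    qed
    define D where "D w = (h (y + (- (1/N)) *\<^sub>R w) - h y) * K w" for w
    have i1: "integrable lborel (\<lambda>w. h (y + (- (1/N)) *\<^sub>R w) * K w)" by (rule convolution_smooth(3)[OF h iK])
    have iD: "integrable lborel D" unfolding D_def left_diff_distrib using i1 iK
      by (intro Bochner_Integration.integrable_diff integrable_mult_right) auto
    have "(\<integral>w. h (y + (- (1/N)) *\<^sub>R w) * K w \<partial>lborel) - (\<integral>w. K w \<partial>lborel) * h y = (\<integral>w. D w \<partial>lborel)"
      unfolding D_def left_diff_distrib using i1 iK by (subst Bochner_Integration.integral_diff) (auto simp: mult.commute)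
    then have "(1 + norm y) ^ n * norm ((\<integral>w. h (y + (- (1/N)) *\<^sub>R w) * K w \<partial>lborel) - (\<integral>w. K w \<partial>lborel) * h y)
      = norm (\<integral>w. of_real ((1 + norm y) ^ n) * D w \<partial>lborel)"
      by (simp add: norm_mult norm_power abs_of_nonneg del: of_real_power of_real_add)
    also have "\<dots> \<le> (\<integral>w. L / N * (1 + r) ^ n * norm (of_real ((1 + norm w) ^ Suc n) * K w) \<partial>lborel)"
    proof (rule norm_integral_le)
      show "integrable lborel (\<lambda>w. of_real ((1 + norm y) ^ n) * D w)" using iD by simp
      show "integrable lborel (\<lambda>w. L / N * (1 + r) ^ n * norm (of_real ((1 + norm w) ^ Suc n) * K w))"
        using K by (intro integrable_mult_right integrable_norm)
      fix w
      have "norm (of_real ((1 + norm y) ^ n) * D w) = ((1 + norm y) ^ n * norm (h (y + (- (1/N)) *\<^sub>R w) - h y)) * norm (K w)"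
        unfolding D_def by (simp add: norm_mult norm_power abs_of_nonneg del: of_real_power of_real_add)
      also have "\<dots> \<le> L / N * (1 + r) ^ n * (1 + norm w) ^ Suc n * norm (K w)"
        by (intro mult_right_mono pt) auto
      also have "\<dots> = L / N * (1 + r) ^ n * norm (of_real ((1 + norm w) ^ Suc n) * K w)"
        by (simp add: norm_mult norm_power abs_of_nonneg del: of_real_power of_real_add power_Suc)
      finally show "norm (of_real ((1 + norm y) ^ n) * D w) \<le> L / N * (1 + r) ^ n * norm (of_real ((1 + norm w) ^ Suc n) * K w)" .
    qed
    also have "\<dots> = M / N" unfolding M_def I_def by simp
    finally show "(1 + norm y) ^ n * norm ((\<integral>w. h (y + (- (1/N)) *\<^sub>R w) * K w \<partial>lborel) - (\<integral>w. K w \<partial>lborel) * h y) \<le> M / N" .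
  qed
qed

text \<open>The atomic formula is evaluated at the test function \<open>\<psi>\<close>, the product
  of \<open>inv_fourier \<phi>\<close> and \<open>\<theta>\<close> dilated by \<open>N\<close>. On
  one side \<open>fourier \<psi>\<close> tends to \<open>c * \<phi>\<close> in the Schwartz norms;
  on the other the sum tends to \<open>\<theta> 0\<close> times the series, with an error controlled
  by the extra weight in the summability hypothesis. Both errors are of order
  \<open>1 / N\<close>.\<close>

lemma fourier_pairing:
  fixes f :: "('n::finite) functional" and \<phi> \<theta> :: "real ^ 'n \<Rightarrow> complex"
  assumes f: "tempered f" and at: "is_atomic_measure (dist_fourier f) \<Gamma> q"
    and \<phi>: "\<phi> \<in> test_fun" and \<theta>: "\<theta> \<in> test_fun"
    and S: "(\<lambda>\<gamma>. norm (q \<gamma> * inv_fourier \<phi> \<gamma>) * (1 + norm \<gamma>)) summable_on \<Gamma>"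
  shows "(\<lambda>\<gamma>. norm (q \<gamma> * inv_fourier \<phi> \<gamma>)) summable_on \<Gamma>"
    "(\<integral>y. fourier \<theta> y \<partial>lborel) * f \<phi> = \<theta> 0 * (\<Sum>\<^sub>\<infinity>\<gamma>\<in>\<Gamma>. q \<gamma> * inv_fourier \<phi> \<gamma>)"
proof -
  define c where "c = (\<integral>y. fourier \<theta> y \<partial>lborel)"
  define a where "a \<gamma> = q \<gamma> * inv_fourier \<phi> \<gamma>" for \<gamma>
  define W where "W = (\<Sum>\<^sub>\<infinity>\<gamma>\<in>\<Gamma>. norm (a \<gamma>) * (1 + norm \<gamma>))"
  have S': "((\<lambda>\<gamma>. norm (a \<gamma>) * (1 + norm \<gamma>)) has_sum W) \<Gamma>"
    using S has_sum_infsum unfolding W_def a_def by blast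
  show abs: "(\<lambda>\<gamma>. norm (q \<gamma> * inv_fourier \<phi> \<gamma>)) summable_on \<Gamma>"
    by (rule summable_on_comparison_test[OF S]) (auto intro: mult_right_le_one_le simp: distrib_left)
  then have sa: "(a has_sum (\<Sum>\<^sub>\<infinity>\<gamma>\<in>\<Gamma>. a \<gamma>)) \<Gamma>"
    using has_sum_infsum[OF abs_summable_summable, of a \<Gamma>] unfolding a_def by simp
  obtain C n m where C: "C \<ge> 0" "\<And>\<phi> B. \<phi> \<in> schwartz \<Longrightarrow>
    (\<And>x k. mi_size k \<le> m \<Longrightarrow> (1 + norm x) ^ n * norm (mi_deriv k \<phi> x) \<le> B) \<Longrightarrow> norm (f \<phi>) \<le> C * B"
    using tempered_bound[OF f] by metis
  have K: "integrable lborel (\<lambda>w. of_real ((1 + norm w) ^ j) * fourier \<theta> w)" for j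
    by (rule integrable_fourier_weight[OF \<theta>])
  have iK: "integrable lborel (fourier \<theta>)" using K[of 0] by simp
  define P where "P n k M \<longleftrightarrow> M \<ge> 0 \<and> (\<forall>N y. N \<ge> 1 \<longrightarrow> (1 + norm y) ^ n *
    norm ((\<integral>w. mi_deriv k \<phi> (y + (- (1/N)) *\<^sub>R w) * fourier \<theta> w \<partial>lborel) - c * mi_deriv k \<phi> y) \<le> M / N)"
    for n k M
  have "\<exists>M. P n k M" for n k
    unfolding P_def c_def mi_deriv_eq_pderivs
    by (rule convolution_approximation[OF pderivs_test_fun[OF \<phi>, of "mi_list k"] K, of n]) blast
  then obtain M where P: "\<And>n k. P n k (M n k)" by metis
  have M: "M n k \<ge> 0" "N \<ge> 1 \<Longrightarrow> (1 + norm y) ^ n *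
    norm ((\<integral>w. mi_deriv k \<phi> (y + (- (1/N)) *\<^sub>R w) * fourier \<theta> w \<partial>lborel) - c * mi_deriv k \<phi> y) \<le> M n k / N"
    for n k N y
    using P[of n k] unfolding P_def by blast+
  define Mt where "Mt = (\<Sum>k | mi_size k \<le> m. M n k)"
  have Mt: "Mt \<ge> 0" unfolding Mt_def using M(1) by (intro sum_nonneg) auto
  obtain L where L: "L \<ge> 0" "\<And>x y. norm (\<theta> y - \<theta> x) \<le> L * norm (y - x)"
    using test_fun_lipschitz[OF \<theta>] by metis
  define z where "z = c * f \<phi> - \<theta> 0 * (\<Sum>\<^sub>\<infinity>\<gamma>\<in>\<Gamma>. a \<gamma>)"
  have "norm z \<le> (C * Mt + L * W) / N" if N: "N \<ge> 1" for N :: real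
  proof -
    define \<psi> where "\<psi> x = inv_fourier \<phi> x * \<theta> ((1/N) *\<^sub>R x)" for x
    define G where "G y = (\<integral>w. \<phi> (y + (- (1/N)) *\<^sub>R w) * fourier \<theta> w \<partial>lborel)" for y
    have "(\<lambda>x. \<theta> (0 + (1/N) *\<^sub>R x) * inv_fourier \<phi> x) \<in> test_fun"
      using N by (intro test_fun_mult test_fun_affine \<theta> smooth_inv_fourier \<phi>) simp
    then have \<psi>: "\<psi> \<in> test_fun" unfolding \<psi>_def by (simp add: mult.commute)
    have f\<psi>: "fourier \<psi> = G" unfolding \<psi>_def G_def
      by (rule ext, rule fourier_dilated_product[OF \<phi> \<theta>]) (use N in simp)
    have sG: "smooth G" unfolding G_def by (rule convolution_smooth(1)[OF \<phi> iK])
    define E where "E y = G y - c * \<phi> y" for y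
    have sE: "smooth E" unfolding E_def using sG test_fun_smooth[OF \<phi>] by (intro smooth_diff smooth_cmult)
    have dE: "mi_deriv k E y = (\<integral>w. mi_deriv k \<phi> (y + (- (1/N)) *\<^sub>R w) * fourier \<theta> w \<partial>lborel) - c * mi_deriv k \<phi> y" for k y
      unfolding E_def mi_deriv_eq_pderivs
      using sG test_fun_smooth[OF \<phi>] convolution_smooth(2)[OF \<phi> iK, of "mi_list k" "- (1/N)", folded G_def]
      by (simp add: pderivs_diff pderivs_cmult smooth_cmult)
    have E: "E \<in> schwartz"
    proof (rule schwartzI[OF sE])
      show "\<exists>B. \<forall>x. (1 + norm x) ^ n * norm (mi_deriv k E x) \<le> B" for n k
        unfolding dE using M(2)[OF N] by blast
    qed
    have c\<phi>: "(\<lambda>y. c * \<phi> y) \<in> schwartz" using schwartz_cmult[OF test_fun_schwartz[OF \<phi>]] .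
    have "f G = f (\<lambda>y. E y + c * \<phi> y)" unfolding E_def by simp
    also have "\<dots> = f E + c * f \<phi>"
      using tempered_add[OF f E c\<phi>] tempered_cmult[OF f test_fun_schwartz[OF \<phi>]] by simp
    finally have fG: "f G = f E + c * f \<phi>" .
    have fE: "norm (f E) \<le> C * (Mt / N)"
    proof (rule C(2)[OF E])
      fix x and k :: "'n multi_index" assume k: "mi_size k \<le> m"
      have "(1 + norm x) ^ n * norm (mi_deriv k E x) \<le> M n k / N" unfolding dE by (rule M(2)[OF N])
      also have "M n k \<le> Mt" unfolding Mt_def
        using k M(1) by (intro member_le_sum) (auto simp: finite_mi_size_le)
      finally show "(1 + norm x) ^ n * norm (mi_deriv k E x) \<le> Mt / N" using N by (simp add: divide_right_mono)
    qed
    have "((\<lambda>\<gamma>. q \<gamma> * \<psi> \<gamma>) has_sum f G) \<Gamma>"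
      using at \<psi> unfolding is_atomic_measure_def dist_fourier_def dirac_def f\<psi>[symmetric] by blast
    from has_sum_add[OF this has_sum_cmult_right[OF sa, of "- \<theta> 0"]]
    have hs: "((\<lambda>\<gamma>. q \<gamma> * \<psi> \<gamma> + - \<theta> 0 * a \<gamma>) has_sum (f G + - \<theta> 0 * (\<Sum>\<^sub>\<infinity>\<gamma>\<in>\<Gamma>. a \<gamma>))) \<Gamma>" .
    have "norm (f G + - \<theta> 0 * (\<Sum>\<^sub>\<infinity>\<gamma>\<in>\<Gamma>. a \<gamma>)) \<le> L / N * W"
    proof (rule norm_infsum_le[OF hs has_sum_cmult_right[OF S', of "L / N"]])
      fix \<gamma>
      have "norm (\<theta> ((1/N) *\<^sub>R \<gamma>) - \<theta> 0) \<le> L * norm ((1/N) *\<^sub>R \<gamma>)" using L(2)[of "(1/N) *\<^sub>R \<gamma>" 0] by simp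
      also have "\<dots> = L / N * norm \<gamma>" using N by simp
      also have "\<dots> \<le> L / N * (1 + norm \<gamma>)" using L N by (intro mult_left_mono) auto
      finally have "norm (a \<gamma>) * norm (\<theta> ((1/N) *\<^sub>R \<gamma>) - \<theta> 0) \<le> norm (a \<gamma>) * (L / N * (1 + norm \<gamma>))"
        by (rule mult_left_mono) simp
      moreover have "q \<gamma> * \<psi> \<gamma> + - \<theta> 0 * a \<gamma> = a \<gamma> * (\<theta> ((1/N) *\<^sub>R \<gamma>) - \<theta> 0)"
        unfolding \<psi>_def a_def by (simp add: algebra_simps)
      ultimately show "norm (q \<gamma> * \<psi> \<gamma> + - \<theta> 0 * a \<gamma>) \<le> L / N * (norm (a \<gamma>) * (1 + norm \<gamma>))"
        by (simp add: norm_mult mult_ac)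
    qed
    moreover have "z = (f G + - \<theta> 0 * (\<Sum>\<^sub>\<infinity>\<gamma>\<in>\<Gamma>. a \<gamma>)) - f E" unfolding z_def fG by simp
    ultimately have "norm z \<le> L / N * W + C * (Mt / N)"
      using order_trans[OF norm_triangle_ineq4 add_mono[OF _ fE]] by metis
    then show ?thesis by (simp add: add_divide_distrib add.commute)
  qed
  then have "z = 0" by (rule zero_if_norm_le_inverse)
  then show "(\<integral>y. fourier \<theta> y \<partial>lborel) * f \<phi> = \<theta> 0 * (\<Sum>\<^sub>\<infinity>\<gamma>\<in>\<Gamma>. q \<gamma> * inv_fourier \<phi> \<gamma>)"
    unfolding z_def c_def a_def by simp
qed

text \<open>Grouped by \<open>\<lfloor>norm \<gamma>\<rfloor> = k\<close>, the masses add up to at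
  most \<open>A * (k + 1) ^ t\<close>, so the weight exponent \<open>t + 2\<close> leaves the
  convergent series of \<open>A / (k + 1)^2\<close>.\<close>

lemma weighted_mass_summable:
  fixes \<Gamma> :: "(real ^ 'n::finite) set"
  assumes loc: "\<And>r. (\<lambda>\<gamma>. norm (q \<gamma>)) summable_on {\<gamma>\<in>\<Gamma>. norm \<gamma> < r}"
    and growth: "\<And>r. r \<ge> 1 \<Longrightarrow> mass_growth \<Gamma> q r \<le> A * r ^ t"
  shows "(\<lambda>\<gamma>. norm (q \<gamma>) / (1 + norm \<gamma>) ^ (t + 2)) summable_on \<Gamma>"
proof (rule nonneg_bdd_above_summable_on)
  let ?g = "\<lambda>\<gamma>. norm (q \<gamma>) / (1 + norm \<gamma>) ^ (t + 2)"
  let ?s = "\<lambda>k. A * (1 / real (Suc k) ^ 2)"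
  have "mass_growth \<Gamma> q 1 \<ge> 0" unfolding mass_growth_def by (intro infsum_nonneg) auto
  then have A: "A \<ge> 0" using growth[of 1] by simp
  have "summable (\<lambda>k. 1 / real (Suc k) ^ 2)"
    using summable_Suc_iff[of "\<lambda>k. 1 / real k ^ 2"] inverse_power_summable[of 2]
    by (simp add: inverse_eq_divide)
  then have sum: "summable ?s" by (rule summable_mult)
  show "?g \<gamma> \<ge> 0" for \<gamma> by simp
  show "bdd_above (sum ?g ` {F. F \<subseteq> \<Gamma> \<and> finite F})"
  proof (rule bdd_aboveI2)
    fix F assume "F \<in> {F. F \<subseteq> \<Gamma> \<and> finite F}"
    then have F: "F \<subseteq> \<Gamma>" "finite F" by auto
    define \<kappa> where "\<kappa> \<gamma> = nat \<lfloor>norm \<gamma>\<rfloor>" for \<gamma> :: "real^'n"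
    have \<kappa>: "real (\<kappa> \<gamma>) \<le> norm \<gamma>" "norm \<gamma> < real (Suc (\<kappa> \<gamma>))" for \<gamma>
      unfolding \<kappa>_def using norm_ge_zero[of \<gamma>] by (linarith, linarith)
    have "sum ?g F = (\<Sum>k\<in>\<kappa> ` F. \<Sum>\<gamma> | \<gamma> \<in> F \<and> \<kappa> \<gamma> = k. ?g \<gamma>)"
      by (rule sum.image_gen[OF F(2)])
    also have "\<dots> \<le> (\<Sum>k\<in>\<kappa> ` F. ?s k)"
    proof (rule sum_mono)
      fix k
      let ?F = "{\<gamma>\<in>F. \<kappa> \<gamma> = k}"
      have "(\<Sum>\<gamma>\<in>?F. ?g \<gamma>) \<le> (\<Sum>\<gamma>\<in>?F. norm (q \<gamma>) / real (Suc k) ^ (t + 2))"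
      proof (rule sum_mono)
        fix \<gamma> assume "\<gamma> \<in> ?F"
        then have "real (Suc k) ^ (t + 2) \<le> (1 + norm \<gamma>) ^ (t + 2)" using \<kappa>(1)[of \<gamma>] by (intro power_mono) auto
        then show "?g \<gamma> \<le> norm (q \<gamma>) / real (Suc k) ^ (t + 2)"
          by (intro divide_left_mono mult_pos_pos zero_less_power) (auto intro: add_pos_nonneg)
      qed
      also have "\<dots> = (\<Sum>\<gamma>\<in>?F. norm (q \<gamma>)) / real (Suc k) ^ (t + 2)" by (rule sum_divide_distrib[symmetric])
      also have "\<dots> \<le> (A * real (Suc k) ^ t) / real (Suc k) ^ (t + 2)"
      proof (rule divide_right_mono)
        have "(\<Sum>\<gamma>\<in>?F. norm (q \<gamma>)) \<le> mass_growth \<Gamma> q (real (Suc k))"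
          unfolding mass_growth_def using F \<kappa>(2) by (intro finite_sum_le_infsum loc) auto
        also have "\<dots> \<le> A * real (Suc k) ^ t" by (rule growth) simp
        finally show "(\<Sum>\<gamma>\<in>?F. norm (q \<gamma>)) \<le> A * real (Suc k) ^ t" .
      qed simp
      also have "\<dots> = ?s k" by (simp only: power_add) (simp del: of_nat_Suc)
      finally show "(\<Sum>\<gamma>\<in>?F. ?g \<gamma>) \<le> ?s k" .
    qed
    also have "\<dots> \<le> suminf ?s" using F(2) A by (intro sum_le_suminf sum) auto
    finally show "sum ?g F \<le> suminf ?s" .
  qed
qed

text \<open>Translation multiplies \<open>inv_fourier \<phi>\<close> by a character of absolute
  value 1, so the pairing holds for all translates with the same coefficients and the same
  absolutely convergent majorant.\<close>

lemma translates_exponential_series: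
  fixes f :: "('n::finite) functional" and \<phi> :: "real ^ 'n \<Rightarrow> complex"
  assumes f: "tempered f" and at: "is_atomic_measure (dist_fourier f) \<Gamma> q"
    and growth: "\<And>r. r \<ge> 1 \<Longrightarrow> mass_growth \<Gamma> q r \<le> A * r ^ t"
    and \<phi>: "\<phi> \<in> test_fun"
  obtains a where "(\<lambda>\<gamma>. norm (a \<gamma>)) summable_on \<Gamma>"
    "\<And>x. ((\<lambda>\<gamma>. a \<gamma> * echar (x \<bullet> \<gamma>)) has_sum f (\<lambda>u. \<phi> (u - x))) \<Gamma>"
proof -
  obtain \<theta> :: "real ^ 'n \<Rightarrow> complex" where \<theta>: "\<theta> \<in> test_fun" "(\<integral>y. fourier \<theta> y \<partial>lborel) \<noteq> 0"
    using test_fun_fourier_integral_nonzero by blast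
  define c where "c = (\<integral>y. fourier \<theta> y \<partial>lborel)"
  have ws: "(\<lambda>\<gamma>. norm (q \<gamma>) / (1 + norm \<gamma>) ^ (t + 2)) summable_on \<Gamma>"
    by (rule weighted_mass_summable[OF _ growth]) (use at in \<open>auto simp: is_atomic_measure_def\<close>)
  \<comment> \<open>Decay of order \<open>t + 2\<close> matches the weighted masses; one order more
    pays for the factor \<open>1 + norm \<gamma>\<close> in \<open>fourier_pairing\<close>.\<close>
  obtain B where B: "B \<ge> 0" "\<And>y. (1 + norm y) ^ (t + 3) * norm (fourier \<phi> y) \<le> B"
    using fourier_decay[OF \<phi>] by metis
  have S: "(\<lambda>\<gamma>. norm (q \<gamma> * inv_fourier \<phi> \<gamma>) * (1 + norm \<gamma>)) summable_on \<Gamma>"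
  proof (rule summable_on_comparison_test[OF summable_on_cmult_right[OF ws, of B]])
    fix \<gamma> :: "real ^ 'n"
    have p: "(1 + norm \<gamma>) ^ (t + 2) > 0" by (intro zero_less_power add_pos_nonneg) auto
    have "norm (inv_fourier \<phi> \<gamma>) * (1 + norm \<gamma>) * (1 + norm \<gamma>) ^ (t + 2) \<le> B"
      using B(2)[of "- \<gamma>"] unfolding inv_fourier_eq by (simp add: eval_nat_numeral mult_ac)
    then have "norm (inv_fourier \<phi> \<gamma>) * (1 + norm \<gamma>) \<le> B / (1 + norm \<gamma>) ^ (t + 2)"
      using p by (simp only: pos_le_divide_eq)
    then have "norm (q \<gamma>) * (norm (inv_fourier \<phi> \<gamma>) * (1 + norm \<gamma>)) \<le> norm (q \<gamma>) * (B / (1 + norm \<gamma>) ^ (t + 2))"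
      by (rule mult_left_mono) simp
    then show "norm (q \<gamma> * inv_fourier \<phi> \<gamma>) * (1 + norm \<gamma>) \<le> B * (norm (q \<gamma>) / (1 + norm \<gamma>) ^ (t + 2))"
      by (simp add: norm_mult mult_ac)
  qed auto
  define a where "a \<gamma> = \<theta> 0 / c * (q \<gamma> * inv_fourier \<phi> \<gamma>)" for \<gamma>
  show ?thesis
  proof (rule that[of a])
    show "(\<lambda>\<gamma>. norm (a \<gamma>)) summable_on \<Gamma>"
      unfolding a_def norm_mult[of "\<theta> 0 / c"] by (rule summable_on_cmult_right[OF fourier_pairing(1)[OF f at \<phi> \<theta>(1) S]])
    fix x
    define \<phi>x where "\<phi>x u = \<phi> (u - x)" for u
    have \<phi>x: "\<phi>x \<in> test_fun" unfolding \<phi>x_def by (rule test_fun_translate[OF \<phi>])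
    have ix: "inv_fourier \<phi>x \<gamma> = echar (x \<bullet> \<gamma>) * inv_fourier \<phi> \<gamma>" for \<gamma>
    proof -
      have m: "(\<lambda>u. \<phi>x u * echar (u \<bullet> \<gamma>)) \<in> borel_measurable borel"
        by (intro borel_measurable_continuous_onI continuous_intros smooth_continuous_on test_fun_smooth \<phi>x)
      have "inv_fourier \<phi>x \<gamma> = (\<integral>u. \<phi>x (x + 1 *\<^sub>R u) * echar ((x + 1 *\<^sub>R u) \<bullet> \<gamma>) \<partial>lborel)"
        unfolding inv_fourier_def using integral_lborel_affine[OF m, of 1 x] by simp
      also have "\<dots> = (\<integral>u. echar (x \<bullet> \<gamma>) * (\<phi> u * echar (u \<bullet> \<gamma>)) \<partial>lborel)"
        unfolding \<phi>x_def by (intro Bochner_Integration.integral_cong) (auto simp: inner_left_distrib echar_add)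
      finally show ?thesis unfolding inv_fourier_def by simp
    qed
    have Sx: "(\<lambda>\<gamma>. norm (q \<gamma> * inv_fourier \<phi>x \<gamma>) * (1 + norm \<gamma>)) summable_on \<Gamma>"
      using S unfolding ix by (simp add: norm_mult)
    have "((\<lambda>\<gamma>. q \<gamma> * inv_fourier \<phi>x \<gamma>) has_sum (\<Sum>\<^sub>\<infinity>\<gamma>\<in>\<Gamma>. q \<gamma> * inv_fourier \<phi>x \<gamma>)) \<Gamma>"
      using has_sum_infsum[OF abs_summable_summable[OF fourier_pairing(1)[OF f at \<phi>x \<theta>(1) Sx]]] .
    from has_sum_cmult_right[OF this, of "\<theta> 0 / c"]
    moreover have "\<theta> 0 / c * (\<Sum>\<^sub>\<infinity>\<gamma>\<in>\<Gamma>. q \<gamma> * inv_fourier \<phi>x \<gamma>) = f \<phi>x"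
      using fourier_pairing(2)[OF f at \<phi>x \<theta>(1) Sx] \<theta>(2) by (simp add: c_def field_simps)
    ultimately have "((\<lambda>\<gamma>. \<theta> 0 / c * (q \<gamma> * inv_fourier \<phi>x \<gamma>)) has_sum f \<phi>x) \<Gamma>" by simp
    then show "((\<lambda>\<gamma>. a \<gamma> * echar (x \<bullet> \<gamma>)) has_sum f (\<lambda>u. \<phi> (u - x))) \<Gamma>"
      unfolding ix a_def \<phi>x_def by (simp add: mult_ac)
  qed
qed

subsection \<open>Almost periods\<close>

lemma norm_echar_diff_one_le: "norm (echar d - 1) \<le> 2 * pi * \<bar>d\<bar>"
proof -
  have "norm (echar d - 1) = 2 * \<bar>sin (2 * pi * d / 2)\<bar>"
    unfolding echar_def cis_conv_exp using dist_exp_i_1[of "2 * pi * d"] by simp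
  also have "\<dots> \<le> 2 * \<bar>2 * pi * d / 2\<bar>" using abs_sin_x_le_abs_x[of "2 * pi * d / 2"] by linarith
  finally show ?thesis by (simp add: abs_mult)
qed

lemma echar_int: "k \<in> \<int> \<Longrightarrow> echar k = 1"
  unfolding echar_def by (rule cis_multiple_2pi)

text \<open>Pigeonhole principle: finitely many cells of the torus contain the values of all characters
  from \<open>G\<close>, and the difference of two points in the same cell is an almost period.\<close>

lemma simultaneous_almost_periods:
  fixes G :: "'a::real_inner set"
  assumes "finite G" "\<delta> > 0"
  obtains R where "\<And>y. \<exists>\<tau>. norm (\<tau> - y) \<le> R \<and> (\<forall>\<gamma>\<in>G. norm (echar (\<tau> \<bullet> \<gamma>) - 1) \<le> \<delta>)"
proof -
  obtain M :: nat where M: "real M > 2 * pi / \<delta>" using reals_Archimedean2 by blast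
  have Mp: "real M > 0" using M assms(2) pi_gt_zero by (smt (verit) divide_pos_pos)
  define cell where "cell \<tau> = restrict (\<lambda>\<gamma>. \<lfloor>real M * frac (\<tau> \<bullet> \<gamma>)\<rfloor>) G" for \<tau>
  have "cell \<tau> \<in> G \<rightarrow>\<^sub>E {0..<int M}" for \<tau>
    unfolding cell_def using Mp frac_lt_1 frac_ge_0
    by (auto simp: floor_less_iff mult_less_cancel_left2)
  then have "range cell \<subseteq> G \<rightarrow>\<^sub>E {0..<int M}" by blast
  then have fin: "finite (range cell)" using finite_PiE[OF assms(1)] finite_subset by (metis finite_atLeastLessThan_int)
  \<comment> \<open>One point is fixed in each occupied cell. Subtracting from \<open>y\<close> the
    point of its own cell gives an almost period at distance at most \<open>R\<close> from
    \<open>y\<close>, with \<open>R\<close> independent of \<open>y\<close>.\<close>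
  define rep where "rep c = (SOME \<tau>. cell \<tau> = c)" for c
  have rep: "cell (rep (cell y)) = cell y" for y unfolding rep_def by (rule someI) simp
  define R where "R = Max (insert 0 ((\<lambda>c. norm (rep c)) ` range cell))"
  have R: "norm (rep (cell y)) \<le> R" for y unfolding R_def using fin by (intro Max_ge) auto
  show ?thesis
  proof (rule that[of R])
    fix y
    define \<sigma> where "\<sigma> = rep (cell y)"
    show "\<exists>\<tau>. norm (\<tau> - y) \<le> R \<and> (\<forall>\<gamma>\<in>G. norm (echar (\<tau> \<bullet> \<gamma>) - 1) \<le> \<delta>)"
    proof (intro exI[of _ "y - \<sigma>"] conjI ballI)
      show "norm (y - \<sigma> - y) \<le> R" using R[of y] by (simp add: \<sigma>_def)
      fix \<gamma> assume \<gamma>: "\<gamma> \<in> G"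
      define d where "d = frac (y \<bullet> \<gamma>) - frac (\<sigma> \<bullet> \<gamma>)"
      have "\<lfloor>real M * frac (\<sigma> \<bullet> \<gamma>)\<rfloor> = \<lfloor>real M * frac (y \<bullet> \<gamma>)\<rfloor>"
        using fun_cong[OF rep[of y, folded \<sigma>_def], of \<gamma>] \<gamma> by (simp add: cell_def)
      then have "\<bar>real M * frac (y \<bullet> \<gamma>) - real M * frac (\<sigma> \<bullet> \<gamma>)\<bar> < 1" by linarith
      then have "real M * \<bar>d\<bar> < 1" unfolding d_def using Mp by (simp add: abs_mult flip: right_diff_distrib)
      then have d: "\<bar>d\<bar> \<le> 1 / real M" using Mp by (simp add: field_simps)
      have "(y - \<sigma>) \<bullet> \<gamma> = of_int (\<lfloor>y \<bullet> \<gamma>\<rfloor> - \<lfloor>\<sigma> \<bullet> \<gamma>\<rfloor>) + d"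
        unfolding d_def frac_def by (simp add: inner_diff_left)
      then have "echar ((y - \<sigma>) \<bullet> \<gamma>) = echar d" using echar_add echar_int by (metis Ints_of_int mult_1)
      then have "norm (echar ((y - \<sigma>) \<bullet> \<gamma>) - 1) \<le> 2 * pi * \<bar>d\<bar>" using norm_echar_diff_one_le by simp
      also have "\<dots> \<le> 2 * pi * (1 / real M)" using d by (intro mult_left_mono) auto
      also have "\<dots> \<le> \<delta>" using M Mp assms(2) by (simp add: field_simps)
      finally show "norm (echar ((y - \<sigma>) \<bullet> \<gamma>) - 1) \<le> \<delta>" .
    qed
  qed
qed

text \<open>All but \<open>e / 4\<close> of the total mass sits on a finite \<open>G\<close>. Off
  \<open>G\<close> each term changes by at most twice its size, on \<open>G\<close> by at most
  \<open>\<delta>\<close> times its size.\<close>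

lemma exponential_series_almost_period:
  fixes a :: "'a::real_inner \<Rightarrow> complex"
  assumes abs: "(\<lambda>\<gamma>. norm (a \<gamma>)) summable_on \<Gamma>"
    and F: "\<And>x. ((\<lambda>\<gamma>. a \<gamma> * echar (x \<bullet> \<gamma>)) has_sum F x) \<Gamma>" and e: "e > 0"
  obtains G \<delta> where "finite G" "\<delta> > 0"
    "\<And>\<tau> x. (\<And>\<gamma>. \<gamma> \<in> G \<Longrightarrow> norm (echar (\<tau> \<bullet> \<gamma>) - 1) \<le> \<delta>) \<Longrightarrow> norm (F (x + \<tau>) - F x) \<le> e"
proof -
  define S where "S = (\<Sum>\<^sub>\<infinity>\<gamma>\<in>\<Gamma>. norm (a \<gamma>))"
  have S: "((\<lambda>\<gamma>. norm (a \<gamma>)) has_sum S) \<Gamma>" unfolding S_def using has_sum_infsum[OF abs] .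
  have S0: "S \<ge> 0" unfolding S_def by (intro infsum_nonneg) auto
  have "eventually (\<lambda>G. dist (sum (\<lambda>\<gamma>. norm (a \<gamma>)) G) S < e / 4) (finite_subsets_at_top \<Gamma>)"
    using S e unfolding has_sum_def by (intro tendstoD) auto
  then obtain G where G: "finite G" "G \<subseteq> \<Gamma>" "dist (sum (\<lambda>\<gamma>. norm (a \<gamma>)) G) S < e / 4"
    unfolding eventually_finite_subsets_at_top by blast
  \<comment> \<open>\<open>S + 1\<close> instead of \<open>S\<close> avoids division by zero when
    all coefficients vanish; half of \<open>e\<close> goes to \<open>G\<close>, half to the
    tail.\<close>
  define \<delta> where "\<delta> = e / (2 * (S + 1))"
  have \<delta>: "\<delta> > 0" "\<delta> * S \<le> e / 2" unfolding \<delta>_def using e S0 by (auto simp: field_simps)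
  have "((\<lambda>\<gamma>. norm (a \<gamma>)) has_sum (S - sum (\<lambda>\<gamma>. norm (a \<gamma>)) G)) (\<Gamma> - G)"
    using has_sum_Diff[OF S has_sum_finite[OF G(1)] G(2)] .
  then have tail: "((\<lambda>\<gamma>. if \<gamma> \<in> G then 0 else norm (a \<gamma>)) has_sum (S - sum (\<lambda>\<gamma>. norm (a \<gamma>)) G)) \<Gamma>"
    by (rule has_sum_cong_neutral[THEN iffD1, rotated -1]) auto
  have bd: "((\<lambda>\<gamma>. \<delta> * norm (a \<gamma>) + 2 * (if \<gamma> \<in> G then 0 else norm (a \<gamma>))) has_sum
      (\<delta> * S + 2 * (S - sum (\<lambda>\<gamma>. norm (a \<gamma>)) G))) \<Gamma>"
    by (intro has_sum_add has_sum_cmult_right S tail)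
  show ?thesis
  proof (rule that[OF G(1) \<delta>(1)])
    fix \<tau> x assume \<tau>: "\<And>\<gamma>. \<gamma> \<in> G \<Longrightarrow> norm (echar (\<tau> \<bullet> \<gamma>) - 1) \<le> \<delta>"
    have diff: "((\<lambda>\<gamma>. a \<gamma> * echar ((x + \<tau>) \<bullet> \<gamma>) + -1 * (a \<gamma> * echar (x \<bullet> \<gamma>))) has_sum (F (x + \<tau>) + -1 * F x)) \<Gamma>"
      by (intro has_sum_add has_sum_cmult_right F)
    have "norm (F (x + \<tau>) + -1 * F x) \<le> \<delta> * S + 2 * (S - sum (\<lambda>\<gamma>. norm (a \<gamma>)) G)"
    proof (rule norm_infsum_le[OF diff bd])
      fix \<gamma>
      have "a \<gamma> * echar ((x + \<tau>) \<bullet> \<gamma>) + -1 * (a \<gamma> * echar (x \<bullet> \<gamma>)) = a \<gamma> * echar (x \<bullet> \<gamma>) * (echar (\<tau> \<bullet> \<gamma>) - 1)"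
        by (simp add: inner_left_distrib echar_add algebra_simps)
      then have n: "norm (a \<gamma> * echar ((x + \<tau>) \<bullet> \<gamma>) + -1 * (a \<gamma> * echar (x \<bullet> \<gamma>))) = norm (a \<gamma>) * norm (echar (\<tau> \<bullet> \<gamma>) - 1)"
        by (simp add: norm_mult)
      have n2: "norm (echar (\<tau> \<bullet> \<gamma>) - 1) \<le> 2" using norm_triangle_ineq4[of "echar (\<tau> \<bullet> \<gamma>)" 1] by simp
      show "norm (a \<gamma> * echar ((x + \<tau>) \<bullet> \<gamma>) + -1 * (a \<gamma> * echar (x \<bullet> \<gamma>))) \<le> \<delta> * norm (a \<gamma>) + 2 * (if \<gamma> \<in> G then 0 else norm (a \<gamma>))"
      proof (cases "\<gamma> \<in> G")
        case True
        then show ?thesis unfolding n using mult_left_mono[OF \<tau>[OF True], of "norm (a \<gamma>)"] by (simp add: mult.commute)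
      next
        case False
        have "norm (a \<gamma>) * norm (echar (\<tau> \<bullet> \<gamma>) - 1) \<le> norm (a \<gamma>) * 2" using n2 by (intro mult_left_mono) auto
        also have "\<dots> \<le> \<delta> * norm (a \<gamma>) + 2 * norm (a \<gamma>)" using \<delta> by simp
        finally show ?thesis unfolding n using False by simp
      qed
    qed
    also have "\<dots> \<le> e / 2 + 2 * (e / 4)"
    proof -
      define s where "s = sum (\<lambda>\<gamma>. norm (a \<gamma>)) G"
      have "S - s \<le> e / 4" using G(3) unfolding dist_real_def s_def[symmetric] by linarith
      then show ?thesis using \<delta>(2) unfolding s_def[symmetric] by (intro add_mono mult_left_mono) auto
    qed
    finally show "norm (F (x + \<tau>) - F x) \<le> e" by simp
  qed
qed

text \<open>The union of the finite frequency sets and the smallest tolerance turn separate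
  conditions into one use of the pigeonhole principle. The frequency set may depend on
  \<open>i\<close>, since series of both distributions have to be treated together.\<close>

lemma common_almost_periods:
  fixes F :: "'i \<Rightarrow> 'a::real_inner \<Rightarrow> complex"
  assumes "finite I" "e > 0"
    "\<And>i. i \<in> I \<Longrightarrow> \<exists>a. (\<lambda>\<gamma>. norm (a \<gamma>)) summable_on \<Gamma> i \<and>
      (\<forall>x. ((\<lambda>\<gamma>. a \<gamma> * echar (x \<bullet> \<gamma>)) has_sum F i x) (\<Gamma> i))"
  obtains R where "\<And>y. \<exists>\<tau>. norm (\<tau> - y) \<le> R \<and> (\<forall>i\<in>I. \<forall>x. norm (F i (x + \<tau>) - F i x) \<le> e)"
proof -
  define Q where "Q i G \<delta> \<longleftrightarrow> finite G \<and> \<delta> > 0 \<and>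
    (\<forall>\<tau> x. (\<forall>\<gamma>\<in>G. norm (echar (\<tau> \<bullet> \<gamma>) - 1) \<le> \<delta>) \<longrightarrow> norm (F i (x + \<tau>) - F i x) \<le> e)" for i G and \<delta> :: real
  have "\<exists>G \<delta>. Q i G \<delta>" if i: "i \<in> I" for i
  proof -
    obtain a where a: "(\<lambda>\<gamma>. norm (a \<gamma>)) summable_on \<Gamma> i" "\<And>x. ((\<lambda>\<gamma>. a \<gamma> * echar (x \<bullet> \<gamma>)) has_sum F i x) (\<Gamma> i)"
      using assms(3)[OF i] by blast
    show ?thesis
      by (rule exponential_series_almost_period[OF a assms(2)], intro exI, unfold Q_def, blast)
  qed
  then obtain G \<delta> where Q: "\<And>i. i \<in> I \<Longrightarrow> Q i (G i) (\<delta> i)" by metis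
  define d where "d = Min (insert 1 (\<delta> ` I))"
  have d: "d > 0" "\<And>i. i \<in> I \<Longrightarrow> d \<le> \<delta> i"
    using assms(1) Q unfolding d_def Q_def by (auto simp: Min_gr_iff)
  have "finite (\<Union>i\<in>I. G i)" using assms(1) Q unfolding Q_def by blast
  then obtain R where R: "\<And>y. \<exists>\<tau>. norm (\<tau> - y) \<le> R \<and> (\<forall>\<gamma>\<in>(\<Union>i\<in>I. G i). norm (echar (\<tau> \<bullet> \<gamma>) - 1) \<le> d)"
    using simultaneous_almost_periods[OF _ d(1)] by metis
  show ?thesis
  proof (rule that[of R])
    fix y
    obtain \<tau> where \<tau>: "norm (\<tau> - y) \<le> R" "\<And>\<gamma>. \<gamma> \<in> (\<Union>i\<in>I. G i) \<Longrightarrow> norm (echar (\<tau> \<bullet> \<gamma>) - 1) \<le> d"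
      using R by metis
    have "norm (F i (x + \<tau>) - F i x) \<le> e" if i: "i \<in> I" for i x
    proof -
      have "norm (echar (\<tau> \<bullet> \<gamma>) - 1) \<le> \<delta> i" if "\<gamma> \<in> G i" for \<gamma>
        using \<tau>(2)[of \<gamma>] d(2)[OF i] i that by force
      then show ?thesis using Q[OF i] unfolding Q_def by blast
    qed
    then show "\<exists>\<tau>. norm (\<tau> - y) \<le> R \<and> (\<forall>i\<in>I. \<forall>x. norm (F i (x + \<tau>) - F i x) \<le> e)" using \<tau>(1) by blast
  qed
qed

subsection \<open>Periods of the supports\<close>

lemma finite_separated:
  fixes D :: "'a::metric_space set"
  assumes "finite D"
  obtains \<delta> where "\<delta> > 0" "\<And>x y. x \<in> D \<Longrightarrow> y \<in> D \<Longrightarrow> dist x y < \<delta> \<Longrightarrow> x = y"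
proof -
  define S where "S = insert 1 ((\<lambda>(x, y). dist x y) ` {p \<in> D \<times> D. fst p \<noteq> snd p})"
  have fin: "finite S" unfolding S_def using assms by simp
  have "Min S > 0" using fin by (subst Min_gr_iff) (auto simp: S_def)
  moreover have "x = y" if "x \<in> D" "y \<in> D" "dist x y < Min S" for x y
  proof (rule ccontr)
    assume "x \<noteq> y"
    then have "dist x y \<in> S" using that unfolding S_def by force
    then show False using Min_le[OF fin] that(3) by fastforce
  qed
  ultimately show ?thesis using that by blast
qed

text \<open>Two close points of \<open>\<Lambda>1\<close> have close differences with a common
  nearby point of \<open>\<Lambda>2\<close>; these differences lie in a bounded, hence finite, part
  of the discrete difference set.\<close>

lemma separated_of_discrete_differences:
  fixes \<Lambda>1 \<Lambda>2 :: "'a::euclidean_space set"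
  assumes disc: "discrete_set {l - l' | l l'. l \<in> \<Lambda>1 \<and> l' \<in> \<Lambda>2}"
    and rd: "\<And>x. \<exists>l\<in>\<Lambda>2. dist x l \<le> R"
  obtains \<delta> where "\<delta> > 0" "\<And>x y. x \<in> \<Lambda>1 \<Longrightarrow> y \<in> \<Lambda>1 \<Longrightarrow> dist x y < \<delta> \<Longrightarrow> x = y"
proof -
  define D where "D = cball 0 (R + 1) \<inter> {l - l' | l l'. l \<in> \<Lambda>1 \<and> l' \<in> \<Lambda>2}"
  have "finite D" unfolding D_def by (rule finite_discrete_Int_compact[OF disc]) simp
  then obtain \<delta> where \<delta>: "\<delta> > 0" "\<And>x y. x \<in> D \<Longrightarrow> y \<in> D \<Longrightarrow> dist x y < \<delta> \<Longrightarrow> x = y"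
    using finite_separated by metis
  show ?thesis
  proof (rule that[of "min 1 \<delta>"])
    show "min 1 \<delta> > 0" using \<delta> by simp
    fix x y assume xy: "x \<in> \<Lambda>1" "y \<in> \<Lambda>1" "dist x y < min 1 \<delta>"
    obtain l where l: "l \<in> \<Lambda>2" "dist x l \<le> R" using rd by blast
    have "dist y l \<le> R + 1" "dist x l \<le> R + 1" using l(2) xy(3) dist_triangle[of y l x] by (auto simp: dist_commute)
    then have "x - l \<in> D" "y - l \<in> D"
      unfolding D_def using xy l by (auto simp: dist_norm mem_cball_0 simp del: mem_cball)
    moreover have "dist (x - l) (y - l) < \<delta>" using xy(3) by (simp add: dist_norm)
    ultimately show "x = y" using \<delta>(2) by fastforce
  qed
qed

lemma discrete_set_differences_swap:
  fixes \<Lambda>1 \<Lambda>2 :: "'a::real_normed_vector set"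
  assumes "discrete_set {l - l' | l l'. l \<in> \<Lambda>1 \<and> l' \<in> \<Lambda>2}"
  shows "discrete_set {l - l' | l l'. l \<in> \<Lambda>2 \<and> l' \<in> \<Lambda>1}"
  unfolding discrete_set_def
proof (intro allI notI)
  fix x assume x: "x islimpt {l - l' | l l'. l \<in> \<Lambda>2 \<and> l' \<in> \<Lambda>1}"
  have "- x islimpt {l - l' | l l'. l \<in> \<Lambda>1 \<and> l' \<in> \<Lambda>2}"
    unfolding islimpt_approachable
  proof (intro allI impI)
    fix e :: real assume "e > 0"
    then obtain l l' where "l \<in> \<Lambda>2" "l' \<in> \<Lambda>1" "l - l' \<noteq> x" "dist (l - l') x < e"
      using x unfolding islimpt_approachable by blast
    then show "\<exists>x'\<in>{l - l' | l l'. l \<in> \<Lambda>1 \<and> l' \<in> \<Lambda>2}. x' \<noteq> - x \<and> dist x' (- x) < e"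
      by (intro bexI[of _ "l' - l"] CollectI exI[of _ l'] exI[of _ l])
         (auto simp: dist_norm norm_minus_commute algebra_simps)
  qed
  then show False using assms by (simp add: discrete_set_def)
qed

text \<open>Every point of \<open>\<Lambda>1 \<union> \<Lambda>2\<close> moves under an almost period with a small error. For neighbouring points
  of \<open>\<Lambda>1\<close> and \<open>\<Lambda>2\<close> the errors agree, because the differences lie in a finite set; chains of
  neighbours then give one common error.\<close>

lemma common_matching_error:
  fixes \<Lambda>1 \<Lambda>2 :: "'a::euclidean_space set"
  assumes rd1: "\<And>x. \<exists>l\<in>\<Lambda>1. dist x l \<le> R" and rd2: "\<And>x. \<exists>l\<in>\<Lambda>2. dist x l \<le> R" and R: "R > 0"
    and D: "D = cball 0 (3 * R + 2) \<inter> {l - l' | l l'. l \<in> \<Lambda>1 \<and> l' \<in> \<Lambda>2}"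
    and sep: "\<forall>x\<in>D. \<forall>y\<in>D. dist x y < 2 * r \<longrightarrow> x = y" and r: "r \<le> 1"
    and m1: "\<forall>l\<in>\<Lambda>1. \<exists>l'\<in>\<Lambda>1. dist l' (l + \<tau>) < r"
    and m2: "\<forall>l\<in>\<Lambda>2. \<exists>l'\<in>\<Lambda>2. dist l' (l + \<tau>) < r"
  obtains e where "norm e < r" "\<And>l. l \<in> \<Lambda>1 \<Longrightarrow> l + (\<tau> + e) \<in> \<Lambda>1" "\<And>l. l \<in> \<Lambda>2 \<Longrightarrow> l + (\<tau> + e) \<in> \<Lambda>2"
proof -
  obtain n1 where n1: "\<And>l. l \<in> \<Lambda>1 \<Longrightarrow> n1 l \<in> \<Lambda>1 \<and> dist (n1 l) (l + \<tau>) < r" using m1 by metis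
  obtain n2 where n2: "\<And>l. l \<in> \<Lambda>2 \<Longrightarrow> n2 l \<in> \<Lambda>2 \<and> dist (n2 l) (l + \<tau>) < r" using m2 by metis
  define e1 where "e1 l = n1 l - (l + \<tau>)" for l
  define e2 where "e2 l = n2 l - (l + \<tau>)" for l
  have e1: "norm (e1 l) < r" "l + (\<tau> + e1 l) \<in> \<Lambda>1" if "l \<in> \<Lambda>1" for l
    using n1[OF that] by (auto simp: e1_def dist_norm)
  have e2: "norm (e2 l) < r" "l + (\<tau> + e2 l) \<in> \<Lambda>2" if "l \<in> \<Lambda>2" for l
    using n2[OF that] by (auto simp: e2_def dist_norm)
  have near: "e1 l = e2 l'" if l: "l \<in> \<Lambda>1" "l' \<in> \<Lambda>2" "dist l l' \<le> 3 * R" for l l'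
  proof -
    \<comment> \<open>The displaced difference deviates from the original one by less than
      \<open>2 * r\<close>, which is at most 2, so both lie in \<open>D\<close>, whose radius is
      chosen accordingly.\<close>
    let ?x = "l - l'" and ?y = "(l + (\<tau> + e1 l)) - (l' + (\<tau> + e2 l'))"
    have eq: "?y = ?x + (e1 l - e2 l')" by simp
    have n: "norm (e1 l - e2 l') < 2 * r"
      using norm_triangle_ineq4[of "e1 l" "e2 l'"] e1(1)[OF l(1)] e2(1)[OF l(2)] by linarith
    have "norm ?y \<le> 3 * R + 2"
      unfolding eq using norm_triangle_ineq[of ?x "e1 l - e2 l'"] l(3) n r by (simp add: dist_norm)
    then have "?y \<in> D" unfolding D Int_iff mem_cball_0 using e1(2)[OF l(1)] e2(2)[OF l(2)] by blast
    moreover have "?x \<in> D" unfolding D Int_iff mem_cball_0 using l R by (auto simp: dist_norm)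
    moreover have "dist ?y ?x < 2 * r" unfolding eq dist_norm using n by simp
    ultimately have "?y = ?x" using sep by blast
    then show ?thesis unfolding eq by simp
  qed
  have chain: "\<forall>l\<in>\<Lambda>1. \<forall>l'\<in>\<Lambda>2. dist l l' \<le> 3 * R + real k * R \<longrightarrow> e1 l = e2 l'" for k
  proof (induction k)
    case 0 then show ?case using near by simp
  next
    case (Suc k)
    show ?case
    proof (intro ballI impI)
      fix l l' assume l: "l \<in> \<Lambda>1" "l' \<in> \<Lambda>2" "dist l l' \<le> 3 * R + real (Suc k) * R"
      show "e1 l = e2 l'"
      proof (cases "dist l l' \<le> 3 * R")
        case False
        define d where "d = norm (l - l')"
        have d: "d > 3 * R" using False by (simp add: d_def dist_norm)
        \<comment> \<open>The point at distance \<open>2 * R\<close> from \<open>l'\<close> on the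
          segment to \<open>l\<close>. Near it there are \<open>a\<close> in
          \<open>\<Lambda>1\<close>, within \<open>3 * R\<close> of \<open>l'\<close>, and
          \<open>b\<close> in \<open>\<Lambda>2\<close>, within \<open>2 * R\<close> of
          \<open>a\<close> and closer to \<open>l\<close> than \<open>l'\<close> by at least
          \<open>R\<close>; passing from \<open>l'\<close> through \<open>a\<close> to
          \<open>b\<close> thus shortens the distance.\<close>
        define x where "x = l' + (2 * R / d) *\<^sub>R (l - l')"
        have "norm (x - l') = 2 * R" unfolding x_def using d R by (auto simp: d_def)
        then have xl': "dist x l' = 2 * R" by (simp add: dist_norm)
        have "l - x = (1 - 2 * R / d) *\<^sub>R (l - l')" unfolding x_def by (simp add: algebra_simps)
        then have "norm (l - x) = \<bar>1 - 2 * R / d\<bar> * d" by (simp add: d_def)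
        also have "\<bar>1 - 2 * R / d\<bar> = 1 - 2 * R / d" using d R by simp
        also have "(1 - 2 * R / d) * d = d - 2 * R" using d R by (simp add: left_diff_distrib)
        finally have "norm (l - x) = d - 2 * R" .
        then have xl: "dist x l = d - 2 * R" by (simp add: dist_norm norm_minus_commute)
        obtain a where a: "a \<in> \<Lambda>1" "dist x a \<le> R" using rd1 by blast
        obtain b where b: "b \<in> \<Lambda>2" "dist x b \<le> R" using rd2 by blast
        have "dist a l' \<le> 3 * R" using dist_triangle3[of a l' x] a xl' by simp
        then have 1: "e1 a = e2 l'" using near a l by blast
        have "dist a b \<le> 3 * R" using dist_triangle3[of a b x] a b R by simp
        then have 2: "e1 a = e2 b" using near a b by blast
        have "dist l b \<le> d - R" using dist_triangle3[of l b x] b xl by simp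
        also have "\<dots> \<le> 3 * R + real k * R" using l(3) by (simp add: d_def dist_norm algebra_simps)
        finally have "e1 l = e2 b" using Suc l b by blast
        then show ?thesis using 1 2 by simp
      qed (use near l in blast)
    qed
  qed
  have all: "e1 l = e2 l'" if l: "l \<in> \<Lambda>1" "l' \<in> \<Lambda>2" for l l'
  proof -
    obtain k where "real k > dist l l' / R" using reals_Archimedean2 by blast
    then have "dist l l' \<le> 3 * R + real k * R" using R by (simp add: field_simps)
    then show ?thesis using chain l by blast
  qed
  obtain l0 l0' where l0: "l0 \<in> \<Lambda>1" "l0' \<in> \<Lambda>2" using rd1 rd2 by blast
  show ?thesis
  proof (rule that[of "e1 l0"])
    show "norm (e1 l0) < r" using e1 l0 by blast
    show "l + (\<tau> + e1 l0) \<in> \<Lambda>1" if "l \<in> \<Lambda>1" for l using e1(2)[OF that] all[OF that l0(2)] all[OF l0] by simp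
    show "l + (\<tau> + e1 l0) \<in> \<Lambda>2" if "l \<in> \<Lambda>2" for l using e2(2)[OF that] all[OF l0(1) that] by simp
  qed
qed

definition near_period :: "real \<Rightarrow> 'a::real_normed_vector set \<Rightarrow> 'a \<Rightarrow> bool"
  where "near_period r A \<tau> \<longleftrightarrow> (\<forall>l\<in>A. \<exists>l'\<in>A. dist l' (l + \<tau>) < r)"

text \<open>Demanding both signs makes this a group; the condition on \<open>x + t\<close> alone
  describes only a semigroup, as for a half-line.\<close>

definition periods :: "'a::ab_group_add set \<Rightarrow> 'a set"
  where "periods A = {t. (\<forall>x\<in>A. x + t \<in> A) \<and> (\<forall>x\<in>A. x - t \<in> A)}"

text \<open>The matching lemma is applied to \<open>\<tau>\<close> and to \<open>- \<tau>\<close>.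
  The two corrected translations compose to a shift by less than the separation of
  \<open>\<Lambda>1\<close>, so they are inverse to each other and \<open>\<tau> + e\<close> is a
  period in both directions.\<close>

lemma periods_relatively_dense:
  fixes \<Lambda>1 \<Lambda>2 :: "'a::euclidean_space set"
  assumes rd1: "\<And>x. \<exists>l\<in>\<Lambda>1. dist x l \<le> R" and rd2: "\<And>x. \<exists>l\<in>\<Lambda>2. dist x l \<le> R" and R: "R > 0"
    and disc: "discrete_set {l - l' | l l'. l \<in> \<Lambda>1 \<and> l' \<in> \<Lambda>2}"
    and ap: "\<And>r. r > 0 \<Longrightarrow> \<exists>\<rho>. \<forall>y. \<exists>\<tau>. norm (\<tau> - y) \<le> \<rho> \<and>
      (\<forall>\<sigma>\<in>{\<tau>, - \<tau>}. near_period r \<Lambda>1 \<sigma> \<and> near_period r \<Lambda>2 \<sigma>)"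
  obtains \<rho> where "\<And>y. \<exists>t\<in>periods \<Lambda>1 \<inter> periods \<Lambda>2. norm (t - y) \<le> \<rho>"
proof -
  define D where "D = cball 0 (3 * R + 2) \<inter> {l - l' | l l'. l \<in> \<Lambda>1 \<and> l' \<in> \<Lambda>2}"
  have "finite D" unfolding D_def by (rule finite_discrete_Int_compact[OF disc]) simp
  then obtain \<delta> where \<delta>: "\<delta> > 0" "\<And>x y. x \<in> D \<Longrightarrow> y \<in> D \<Longrightarrow> dist x y < \<delta> \<Longrightarrow> x = y"
    using finite_separated by metis
  obtain \<delta>1 where \<delta>1: "\<delta>1 > 0" "\<And>x y. x \<in> \<Lambda>1 \<Longrightarrow> y \<in> \<Lambda>1 \<Longrightarrow> dist x y < \<delta>1 \<Longrightarrow> x = y"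
    using separated_of_discrete_differences[OF disc rd2] by metis
  \<comment> \<open>Half, because two errors of size \<open>r\<close> add up, once against the gaps
    in \<open>D\<close> and once against those in \<open>\<Lambda>1\<close>; the bound by 1 fits the
    radius of \<open>D\<close>.\<close>
  define r where "r = min 1 (min \<delta> \<delta>1) / 2"
  have r: "r > 0" "r \<le> 1" "2 * r \<le> \<delta>" "2 * r \<le> \<delta>1" using \<delta> \<delta>1 by (auto simp: r_def min_def)
  have sep: "\<forall>x\<in>D. \<forall>y\<in>D. dist x y < 2 * r \<longrightarrow> x = y" using \<delta>(2) r by force
  obtain \<rho> where \<rho>: "\<And>y. \<exists>\<tau>. norm (\<tau> - y) \<le> \<rho> \<and>
      (\<forall>\<sigma>\<in>{\<tau>, - \<tau>}. near_period r \<Lambda>1 \<sigma> \<and> near_period r \<Lambda>2 \<sigma>)"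
    using ap[OF r(1)] by blast
  show ?thesis
  proof (rule that[of "\<rho> + 1"])
    fix y
    obtain \<tau> where \<tau>: "norm (\<tau> - y) \<le> \<rho>"
      "\<forall>l\<in>\<Lambda>1. \<exists>l'\<in>\<Lambda>1. dist l' (l + \<tau>) < r" "\<forall>l\<in>\<Lambda>1. \<exists>l'\<in>\<Lambda>1. dist l' (l + - \<tau>) < r"
      "\<forall>l\<in>\<Lambda>2. \<exists>l'\<in>\<Lambda>2. dist l' (l + \<tau>) < r" "\<forall>l\<in>\<Lambda>2. \<exists>l'\<in>\<Lambda>2. dist l' (l + - \<tau>) < r"
      using \<rho>[of y] unfolding near_period_def by blast
    obtain e where e: "norm e < r" "\<And>l. l \<in> \<Lambda>1 \<Longrightarrow> l + (\<tau> + e) \<in> \<Lambda>1" "\<And>l. l \<in> \<Lambda>2 \<Longrightarrow> l + (\<tau> + e) \<in> \<Lambda>2"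
      using common_matching_error[OF rd1 rd2 R D_def sep r(2) \<tau>(2,4)] by metis
    obtain e' where e': "norm e' < r" "\<And>l. l \<in> \<Lambda>1 \<Longrightarrow> l + (- \<tau> + e') \<in> \<Lambda>1" "\<And>l. l \<in> \<Lambda>2 \<Longrightarrow> l + (- \<tau> + e') \<in> \<Lambda>2"
      using common_matching_error[OF rd1 rd2 R D_def sep r(2) \<tau>(3,5)] by metis
    obtain l0 where l0: "l0 \<in> \<Lambda>1" using rd1 by blast
    have "l0 + (\<tau> + e) + (- \<tau> + e') \<in> \<Lambda>1" using e(2) e'(2) l0 by blast
    moreover have "dist (l0 + (\<tau> + e) + (- \<tau> + e')) l0 < \<delta>1"
      using norm_triangle_ineq[of e e'] e(1) e'(1) r(4) by (simp add: dist_norm)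
    ultimately have "l0 + (\<tau> + e) + (- \<tau> + e') = l0" using \<delta>1(2) l0 by blast
    then have "e' = - e" by (simp add: add_eq_0_iff)
    then have neg: "l + (- \<tau> + e') = l - (\<tau> + e)" for l by simp
    have "\<tau> + e \<in> periods \<Lambda>1 \<inter> periods \<Lambda>2"
      using e(2,3) e'(2,3) unfolding neg periods_def by blast
    moreover have "norm (\<tau> + e - y) \<le> \<rho> + 1"
      using norm_triangle_ineq[of "\<tau> - y" e] \<tau>(1) e(1) r(2) by (simp add: algebra_simps)
    ultimately show "\<exists>t\<in>periods \<Lambda>1 \<inter> periods \<Lambda>2. norm (t - y) \<le> \<rho> + 1" by blast
  qed
qed

subsection \<open>Lattices\<close>

lemma subgroup_int_scaleR:
  fixes L :: "'a::real_vector set"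
  assumes "0 \<in> L" "\<And>x y. x \<in> L \<Longrightarrow> y \<in> L \<Longrightarrow> x - y \<in> L" "x \<in> L" "c \<in> \<int>"
  shows "c *\<^sub>R x \<in> L"
proof -
  have neg: "- y \<in> L" if "y \<in> L" for y using assms(2)[OF assms(1) that] by simp
  have add: "y + z \<in> L" if "y \<in> L" "z \<in> L" for y z using assms(2)[OF that(1) neg[OF that(2)]] by simp
  have nat: "real k *\<^sub>R x \<in> L" for k
    by (induction k) (auto simp: assms(1) scaleR_add_left intro: add assms(3))
  obtain k where c: "c = of_int k" using assms(4) by (auto elim: Ints_cases)
  show ?thesis
  proof (cases "k \<ge> 0")
    case True
    then show ?thesis using nat[of "nat k"] by (simp add: c)
  next
    case False
    then have "c *\<^sub>R x = - (real (nat (- k)) *\<^sub>R x)" by (simp add: c)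
    then show ?thesis using neg nat by metis
  qed
qed

lemma subgroup_sum:
  fixes L :: "'a::real_vector set"
  assumes "0 \<in> L" "\<And>x y. x \<in> L \<Longrightarrow> y \<in> L \<Longrightarrow> x - y \<in> L" "\<And>j. j \<in> J \<Longrightarrow> g j \<in> L"
  shows "sum g J \<in> L"
proof -
  have add: "y + z \<in> L" if "y \<in> L" "z \<in> L" for y z
    using assms(2)[OF that(1) assms(2)[OF assms(1) that(2)]] by simp
  show ?thesis using assms(3)
    by (induction J rule: infinite_finite_induct) (auto simp: assms(1) intro: add)
qed

text \<open>A basis of \<open>L\<close> is a matrix with rows in \<open>L\<close> of minimal nonzero determinant: otherwise replacing
  a row by a vector with a fractional coordinate makes the determinant smaller.\<close>

lemma lattice_basis_exists:
  fixes L :: "(real ^ 'n::finite) set" and M :: nat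
  assumes zero: "0 \<in> L" and diff: "\<And>x y. x \<in> L \<Longrightarrow> y \<in> L \<Longrightarrow> x - y \<in> L"
    and ax: "\<And>i. axis i 1 \<in> L" and M: "M > 0" "\<And>x i. x \<in> L \<Longrightarrow> real M * x $ i \<in> \<int>"
  obtains S :: "real ^ 'n \<Rightarrow> real ^ 'n" where "linear S" "bij S" "L = S ` {x. \<forall>i. x $ i \<in> \<int>}"
proof -
  let ?d = "CARD('n)"
  define P where "P C \<longleftrightarrow> (\<forall>i. row i C \<in> L) \<and> det C \<noteq> 0" for C :: "real ^ 'n ^ 'n"
  \<comment> \<open>For matrices with rows in \<open>L\<close> the entries become integers after
    multiplication by \<open>M\<close>, so the scaled determinant is an integer and the minimum can
    be taken over natural numbers.\<close>
  define g where "g C = nat \<lfloor>real M ^ ?d * \<bar>det C\<bar>\<rfloor>" for C :: "real ^ 'n ^ 'n"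
  have g: "real (g C) = real M ^ ?d * \<bar>det C\<bar>" if "P C" for C
  proof -
    have "real M ^ ?d * det C = (\<Sum>p | p permutes (UNIV :: 'n set). of_int (sign p) * (\<Prod>i\<in>UNIV. real M * C $ i $ p i))"
      by (simp add: det_def sum_distrib_left prod.distrib mult_ac)
    also have "\<dots> \<in> \<int>"
    proof -
      have "real M * C $ i $ j \<in> \<int>" for i j
      proof -
        have "row i C \<in> L" using that by (simp add: P_def)
        then have "real M * row i C $ j \<in> \<int>" by (rule M(2))
        then show ?thesis by (simp add: row_def)
      qed
      then show ?thesis by (intro Ints_sum Ints_mult[OF Ints_of_int Ints_prod])
    qed
    finally have "\<bar>real M ^ ?d * det C\<bar> \<in> \<int>" by (rule Ints_abs)
    then have "real M ^ ?d * \<bar>det C\<bar> \<in> \<int>" by (simp add: abs_mult)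
    then obtain k where k: "real M ^ ?d * \<bar>det C\<bar> = of_int k" by (auto elim: Ints_cases)
    have "0 \<le> (of_int k :: real)" unfolding k[symmetric] by simp
    then show ?thesis unfolding g_def k by simp
  qed
  have "row i (mat 1 :: real ^ 'n ^ 'n) = axis i 1" for i
    by (simp add: row_def mat_def axis_def vec_eq_iff)
  then have "P (mat 1)" unfolding P_def using ax by simp
  then obtain C where C: "P C" "\<And>C'. P C' \<Longrightarrow> g C \<le> g C'"
    using ex_has_least_nat[of P "mat 1" g] by blast
  define S where "S z = transpose C *v z" for z
  have S: "S z = (\<Sum>i\<in>UNIV. z $ i *\<^sub>R row i C)" for z
    unfolding S_def matrix_mult_sum column_transpose scalar_mult_eq_scaleR ..
  have inv: "invertible (transpose C)" using C(1) by (simp add: P_def invertible_det_nz)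
  then obtain B where B: "transpose C ** B = mat 1" "B ** transpose C = mat 1" unfolding invertible_def by blast
  have bij: "bij S"
  proof (rule bij_betw_byWitness[where f' = "\<lambda>z. B *v z"])
    show "\<forall>z\<in>UNIV. B *v S z = z" "\<forall>z\<in>UNIV. S (B *v z) = z"
      unfolding S_def matrix_vector_mul_assoc B by auto
  qed auto
  have lin: "linear S" unfolding S_def by (rule matrix_vector_mul_linear)
  have comb: "S z \<in> L" if "\<And>i. z $ i \<in> \<int>" for z
    unfolding S using C(1) that
    by (intro subgroup_sum[OF zero diff] subgroup_int_scaleR[OF zero diff]) (auto simp: P_def)
  have "x \<in> S ` {x. \<forall>i. x $ i \<in> \<int>}" if x: "x \<in> L" for x
  proof -
    obtain t where t: "x = S t" using bij by (meson bij_pointE)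
    have "t $ k \<in> \<int>" for k
    proof (rule ccontr)
      assume nk: "t $ k \<notin> \<int>"
      define y :: "real ^ 'n" where "y = (\<chi> i. frac (t $ i))"
      have "S y = x - S (\<chi> i. of_int \<lfloor>t $ i\<rfloor>)"
        unfolding t linear_diff[OF lin, symmetric] y_def by (rule arg_cong[of _ _ S]) (simp add: vec_eq_iff frac_def)
      also have "\<dots> \<in> L" by (intro diff x comb) simp
      finally have yL: "S y \<in> L" .
      define C' :: "real ^ 'n ^ 'n" where "C' = (\<chi> i. if i = k then \<Sum>i\<in>UNIV. y $ i *s row i C else row i C)"
      have det: "det C' = y $ k * det C" unfolding C'_def by (rule cramer_lemma_transpose)
      have yk: "0 < y $ k" "y $ k < 1" using nk by (auto simp: y_def frac_gt_0_iff frac_lt_1)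
      have "row i C' = (if i = k then S y else row i C)" for i
        unfolding S by (auto simp: row_def C'_def vec_eq_iff scalar_mult_eq_scaleR)
      then have PC': "P C'" unfolding P_def using yL C(1) det yk by (auto simp: P_def)
      have "real (g C') < real (g C)"
        unfolding g[OF PC'] g[OF C(1)] det using yk C(1) M(1) by (simp add: abs_mult P_def)
      then show False using C(2)[OF PC'] by simp
    qed
    then show ?thesis using t by blast
  qed
  then have "L = S ` {x. \<forall>i. x $ i \<in> \<int>}" using comb by blast
  then show ?thesis using that lin bij by blast
qed

text \<open>Relative density makes \<open>L\<close> span the space, so a basis can be taken from
  \<open>L\<close>, and in its coordinates \<open>L\<close> contains the integer vectors. Finiteness
  of the part in the unit cube then bounds all denominators by one \<open>M\<close>, and
  \<open>lattice_basis_exists\<close> applies.\<close>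

lemma full_rank_lattice_of_discrete_subgroup:
  fixes L :: "(real ^ 'n::finite) set"
  assumes zero: "0 \<in> L" and diff: "\<And>x y. x \<in> L \<Longrightarrow> y \<in> L \<Longrightarrow> x - y \<in> L"
    and fin: "\<And>r. finite (L \<inter> cball 0 r)" and rd: "\<And>y. \<exists>t\<in>L. norm (t - y) \<le> \<rho>"
  shows "full_rank_lattice L"
proof -
  have span: "span L = UNIV"
  proof (rule ccontr)
    assume "span L \<noteq> UNIV"
    then obtain a where a: "a \<noteq> 0" "\<And>x. x \<in> span L \<Longrightarrow> a \<bullet> x = 0"
      using span_not_UNIV_orthogonal by blast
    have \<rho>: "\<rho> \<ge> 0" using rd[of 0] norm_ge_zero order_trans by blast
    \<comment> \<open>A point at distance \<open>\<rho> + 1\<close> from the hyperplane orthogonal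
      to \<open>a\<close>, which would contain \<open>L\<close>.\<close>
    define y where "y = ((\<rho> + 1) / norm a) *\<^sub>R a"
    obtain t where t: "t \<in> L" "norm (t - y) \<le> \<rho>" using rd by blast
    have "a \<bullet> (y - t) = (\<rho> + 1) * norm a"
      using a(2)[OF span_base[OF t(1)]] a(1) by (simp add: y_def inner_diff_right dot_square_norm power2_eq_square)
    moreover have "a \<bullet> (y - t) \<le> norm a * \<rho>"
      using norm_cauchy_schwarz[of a "y - t"] t(2)
      by (metis mult_left_mono norm_ge_zero norm_minus_commute order_trans)
    ultimately have "norm a * (\<rho> + 1) \<le> norm a * \<rho>" by (simp add: mult.commute)
    then show False using a(1) by simp
  qed
  obtain B where B: "B \<subseteq> L" "independent B" "L \<subseteq> span B" "card B = dim L"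
    using basis_exists[of L] by blast
  have finB: "finite B" using B(2) by (rule independent_imp_finite)
  have spanB: "span B = UNIV" using span_mono[OF B(3)] span by (auto simp: span_span)
  have "card B = CARD('n)" using B(4) dim_span[of L] span by (simp add: dim_UNIV)
  then obtain b where b: "bij_betw b (UNIV :: 'n set) B"
    using finB bij_betw_iff_card[of "UNIV :: 'n set" B] by auto
  define h where "h z = (\<Sum>i\<in>UNIV. z $ i *\<^sub>R b i)" for z :: "real ^ 'n"
  have lin: "linear h" unfolding h_def
    by (rule linearI) (auto simp: scaleR_add_left sum.distrib scaleR_sum_right)
  have surj: "surj h"
  proof -
    have "\<exists>z. x = h z" for x
    proof -
      have "x \<in> span B" using spanB by simp
      then obtain u where "x = (\<Sum>v\<in>B. u v *\<^sub>R v)" using span_finite[OF finB] by auto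
      also have "\<dots> = (\<Sum>i\<in>UNIV. u (b i) *\<^sub>R b i)" by (rule sum.reindex_bij_betw[OF b, symmetric])
      finally have "x = h (\<chi> i. u (b i))" by (simp add: h_def)
      then show ?thesis by blast
    qed
    then show ?thesis by (simp add: surj_def)
  qed
  have inj: "inj h" using linear_surjective_imp_injective[OF lin surj] by simp
  define L' where "L' = h -` L"
  have z': "0 \<in> L'" unfolding L'_def using zero by (simp add: linear_0[OF lin])
  have d': "x - y \<in> L'" if "x \<in> L'" "y \<in> L'" for x y
    using that diff unfolding L'_def by (simp add: linear_diff[OF lin])
  have ax: "axis i 1 \<in> L'" for i
  proof -
    have "h (axis i 1) = (\<Sum>j\<in>UNIV. if j = i then b j else 0)"
      unfolding h_def by (intro sum.cong) (auto simp: axis_def)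
    also have "\<dots> = b i" by simp
    also have "\<dots> \<in> L" using b B(1) by (auto simp: bij_betw_def)
    finally show ?thesis by (simp add: L'_def)
  qed
  have int: "z \<in> L'" if "\<And>i. z $ i \<in> \<int>" for z
  proof -
    have "z = (\<Sum>i\<in>UNIV. z $ i *\<^sub>R axis i 1)" using basis_expansion[of z] by (simp add: scalar_mult_eq_scaleR)
    also have "\<dots> \<in> L'" using that
      by (intro subgroup_sum[OF z' d'] subgroup_int_scaleR[OF z' d'] ax) auto
    finally show ?thesis .
  qed
  define F where "F = {z \<in> L'. \<forall>i. 0 \<le> z $ i \<and> z $ i \<le> 1}"
  have "h ` F \<subseteq> L \<inter> cball 0 (\<Sum>i\<in>UNIV. norm (b i))"
  proof
    fix x assume "x \<in> h ` F"
    then obtain z where z: "x = h z" "z \<in> F" by blast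
    have "norm (h z) \<le> (\<Sum>i\<in>UNIV. norm (b i))"
      unfolding h_def
    proof (rule order_trans[OF norm_sum sum_mono])
      fix i
      show "norm (z $ i *\<^sub>R b i) \<le> norm (b i)" using z(2) by (auto simp: F_def intro!: mult_left_le_one_le)
    qed
    then show "x \<in> L \<inter> cball 0 (\<Sum>i\<in>UNIV. norm (b i))"
      using z unfolding Int_iff mem_cball_0 by (auto simp: F_def L'_def)
  qed
  then have "finite (h ` F)" using fin finite_subset by blast
  then have finF: "finite F" using inj finite_imageD inj_on_subset by blast
  \<comment> \<open>Among the \<open>card F + 1\<close> multiples \<open>j * x\<close> reduced to
    the unit cube two coincide, so some number between 1 and \<open>card F\<close> clears the
    denominators of \<open>x\<close>; the factorial is a multiple of all such numbers.\<close>
  define M :: nat where "M = fact (card F)"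
  have M: "real M * x $ i \<in> \<int>" if x: "x \<in> L'" for x i
  proof -
    define \<phi> :: "nat \<Rightarrow> real ^ 'n" where "\<phi> j = (\<chi> i. frac (real j * x $ i))" for j
    have "\<phi> j \<in> F" for j
    proof -
      have "\<phi> j = real j *\<^sub>R x - (\<chi> i. of_int \<lfloor>real j * x $ i\<rfloor>)"
        by (simp add: \<phi>_def vec_eq_iff frac_def)
      also have "\<dots> \<in> L'"
      proof (rule d')
        show "real j *\<^sub>R x \<in> L'" by (intro subgroup_int_scaleR[OF z' d'] x) auto
        show "(\<chi> i. of_int \<lfloor>real j * x $ i\<rfloor>) \<in> L'" by (rule int) simp
      qed
      finally show ?thesis by (simp add: F_def \<phi>_def frac_lt_1 less_imp_le)
    qed
    then have "\<phi> ` {0..card F} \<subseteq> F" by blast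
    then have "\<not> inj_on \<phi> {0..card F}" using card_inj_on_le[OF _ _ finF, of \<phi> "{0..card F}"] by auto
    then obtain j j' where j: "j \<le> card F" "j' \<le> card F" "j < j'" "\<phi> j = \<phi> j'"
      unfolding inj_on_def by (metis atLeastAtMost_iff linorder_neqE_nat)
    have "frac (real j * x $ i) = frac (real j' * x $ i)" using j(4) by (simp add: \<phi>_def vec_eq_iff)
    then have "real (j' - j) * x $ i = of_int (\<lfloor>real j' * x $ i\<rfloor> - \<lfloor>real j * x $ i\<rfloor>)"
      using j(3) by (simp add: frac_def of_nat_diff algebra_simps)
    then have "real (j' - j) * x $ i \<in> \<int>" by simp
    moreover have "(j' - j) dvd fact (card F)" using j by (intro dvd_fact) auto
    then obtain m where "M = (j' - j) * m" unfolding M_def by (rule dvdE)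
    then have "real M * x $ i = real m * (real (j' - j) * x $ i)" by simp
    ultimately show ?thesis by (metis Ints_mult Ints_of_nat)
  qed
  have "M > 0" by (simp add: M_def)
  then obtain S :: "real ^ 'n \<Rightarrow> real ^ 'n" where S: "linear S" "bij S" "L' = S ` {x. \<forall>i. x $ i \<in> \<int>}"
    using lattice_basis_exists[OF z' d' ax _ M] by metis
  have "L = h ` L'" unfolding L'_def using surj by (simp add: surj_image_vimage_eq)
  then have "L = (h \<circ> S) ` {x. \<forall>i. x $ i \<in> \<int>}" using S(3) by (simp add: image_comp)
  moreover have "bij (h \<circ> S)" using bij_comp[OF S(2) bijI[OF inj surj]] .
  moreover have "linear (h \<circ> S)" using S(1) lin by (rule linear_compose)
  ultimately show ?thesis unfolding full_rank_lattice_def by blast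
qed

section \<open>Common periods and crystals\<close>

lemma periods_diff:
  assumes "s \<in> periods A" "t \<in> periods A" shows "s - t \<in> periods A"
proof -
  have "x + (s - t) \<in> A \<and> x - (s - t) \<in> A" if "x \<in> A" for x
  proof -
    have "x + s - t \<in> A" "x + t - s \<in> A" using assms that unfolding periods_def by blast+
    then show ?thesis by (simp add: algebra_simps)
  qed
  then show ?thesis by (simp add: periods_def)
qed

lemma finite_periods_Int_cball:
  fixes A :: "'a::euclidean_space set"
  assumes "discrete_set A" "a \<in> A"
  shows "finite (periods A \<inter> cball 0 r)"
proof -
  have "(\<lambda>t. a + t) ` (periods A \<inter> cball 0 r) \<subseteq> cball a r \<inter> A"
    using assms(2) by (auto simp: periods_def dist_norm)
  then have "finite ((\<lambda>t. a + t) ` (periods A \<inter> cball 0 r))"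
    using finite_discrete_Int_compact[OF assms(1) compact_cball] finite_subset by blast
  then show ?thesis by (rule finite_imageD) simp
qed

text \<open>A period near \<open>x\<close> moves \<open>x\<close> into the ball of radius
  \<open>\<rho>\<close>, so the finitely many points of \<open>A\<close> there represent all cosets,
  possibly with repetition.\<close>

lemma pure_crystal_of_periods:
  fixes A :: "(real ^ 'n::finite) set"
  assumes disc: "discrete_set A" and L: "L \<subseteq> periods A" and rd: "\<And>y. \<exists>t\<in>L. norm (t - y) \<le> \<rho>"
  shows "pure_crystal L A"
  unfolding pure_crystal_def
proof (intro exI conjI)
  let ?F = "cball 0 \<rho> \<inter> A"
  show "finite ?F" by (rule finite_discrete_Int_compact[OF disc compact_cball])
  show "A = (\<Union>c\<in>?F. (\<lambda>x. c + x) ` L)"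
  proof
    show "A \<subseteq> (\<Union>c\<in>?F. (\<lambda>x. c + x) ` L)"
    proof
      fix x assume x: "x \<in> A"
      obtain t where t: "t \<in> L" "norm (t - x) \<le> \<rho>" using rd by blast
      have "x - t \<in> ?F" using t x L unfolding Int_iff mem_cball_0 periods_def
        by (auto simp: norm_minus_commute)
      then show "x \<in> (\<Union>c\<in>?F. (\<lambda>x. c + x) ` L)" using t(1) by (intro UN_I[of "x - t"]) (auto intro: image_eqI[of _ _ t])
    qed
    show "(\<Union>c\<in>?F. (\<lambda>x. c + x) ` L) \<subseteq> A" using L by (auto simp: periods_def)
  qed
qed

text \<open>Growth is controlled only for the sum of both masses and only for large
  \<open>r\<close>. The other summand \<open>g\<close> is dropped as nonnegative, and monotonicity
  of the mass extends the bound down to \<open>r = 1\<close>.\<close>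

lemma mass_growth_polynomial:
  fixes \<Gamma> :: "(real ^ 'n::finite) set"
  assumes loc: "\<And>r. (\<lambda>\<gamma>. norm (q \<gamma>)) summable_on {\<gamma>\<in>\<Gamma>. norm \<gamma> < r}"
    and big: "(\<lambda>r. mass_growth \<Gamma> q r + g r) \<in> O[at_top](\<lambda>r. r powr T)" and g: "\<And>r. g r \<ge> 0"
  obtains A t where "\<And>r. r \<ge> 1 \<Longrightarrow> mass_growth \<Gamma> q r \<le> A * r ^ t"
proof -
  obtain c where c: "c > 0" "eventually (\<lambda>r. norm (mass_growth \<Gamma> q r + g r) \<le> c * norm (r powr T)) at_top"
    using landau_o.bigE[OF big] by blast
  then obtain r0 where r0: "\<And>r. r \<ge> r0 \<Longrightarrow> norm (mass_growth \<Gamma> q r + g r) \<le> c * norm (r powr T)"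
    unfolding eventually_at_top_linorder by blast
  define r1 where "r1 = max 1 r0"
  \<comment> \<open>For negative \<open>T\<close> this is 0, which is harmless since
    \<open>r powr T\<close> is then at most 1 for \<open>r\<close> at least 1.\<close>
  define t where "t = nat \<lceil>T\<rceil>"
  have large: "mass_growth \<Gamma> q r \<le> c * r ^ t" if "r \<ge> r1" for r
  proof -
    have r: "r \<ge> 1" "r \<ge> r0" using that by (auto simp: r1_def)
    have "r powr T \<le> r powr real t" using r by (intro powr_mono) (auto simp: t_def real_nat_ceiling_ge)
    also have "\<dots> = r ^ t" using r by (simp add: powr_realpow)
    finally have p: "r powr T \<le> r ^ t" .
    have "mass_growth \<Gamma> q r \<le> norm (mass_growth \<Gamma> q r + g r)" using g[of r] by simp
    also have "\<dots> \<le> c * norm (r powr T)" using r0 r by blast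
    also have "\<dots> \<le> c * r ^ t" using p c by (intro mult_left_mono) auto
    finally show ?thesis .
  qed
  show ?thesis
  proof (rule that[of "c * r1 ^ t" t])
    fix r :: real assume r: "r \<ge> 1"
    define s where "s = max r r1"
    have r1: "r1 \<ge> 1" by (simp add: r1_def)
    have "mass_growth \<Gamma> q r \<le> mass_growth \<Gamma> q s"
      unfolding mass_growth_def by (intro infsum_mono2 loc) (auto simp: s_def)
    also have "\<dots> \<le> c * s ^ t" by (rule large) (simp add: s_def)
    also have "\<dots> \<le> c * (r1 * r) ^ t"
    proof -
      have "s \<le> r1 * r" unfolding s_def using r r1 mult_left_mono[of 1 r r1] mult_right_mono[of 1 r1 r] by simp
      then show ?thesis using c r r1 by (intro mult_left_mono power_mono) (auto simp: s_def)
    qed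
    finally show "mass_growth \<Gamma> q r \<le> c * r1 ^ t * r ^ t" by (simp add: power_mult_distrib mult.assoc)
  qed
qed

text \<open>Some test function near a support point has \<open>f \<phi> \<noteq> 0\<close>; at an
  almost period \<open>\<tau>\<close> its translate still gives a nonzero value, so the support of
  the translate meets that of \<open>f\<close>. Almost periods exist near every
  \<open>y\<close>.\<close>

lemma support_relatively_dense:
  fixes f :: "('n::finite) functional"
  assumes f: "tempered f" and nz: "nonzero_dist f" and at: "is_atomic_measure (dist_fourier f) \<Gamma> q"
    and growth: "\<And>r. r \<ge> 1 \<Longrightarrow> mass_growth \<Gamma> q r \<le> A * r ^ t"
  obtains R where "\<And>x. \<exists>l\<in>dist_support f. dist x l \<le> R"
proof -
  obtain l0 where l0: "l0 \<in> dist_support f" using dist_support_nonempty[OF f nz] by blast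
  moreover have "open (ball l0 1)" "l0 \<in> ball l0 1" by auto
  ultimately obtain \<phi> where \<phi>: "\<phi> \<in> test_fun" "fun_support \<phi> \<subseteq> ball l0 1" "f \<phi> \<noteq> 0"
    unfolding dist_support_def by blast
  obtain a where a: "(\<lambda>\<gamma>. norm (a \<gamma>)) summable_on \<Gamma>"
    "\<And>x. ((\<lambda>\<gamma>. a \<gamma> * echar (x \<bullet> \<gamma>)) has_sum f (\<lambda>u. \<phi> (u - x))) \<Gamma>"
    using translates_exponential_series[OF f at growth \<phi>(1)] by metis
  define F where "F x = f (\<lambda>u. \<phi> (u - x))" for x
  define e where "e = norm (f \<phi>) / 2"
  have e: "e > 0" using \<phi> by (simp add: e_def)
  obtain R where R: "\<And>y. \<exists>\<tau>. norm (\<tau> - y) \<le> R \<and> (\<forall>i\<in>{()}. \<forall>x. norm (F (x + \<tau>) - F x) \<le> e)"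
    using common_almost_periods[of "{()}" e "\<lambda>_. \<Gamma>" "\<lambda>_. F"] e a unfolding F_def by auto
  show ?thesis
  proof (rule that[of "R + 1 + norm l0"])
    fix y
    obtain \<tau> where \<tau>: "norm (\<tau> - y) \<le> R" "norm (F (0 + \<tau>) - F 0) \<le> e" using R[of y] by blast
    have "F 0 = f \<phi>" by (simp add: F_def)
    then have "F \<tau> \<noteq> 0" using \<tau>(2) e by (auto simp: e_def)
    then have "fun_support (\<lambda>u. \<phi> (u - \<tau>)) \<inter> dist_support f \<noteq> {}"
      unfolding F_def using vanish_off_dist_support[OF f test_fun_translate[OF \<phi>(1)]] by blast
    then obtain l where l: "l \<in> dist_support f" "l - \<tau> \<in> fun_support \<phi>"
      using fun_support_translate by blast
    then have "norm (l - \<tau> - l0) < 1" using \<phi>(2) by (auto simp: dist_norm norm_minus_commute)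
    moreover have "norm (y - l) \<le> norm (\<tau> - y) + (norm (l - \<tau> - l0) + norm l0)"
      using norm_triangle_ineq[of "l - \<tau> - l0" l0] norm_triangle_ineq[of "l - \<tau>" "\<tau> - y"]
      by (simp add: norm_minus_commute)
    ultimately have "dist y l \<le> R + 1 + norm l0" using \<tau>(1) by (simp add: dist_norm)
    then show "\<exists>l\<in>dist_support f. dist y l \<le> R + 1 + norm l0" using l(1) by blast
  qed
qed

text \<open>Testing against translates of a dual function reads off one coefficient of the expansion.\<close>

lemma support_point_matched:
  fixes f :: "('n::finite) functional" and \<omega> :: "'n multi_index \<Rightarrow> real ^ 'n \<Rightarrow> complex"
  assumes f: "tempered f" and disc: "discrete_set (dist_support f)"
    and \<kappa>: "(INF l\<in>dist_support f. kappa f l) > 0"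
    and \<omega>: "\<And>k. \<omega> k \<in> test_fun" "\<And>k. fun_support (\<omega> k) \<subseteq> ball 0 r"
      "\<And>k k'. mi_deriv k' (\<omega> k) 0 = (if k' = k then 1 else 0)"
    and sep: "\<And>l'. l' \<in> dist_support f \<Longrightarrow> dist l l' < r \<Longrightarrow> l' = l" and l: "l \<in> dist_support f"
    and near: "\<And>k. mi_size k \<le> dist_ord f \<Longrightarrow>
      norm (f (\<lambda>u. \<omega> k (u - z)) - f (\<lambda>u. \<omega> k (u - l))) \<le> (INF l\<in>dist_support f. kappa f l) / 2"
  shows "\<exists>l'\<in>dist_support f. dist l' z < r"
proof -
  obtain k where k: "mi_size k \<le> dist_ord f" "norm (dist_coeff f l k) \<ge> (INF l\<in>dist_support f. kappa f l)"
    using dist_coeff_lower_bound[OF \<kappa> l] by blast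
  have sup: "fun_support (\<lambda>u. \<omega> k (u - y)) \<subseteq> ball y r" for y
    using fun_support_translate[of "\<omega> k" y] \<omega>(2)[of k] by (force simp: dist_norm norm_minus_commute)
  have "fun_support (\<lambda>u. \<omega> k (u - l)) \<inter> dist_support f \<subseteq> {l}" using sup[of l] sep by force
  then have "f (\<lambda>u. \<omega> k (u - l)) =
      (\<Sum>j | mi_size j \<le> dist_ord f. dist_coeff f l j * (-1) ^ mi_size j * mi_deriv j (\<lambda>u. \<omega> k (u - l)) l)"
    using dist_eq_local_expansion[OF f disc test_fun_translate[OF \<omega>(1)] l] by blast
  also have "\<dots> = (\<Sum>j | mi_size j \<le> dist_ord f. if j = k then dist_coeff f l j * (-1) ^ mi_size j else 0)"
    by (intro sum.cong) (auto simp: mi_deriv_translate[OF test_fun_smooth[OF \<omega>(1)]] \<omega>(3))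
  also have "\<dots> = dist_coeff f l k * (-1) ^ mi_size k" using k(1) by (simp add: finite_mi_size_le)
  finally have "norm (f (\<lambda>u. \<omega> k (u - l))) = norm (dist_coeff f l k)" by (simp add: norm_mult norm_power)
  \<comment> \<open>The value at \<open>l\<close> is at least the infimum of \<open>kappa\<close> in
    size and changes by at most half of it.\<close>
  then have "f (\<lambda>u. \<omega> k (u - z)) \<noteq> 0" using near[OF k(1)] k(2) \<kappa> by auto
  then have "fun_support (\<lambda>u. \<omega> k (u - z)) \<inter> dist_support f \<noteq> {}"
    using vanish_off_dist_support[OF f test_fun_translate[OF \<omega>(1)]] by blast
  then show ?thesis using sup[of z] by (force simp: dist_commute)
qed

theorem theorem4:
  fixes f1 f2 :: "('n::finite) functional"
    and \<Gamma>1 \<Gamma>2 :: "(real ^ 'n) set"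
    and q1 q2 :: "real ^ 'n \<Rightarrow> complex"
    and T :: real
  assumes "tempered f1" and "tempered f2"
    and "nonzero_dist f1" and "nonzero_dist f2"
    and "discrete_set (dist_support f1)" and "discrete_set (dist_support f2)"
    and "discrete_set {l - l' | l l'. l \<in> dist_support f1 \<and> l' \<in> dist_support f2}"
    and "(INF l\<in>dist_support f1. kappa f1 l) > 0"
    and "(INF l\<in>dist_support f2. kappa f2 l) > 0"
    and "is_atomic_measure (dist_fourier f1) \<Gamma>1 q1"
    and "is_atomic_measure (dist_fourier f2) \<Gamma>2 q2"
    and "(\<lambda>r. mass_growth \<Gamma>1 q1 r + mass_growth \<Gamma>2 q2 r) \<in> O[at_top](\<lambda>r. r powr T)"
  shows "\<exists>L. full_rank_lattice L \<and>
    pure_crystal L (dist_support f1) \<and> pure_crystal L (dist_support f2)"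
proof -
  \<comment> \<open>Indexing by a Boolean, with \<open>\<not> b\<close> for the other distribution,
    lets the symmetric facts be proved once.\<close>
  define f where "f b = (if b then f1 else f2)" for b
  define \<Gamma> where "\<Gamma> b = (if b then \<Gamma>1 else \<Gamma>2)" for b
  define q where "q b = (if b then q1 else q2)" for b
  let ?A = "\<lambda>b. dist_support (f b)"
  have f: "tempered (f b)" "nonzero_dist (f b)" "discrete_set (?A b)" "(INF l\<in>?A b. kappa (f b) l) > 0"
    "is_atomic_measure (dist_fourier (f b)) (\<Gamma> b) (q b)" for b
    using assms unfolding f_def \<Gamma>_def q_def by simp_all
  have disc: "discrete_set {l - l' | l l'. l \<in> ?A b \<and> l' \<in> ?A (\<not> b)}" for b
    using assms(7) discrete_set_differences_swap[OF assms(7)] by (cases b) (simp_all add: f_def)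
  have mg: "mass_growth \<Gamma> q r \<ge> 0" for \<Gamma> :: "(real ^ 'n) set" and q r
    unfolding mass_growth_def by (intro infsum_nonneg) auto
  have "\<exists>C t. \<forall>r\<ge>1. mass_growth (\<Gamma> b) (q b) r \<le> C * r ^ t" for b
  proof -
    have big: "(\<lambda>r. mass_growth (\<Gamma> b) (q b) r + mass_growth (\<Gamma> (\<not> b)) (q (\<not> b)) r) \<in> O[at_top](\<lambda>r. r powr T)"
      using assms(12) by (cases b) (simp_all add: \<Gamma>_def q_def add.commute)
    show ?thesis
      by (rule mass_growth_polynomial[OF _ big mg]) (use f(5)[of b] in \<open>auto simp: is_atomic_measure_def\<close>)
  qed
  then obtain C t where growth: "\<And>b r. r \<ge> 1 \<Longrightarrow> mass_growth (\<Gamma> b) (q b) r \<le> C b * r ^ t b" by metis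
  have "\<exists>R. \<forall>x. \<exists>l\<in>?A b. dist x l \<le> R" for b
    using support_relatively_dense[OF f(1,2,5) growth, of b] by metis
  then obtain R0 where R0: "\<And>b x. \<exists>l\<in>?A b. dist x l \<le> R0 b" by metis
  define R where "R = max 1 (max (R0 True) (R0 False))"
  have R: "R > 0" "R0 b \<le> R" for b by (cases b; simp add: R_def)+
  have rd: "\<exists>l\<in>?A b. dist x l \<le> R" for b x using R0[where b=b and x=x] R(2)[of b] by force
  have "\<exists>\<delta>>0. \<forall>x\<in>?A b. \<forall>y\<in>?A b. dist x y < \<delta> \<longrightarrow> x = y" for b
    by (rule separated_of_discrete_differences[OF disc rd, of b]) blast
  then obtain \<delta> where \<delta>: "\<And>b. \<delta> b > 0"
    "\<And>b x y. x \<in> ?A b \<Longrightarrow> y \<in> ?A b \<Longrightarrow> dist x y < \<delta> b \<Longrightarrow> x = y" by metis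
  have ap: "\<exists>\<rho>. \<forall>y. \<exists>\<tau>. norm (\<tau> - y) \<le> \<rho> \<and>
      (\<forall>\<sigma>\<in>{\<tau>, - \<tau>}. near_period r (?A True) \<sigma> \<and> near_period r (?A False) \<sigma>)"
    if r: "r > 0" for r
  proof -
    define s where "s = min r (min (\<delta> True) (\<delta> False))"
    have s: "s > 0" "s \<le> r" "s \<le> \<delta> b" for b using r \<delta>(1) by (cases b; simp add: s_def)+
    have "\<forall>k. \<exists>\<omega>. \<omega> \<in> test_fun \<and> fun_support \<omega> \<subseteq> ball (0 :: real ^ 'n) s \<and>
        (\<forall>k'. mi_deriv k' \<omega> 0 = (if k' = k then 1 else 0))"
      using dual_test_fun_exists[OF s(1), of "0 :: real ^ 'n"] by metis
    then obtain \<omega> where \<omega>: "\<And>k. \<omega> k \<in> test_fun" "\<And>k. fun_support (\<omega> k) \<subseteq> ball (0 :: real ^ 'n) s"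
      "\<And>k k'. mi_deriv k' (\<omega> k) 0 = (if k' = k then 1 else 0)"
      by metis
    define K where "K b = (INF l\<in>?A b. kappa (f b) l)" for b
    define c where "c = min (K True) (K False)"
    have c: "c / 2 > 0" "c \<le> K b" for b
      using f(4)[of True] f(4)[of False] by (cases b; simp add: c_def K_def)+
    \<comment> \<open>The orders of the two distributions may differ, hence dependent pairs; the set
      is finite, so one \<open>\<tau>\<close> works for every dual function of both.\<close>
    define I where "I = (SIGMA b : UNIV. {k :: 'n multi_index. mi_size k \<le> dist_ord (f b)})"
    define F where "F i x = f (fst i) (\<lambda>u. \<omega> (snd i) (u - x))" for i x
    have finI: "finite I" unfolding I_def by (intro finite_SigmaI finite_mi_size_le) simp
    have series: "\<exists>a. (\<lambda>\<gamma>. norm (a \<gamma>)) summable_on \<Gamma> (fst i) \<and>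
      (\<forall>x. ((\<lambda>\<gamma>. a \<gamma> * echar (x \<bullet> \<gamma>)) has_sum F i x) (\<Gamma> (fst i)))" for i
      unfolding F_def
      by (rule translates_exponential_series[OF f(1,5) growth \<omega>(1), of "fst i" "snd i"]) auto
    obtain \<rho> where \<rho>: "\<And>y. \<exists>\<tau>. norm (\<tau> - y) \<le> \<rho> \<and> (\<forall>i\<in>I. \<forall>x. norm (F i (x + \<tau>) - F i x) \<le> c / 2)"
      using common_almost_periods[where F = F and \<Gamma> = "\<lambda>i. \<Gamma> (fst i)", OF finI c(1) series] by metis
    have "\<exists>\<tau>. norm (\<tau> - y) \<le> \<rho> \<and>
      (\<forall>\<sigma>\<in>{\<tau>, - \<tau>}. near_period r (?A True) \<sigma> \<and> near_period r (?A False) \<sigma>)" for y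
    proof -
      obtain \<tau> where \<tau>: "norm (\<tau> - y) \<le> \<rho>" "\<And>i x. i \<in> I \<Longrightarrow> norm (F i (x + \<tau>) - F i x) \<le> c / 2"
        using \<rho>[of y] by blast
      \<comment> \<open>The estimate is uniform in \<open>x\<close>, so shifting \<open>x\<close> by
        \<open>- \<tau>\<close> makes \<open>- \<tau>\<close> an almost period too.\<close>
      have neg: "norm (F i (x + - \<tau>) - F i x) \<le> c / 2" if "i \<in> I" for i x
        using \<tau>(2)[OF that, of "x + - \<tau>"] by (simp add: norm_minus_commute)
      have "near_period r (?A b) \<sigma>" if \<sigma>: "\<sigma> \<in> {\<tau>, - \<tau>}" for b \<sigma>
        unfolding near_period_def
      proof
        fix l assume l: "l \<in> ?A b"
        have "\<exists>l'\<in>?A b. dist l' (l + \<sigma>) < s"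
        proof (rule support_point_matched[OF f(1,3,4) \<omega> _ l])
          show "l' = l" if "l' \<in> ?A b" "dist l l' < s" for l'
            using \<delta>(2)[OF l that(1)] that(2) s(3)[of b] by simp
          fix k :: "'n multi_index" assume "mi_size k \<le> dist_ord (f b)"
          then have "(b, k) \<in> I" by (simp add: I_def)
          then have "norm (F (b, k) (l + \<sigma>) - F (b, k) l) \<le> c / 2" using \<sigma> \<tau>(2) neg by blast
          then show "norm (f b (\<lambda>u. \<omega> k (u - (l + \<sigma>))) - f b (\<lambda>u. \<omega> k (u - l))) \<le> (INF l\<in>?A b. kappa (f b) l) / 2"
            using c(2)[of b] unfolding F_def K_def by simp
        qed
        then show "\<exists>l'\<in>?A b. dist l' (l + \<sigma>) < r" using s(2) by force
      qed
      then show ?thesis using \<tau>(1) by blast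
    qed
    then show ?thesis by blast
  qed
  define L where "L = periods (?A True) \<inter> periods (?A False)"
  have disc': "discrete_set {l - l' | l l'. l \<in> ?A True \<and> l' \<in> ?A False}" using disc[of True] by simp
  obtain \<rho> where \<rho>: "\<And>y. \<exists>t\<in>L. norm (t - y) \<le> \<rho>"
    using periods_relatively_dense[OF rd rd R(1) disc' ap] unfolding L_def by metis
  obtain a where a: "a \<in> ?A True" using rd by blast
  have "full_rank_lattice L"
  proof (rule full_rank_lattice_of_discrete_subgroup[OF _ _ _ \<rho>])
    show "0 \<in> L" by (simp add: L_def periods_def)
    show "x - y \<in> L" if "x \<in> L" "y \<in> L" for x y using that periods_diff unfolding L_def by blast
    show "finite (L \<inter> cball 0 r)" for r
      using finite_periods_Int_cball[OF f(3) a, of r] unfolding L_def by (rule rev_finite_subset) blast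
  qed
  moreover have "pure_crystal L (?A b)" for b
    by (rule pure_crystal_of_periods[OF f(3) _ \<rho>]) (cases b; simp add: L_def)
  from this[of True] this[of False] have "pure_crystal L (dist_support f1)" "pure_crystal L (dist_support f2)"
    by (simp_all add: f_def)
  ultimately show ?thesis by blast
qed

end
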